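(* Let $r\ge 1$ be an integer, let $\gamma>0$ and $\alpha_1,\dots,\alpha_r>0$ be real numbers, and let $(\gamma_n)_{n\ge 0}$ be a sequence of positive real numbers such that for each $k\in\{1,\dots,r\}$, $\gamma_n/n^\gamma\to\alpha_k$ as $n\to\infty$ with $n\equiv k-1\bmod r$. Let $(P_n)_{n\ge0}$ be given by $P_n(z)=z^n$ for $0\le n\le r$ and $P_{n+1}(z)=zP_n(z)-\gamma_{n-r}P_{n-r}(z)$ for $n\ge r$, and let $Q_n(z,N)=N^{-\frac{n\gamma}{r+1}}P_n\big(N^{\frac{\gamma}{r+1}}z\big)$ for integers $N\geq 1$. Let $\mathcal{G}$ be the Stieltjes transform of the limiting zero distribution of the rescaled polynomials, $\mathcal G(z)=\lim_{N\to\infty}\frac1N\frac{Q_N'(z,N)}{Q_N(z,N)}$. Then $$\mathcal{G}(z)=\lim_{N\to\infty}\frac1N\frac{Q_N'(z,N)}{Q_N(z,N)}=-\frac1r\int_0^1\frac{\partial_z\Phi(z,t)}{\Phi(z,t)}\,dt,$$ uniformly on compact subsets of $\mathbb{C}\setminus\Sigma$. Moreover, for $z\in\mathbb{C}\setminus\Sigma$ and with $y=z^{r+1}$, $$\mathcal{G}(z)=-\frac{1}{r\,z}\left(1-\frac{r+1}{\gamma}\,\frac{1}{\big(F(y)A_r(F(y))\big)^{1/\gamma}}\int_0^{F(y)}\big(u\,A_r(u)\big)^{1/\gamma}\,\frac{1}{u}\,du\right).$$ Here $\Sigma$, $\Phi$, $A_r$ and $F$ are as defined in the context.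
   Context: $\Sigma=\bigcup_{k=0}^{r}\{x\,e^{2\pi i k/(r+1)}: x\ge 0\}$. The prime denotes $d/dz$. Limiting zero distribution: the weak$^*$ limit $\mu$ of the normalized zero counting measures $\mu_N=\frac1N\sum_{x:\,Q_N(x,N)=0}\delta_x$ (zeros counted with multiplicity); its Stieltjes transform is $\mathcal G(z)=\int\frac{d\mu(x)}{z-x}$, obtained as the limit of $\int\frac{d\mu_N(x)}{z-x}=\frac1N\frac{Q_N'(z,N)}{Q_N(z,N)}$. For $t>0$, $\Phi(z,t)=\lim_{n\to\infty,\,n/N\to t}\frac{Q_n(z,N)}{Q_{n+r}(z,N)}$ for $z\in\mathbb C\setminus\Sigma$; it is the solution, analytic in $z\in\mathbb{C}\setminus\Sigma$, of $1=\Phi(z,t)\prod_{j=1}^r(z-\alpha_jt^\gamma\Phi(z,t))$ with $z^r\Phi(z,t)\to1$ as $z\to\infty$. $A_r(u)=\prod_{j=1}^r(1-\alpha_ju)$, and $F$ is the function with $1=yF(y)A_r(F(y))$ and $yF(y)\to1$ as $y\to\infty$, related to $\Phi$ by $\Phi(z,t)=t^{-\gamma}zF(t^{-\gamma}z^{r+1})$. Branch convention: the integral is taken along the path $u=F(t^{-\gamma}y)$, $t\in(0,1]$, running from $0$ (as $t\to0^+$) to $F(y)$ (at $t=1$); along it $\frac{uA_r(u)}{F(y)A_r(F(y))}=t^\gamma$, and the $1/\gamma$-th power of this quotient is taken to be $t$. *)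

theory Defs
  imports "HOL-Complex_Analysis.Complex_Analysis" "HOL-Number_Theory.Cong"
begin

text \<open>
  Parameters throughout: the period \<open>r\<close>, the growth exponent \<open>\<gamma>\<close>, the recurrence
  coefficients \<open>c n\<close> (the sequence $\gamma_n$), and the limits \<open>\<alpha> 1, \<dots>, \<alpha> r\<close> of
  \<open>c n / n powr \<gamma>\<close> along the residue classes modulo \<open>r\<close>.
\<close>

definition star :: "nat \<Rightarrow> complex set" where
  "star r = (\<Union>k\<in>{0..r}. {of_real x * exp (2 * of_real pi * \<i> * of_nat k / of_nat (r + 1)) |x::real. 0 \<le> x})"

fun P :: "nat \<Rightarrow> (nat \<Rightarrow> real) \<Rightarrow> nat \<Rightarrow> complex poly" where
  "P r c 0 = 1"
| "P r c (Suc n) =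
     (if n < r then monom 1 (Suc n)
      else [:0, 1:] * P r c n - smult (of_real (c (n - r))) (P r c (n - r)))"

definition Q :: "nat \<Rightarrow> real \<Rightarrow> (nat \<Rightarrow> real) \<Rightarrow> nat \<Rightarrow> nat \<Rightarrow> complex poly" where
  "Q r \<gamma> c n N =
     smult (of_real (real N powr (- (real n * \<gamma> / real (r + 1)))))
       (pcompose (P r c n) [:0, of_real (real N powr (\<gamma> / real (r + 1))):])"

text \<open>
  The zero counting measure of \<open>p\<close> with total weight \<open>degree p / N\<close>: every zero \<open>x\<close>
  carries the mass \<open>order x p / N\<close>, where \<open>order x p\<close> is its multiplicity.
\<close>

definition zero_measure :: "complex poly \<Rightarrow> nat \<Rightarrow> complex measure" where
  "zero_measure p N =
     distr (point_measure {x. poly p x = 0} (\<lambda>x. ennreal (real (order x p) / real N))) borel (\<lambda>x. x)"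

definition weak_star_limit :: "(nat \<Rightarrow> complex measure) \<Rightarrow> complex measure \<Rightarrow> bool" where
  "weak_star_limit M \<mu> \<longleftrightarrow>
     sets \<mu> = sets borel \<and> finite_measure \<mu> \<and>
     (\<forall>f :: complex \<Rightarrow> real. continuous_on UNIV f \<and> bounded (range f) \<longrightarrow>
        (\<lambda>N. integral\<^sup>L (M N) f) \<longlonglongrightarrow> integral\<^sup>L \<mu> f)"

text \<open>There is at most one weak-star limit, so the choice operator is harmless.\<close>

definition limiting_zero_distribution :: "nat \<Rightarrow> real \<Rightarrow> (nat \<Rightarrow> real) \<Rightarrow> complex measure" where
  "limiting_zero_distribution r \<gamma> c =
     (SOME \<mu>. weak_star_limit (\<lambda>N. zero_measure (Q r \<gamma> c N N) N) \<mu>)"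

definition stieltjes :: "complex measure \<Rightarrow> complex \<Rightarrow> complex" where
  "stieltjes \<mu> z = (\<integral>x. 1 / (z - x) \<partial>\<mu>)"

definition G :: "nat \<Rightarrow> real \<Rightarrow> (nat \<Rightarrow> real) \<Rightarrow> complex \<Rightarrow> complex" where
  "G r \<gamma> c = stieltjes (limiting_zero_distribution r \<gamma> c)"

text \<open>The filter on pairs \<open>(n, N)\<close> describing \<open>n \<rightarrow> \<infinity>\<close>, \<open>n / N \<rightarrow> t\<close>.\<close>

definition ratio_filter :: "real \<Rightarrow> (nat \<times> nat) filter" where
  "ratio_filter t =
     inf (filtercomap fst at_top) (filtercomap (\<lambda>(n, N). real n / real N) (nhds t))"

definition Phi :: "nat \<Rightarrow> real \<Rightarrow> (nat \<Rightarrow> real) \<Rightarrow> complex \<Rightarrow> real \<Rightarrow> complex" where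
  "Phi r \<gamma> c z t =
     Lim (ratio_filter t) (\<lambda>(n, N). poly (Q r \<gamma> c n N) z / poly (Q r \<gamma> c (n + r) N) z)"

definition A :: "nat \<Rightarrow> (nat \<Rightarrow> real) \<Rightarrow> complex \<Rightarrow> complex" where
  "A r \<alpha> u = (\<Prod>j=1..r. 1 - of_real (\<alpha> j) * u)"

text \<open>
  The plane cut along the nonnegative reals is the image of the complement of \<open>star r\<close> under
  \<open>z \<mapsto> z ^ (r + 1)\<close>. On this domain the three conditions below have exactly one solution;
  the values of \<open>F\<close> on the cut are irrelevant.
\<close>

definition F :: "nat \<Rightarrow> (nat \<Rightarrow> real) \<Rightarrow> complex \<Rightarrow> complex" where
  "F r \<alpha> = (SOME f. f holomorphic_on (- \<real>\<^sub>\<ge>\<^sub>0) \<and>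
                 (\<forall>y \<in> - \<real>\<^sub>\<ge>\<^sub>0. 1 = y * f y * A r \<alpha> (f y)) \<and>
                 ((\<lambda>y. y * f y) \<longlongrightarrow> 1) (inf at_infinity (principal (- \<real>\<^sub>\<ge>\<^sub>0))))"

definition F_path :: "nat \<Rightarrow> real \<Rightarrow> (nat \<Rightarrow> real) \<Rightarrow> complex \<Rightarrow> real \<Rightarrow> complex" where
  "F_path r \<gamma> \<alpha> y t = (if t = 0 then 0 else F r \<alpha> (of_real (t powr (- \<gamma>)) * y))"

text \<open>
  The quantity
  \[ \frac{1}{(F(y) A_r(F(y)))^{1/\gamma}} \int_0^{F(y)} (u A_r(u))^{1/\gamma} \frac{du}{u}. \]
  The two powers are combined into the \<open>1/\<gamma>\<close>-th power of the quotient
  \<open>u A(u) / (F(y) A(F(y)))\<close>. At the point \<open>F_path r \<gamma> \<alpha> y t\<close> of the path this quotient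
  is the nonnegative real number \<open>t powr \<gamma>\<close>, so the principal power used here is \<open>t\<close>,
  which is the prescribed branch.
\<close>

definition F_integrand :: "nat \<Rightarrow> real \<Rightarrow> (nat \<Rightarrow> real) \<Rightarrow> complex \<Rightarrow> complex \<Rightarrow> complex" where
  "F_integrand r \<gamma> \<alpha> y u =
     ((u * A r \<alpha> u) / (F r \<alpha> y * A r \<alpha> (F r \<alpha> y))) powr of_real (1 / \<gamma>) * (1 / u)"

definition F_integral :: "nat \<Rightarrow> real \<Rightarrow> (nat \<Rightarrow> real) \<Rightarrow> complex \<Rightarrow> complex" where
  "F_integral r \<gamma> \<alpha> y = contour_integral (F_path r \<gamma> \<alpha> y) (F_integrand r \<gamma> \<alpha> y)"

end

theory Submission
  imports
    Defs
    "HOL-Computational_Algebra.Fundamental_Theorem_Algebra"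
    "HOL-Probability.Probability"
    "HOL-Real_Asymp.Real_Asymp"
begin

text \<open>
  In the variable $s = z^{-(r+1)}$ one has $P_n(z) = z^n p_n(s)$ with
  $p_{n+1} = p_n - \gamma_{n-r}\, s\, p_{n-r}$, and the quotient of $P_n$ by $P_{n+r}$ becomes
  $z^{-r} f_n(s)$ with $f_n = p_n / p_{n+r}$. Three facts about $f_n$ on the plane cut along
  $[0,\infty)$ carry the proof.

  First, the arguments of the one-step quotients $p_n/p_{n+1}$ are controlled by an induction over
  windows of length $r$; hence $p_n$ has no zeros off the cut and $f_n$ omits $(-\infty,0]$. As
  $\log f_n$ has bounded imaginary part, its derivative is locally bounded, uniformly in $n$ and
  under all scalings $s \mapsto xs$. Second, near $s = 0$ the recurrence is a contraction, so that
  $f_n(s/n^\gamma)$ converges to the solution $h$ of $s\,h(s)\,A_r(s\,h(s)) = s$ given by the inverse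
  function theorem. Third, Vitali's theorem extends the convergence of $f_n(s/n^\gamma)$ and of
  its logarithmic derivative to the whole cut plane; in particular $F(y) = h(1/y)/y$ and
  $\Phi(z,t) = z^{-r} h(t^\gamma z^{-(r+1)})$.

  Since $p_N$ is a product of reciprocals of the $f_n$ with $n \equiv N$ modulo $r$, the logarithmic
  derivative of $Q_N$ is a Riemann sum and converges to the stated integral. Its convergence off the
  star gives that of all moments of the zero distributions; together with their rotational symmetry
  and a bound for the zeros this yields the existence of the weak-star limit, whose Stieltjes
  transform is then the limit already found. The substitution $u = F(t^{-\gamma} y)$ turns the
  integral over $t$ into the one over $u$.
\<close>

section \<open>The reduced polynomials off the cut\<close>

text \<open>One-step quotients behave differently along different residues of n modulo r. Over r
  consecutive steps each \<alpha>_k occurs exactly once, so the quotients over blocks can share one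
  limit; this is also why the sums over n run through a single residue class.

  Away from s = 0 there is no a priori bound for f_n: the recurrence contracts only for small s.
  What survives is a bound for the argument. It is invariant under s -> xs for x > 0, as the cut
  plane is, so one estimate serves all n and N at once. A bound for the logarithmic derivative
  leaves log f_n free up to a constant; the convergence at one point near 0 controls that constant.

  Moments x^k alone do not determine a measure in the plane. On the star x^(r+1) = |x|^(r+1), so the
  moments whose order is a multiple of r+1 determine the distribution of the modulus, and the
  rotational symmetry determines the rest.\<close>

fun reduced_P :: "nat \<Rightarrow> (nat \<Rightarrow> real) \<Rightarrow> nat \<Rightarrow> complex \<Rightarrow> complex" where
  "reduced_P r c 0 s = 1"
| "reduced_P r c (Suc n) s =
     (if n < r then 1 else reduced_P r c n s - of_real (c (n - r)) * s * reduced_P r c (n - r) s)"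

lemma reduced_P_initial: "n \<le> r \<Longrightarrow> reduced_P r c n s = 1"
  by (cases n) auto

lemma reduced_P_add_Suc: "reduced_P r c (Suc (n + r)) s = reduced_P r c (n + r) s - of_real (c n) * s * reduced_P r c n s"
  by simp

declare reduced_P.simps(2) [simp del]

lemma reduced_P_cnj: "reduced_P r c n (cnj s) = cnj (reduced_P r c n s)"
  by (induction r c n s rule: reduced_P.induct) (auto simp: reduced_P.simps(2))

lemma reduced_P_holomorphic [holomorphic_intros]:
  assumes "g holomorphic_on S"
  shows "(\<lambda>s. reduced_P r c n (g s)) holomorphic_on S"
proof (induction n rule: less_induct)
  case (less n)
  show ?case
  proof (cases n)
    case (Suc m)
    show ?thesis
    proof (cases "m < r")
      case False
      with less Suc show ?thesis
        by (auto simp: reduced_P.simps(2) intro!: holomorphic_intros assms)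
    qed (auto simp: Suc reduced_P.simps(2))
  qed auto
qed

lemma poly_P_eq:
  assumes "z \<noteq> 0"
  shows "poly (P r c n) z = z ^ n * reduced_P r c n (1 / z ^ (r + 1))"
proof (induction n rule: less_induct)
  case (less n)
  show ?case
  proof (cases n)
    case (Suc m)
    show ?thesis
    proof (cases "m < r")
      case True
      then show ?thesis by (simp add: Suc reduced_P.simps(2) poly_monom)
    next
      case False
      have "z ^ Suc m = z ^ (m - r) * z ^ (r + 1)"
        using False by (simp flip: power_add)
      with less[of m] less[of "m - r"] Suc False assms show ?thesis
        by (simp add: reduced_P.simps(2) field_simps)
    qed
  qed auto
qed

section \<open>Quotients of the reduced polynomials\<close>

definition step_ratio :: "nat \<Rightarrow> (nat \<Rightarrow> real) \<Rightarrow> nat \<Rightarrow> complex \<Rightarrow> complex" where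
  "step_ratio r c n s = reduced_P r c n s / reduced_P r c (Suc n) s"

definition block_ratio :: "nat \<Rightarrow> (nat \<Rightarrow> real) \<Rightarrow> nat \<Rightarrow> complex \<Rightarrow> complex" where
  "block_ratio r c n s = reduced_P r c n s / reduced_P r c (n + r) s"

lemma block_ratio_eq_prod_step_ratio:
  assumes "\<And>m. m \<le> n + r \<Longrightarrow> reduced_P r c m s \<noteq> 0"
  shows "block_ratio r c n s = (\<Prod>i\<in>{n..<n + r}. step_ratio r c i s)"
proof -
  have "(\<Prod>i\<in>{n..<n + k}. step_ratio r c i s) = reduced_P r c n s / reduced_P r c (n + k) s" if "k \<le> r" for k
    using that
  proof (induction k)
    case 0
    then show ?case using assms[of n] by simp
  next
    case (Suc k)
    have "reduced_P r c (n + k) s \<noteq> 0" using assms[of "n + k"] Suc.prems by simp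
    with Suc show ?case by (simp add: prod.atLeastLessThan_Suc step_ratio_def)
  qed
  from this[of r] show ?thesis by (simp add: block_ratio_def)
qed

lemma reduced_P_step:
  assumes "reduced_P r c (n + r) s \<noteq> 0"
  shows "reduced_P r c (Suc (n + r)) s = reduced_P r c (n + r) s * (1 - of_real (c n) * s * block_ratio r c n s)"
  using assms by (simp add: reduced_P_add_Suc block_ratio_def field_simps)

lemma step_ratio_step:
  assumes "reduced_P r c (n + r) s \<noteq> 0"
  shows "step_ratio r c (n + r) s = 1 / (1 - of_real (c n) * s * block_ratio r c n s)"
  unfolding step_ratio_def reduced_P_step[OF assms] using assms by simp

text \<open>1 - exp a is the sum of 1 and of -exp a, a vector of the upper half plane with argument
  pi + Im a. Adding a positive number turns such a vector towards the positive axis, so the argument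
  of the sum lies strictly between 0 and pi + Im a; the reciprocal reverses the sign.\<close>

lemma Arg_one_minus_lower:
  assumes "- pi < Im a" "Im a < 0"
  shows "1 - exp a \<noteq> 0" "Im (Ln (1 / (1 - exp a))) < 0" "- (pi + Im a) < Im (Ln (1 / (1 - exp a)))"
proof -
  define v where "v = exp a"
  have "sin (Im a) < 0" using assms sin_gt_zero[of "- Im a"] by simp
  then have imv: "Im v < 0" by (simp add: v_def Im_exp mult_pos_neg)
  show nz: "1 - exp a \<noteq> 0"
    using imv unfolding v_def by (metis one_complex.sel(2) less_irrefl right_minus_eq)
  define b where "b = Im (Ln (1 - v))"
  have b: "0 < b" "b < pi"
    using imv nz Im_Ln_pos_lt_imp[of "1 - v"] Im_Ln_pos_lt[of "1 - v"] by (auto simp: b_def v_def)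
  have npr: "1 - v \<notin> \<real>\<^sub>\<le>\<^sub>0"
    using imv by (auto simp: complex_nonpos_Reals_iff)
  have inv: "Ln (1 / (1 - v)) = - Ln (1 - v)"
    using Ln_inverse[OF npr] by (simp add: inverse_eq_divide)
  show "Im (Ln (1 / (1 - exp a))) < 0"
    using inv b by (simp add: b_def v_def)
  \<comment> \<open>exp w is (1 - v) / (-v), and Im w is the difference of the two arguments to be
    compared. It is less than pi, so a negative sine makes it negative.\<close>
  define w where "w = Ln (1 - v) - (a + \<i> * pi)"
  have "exp w = (1 - v) / (- v)"
    using nz by (simp add: w_def exp_diff exp_add v_def)
  also have "\<dots> = 1 - 1 / v"
    by (simp add: v_def field_simps)
  finally have "Im (exp w) = - Im (1 / v)" by simp
  also have "- Im (1 / v) = Im v / (cmod v)\<^sup>2"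
    by (simp add: Im_divide cmod_power2)
  also have "\<dots> < 0" using imv by (simp add: divide_neg_pos v_def)
  finally have "sin (Im w) < 0" by (simp add: Im_exp mult_less_0_iff)
  moreover have "Im w = b - (pi + Im a)" by (simp add: w_def b_def)
  ultimately have "b - (pi + Im a) < 0"
    using sin_ge_zero[of "b - (pi + Im a)"] b assms by force
  then show "- (pi + Im a) < Im (Ln (1 / (1 - exp a)))"
    using inv by (simp add: b_def v_def)
qed

lemma exp_notin_nonpos_Reals:
  assumes "\<bar>Im a\<bar> < pi"
  shows "exp a \<notin> \<real>\<^sub>\<le>\<^sub>0"
proof -
  have "Ln (exp a) = a" using assms by (intro Ln_exp) auto
  then show ?thesis
    using Im_Ln_eq_pi[of "exp a"] assms Ln_exp[of a]
    by (smt (verit, ccfv_threshold) complex_eq_iff complex_nonpos_Reals_iff exp_not_eq_zero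
       zero_complex.sel)
qed

locale positive_recurrence =
  fixes r :: nat and c :: "nat \<Rightarrow> real"
  assumes r_pos: "1 \<le> r" and c_pos: "\<And>n. 0 < c n"
begin

abbreviation p where "p \<equiv> reduced_P r c"
abbreviation w where "w \<equiv> step_ratio r c"
abbreviation f where "f \<equiv> block_ratio r c"

text \<open>The invariant is the lower bound for the sum of the arguments of \<open>r\<close> consecutive quotients.
  The new quotient has argument above $-(\pi + \arg s + T)$, where \<open>T\<close> is the old
  sum, and the quotient leaving the window has argument at most 0.\<close>

lemma lower_half_plane_aux:
  assumes s: "Im s < 0"
  shows "(\<forall>m\<le>n + r. p m s \<noteq> 0) \<and> (\<forall>m<n + r. Im (Ln (w m s)) \<le> 0) \<and>
    - pi - Arg s < (\<Sum>i\<in>{n..<n + r}. Im (Ln (w i s)))"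
proof (induction n)
  case 0
  have "w m s = 1" if "m < r" for m
    using that by (simp add: step_ratio_def reduced_P_initial)
  moreover have "- pi < Arg s" by (rule mpi_less_Arg)
  ultimately show ?case by (simp add: reduced_P_initial)
next
  case (Suc n)
  have s0: "s \<noteq> 0" using s by auto
  have args: "Arg s < 0" "- pi < Arg s"
    using s Arg_lt_pi[of s] Arg_neg_iff[of s] mpi_less_Arg by auto
  have nz: "p m s \<noteq> 0" if "m \<le> n + r" for m using Suc that by blast
  have wnz: "w m s \<noteq> 0" if "m < n + r" for m
    using nz[of m] nz[of "Suc m"] that by (simp add: step_ratio_def)
  define T where "T = (\<Sum>i\<in>{n..<n + r}. Ln (w i s))"
  have fT: "f n s = exp T"
    using nz wnz by (simp add: block_ratio_eq_prod_step_ratio T_def exp_sum)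
  \<comment> \<open>A sum of logarithms, not the principal logarithm of the product: the invariant
    puts its imaginary part into (-pi, 0), as \<open>Arg_one_minus_lower\<close> requires.\<close>
  define a where "a = of_real (ln (c n)) + Ln s + T"
  have v: "of_real (c n) * s * f n s = exp a"
    using s0 c_pos[of n] by (simp add: a_def fT exp_add exp_of_real)
  have imT: "Im T = (\<Sum>i\<in>{n..<n + r}. Im (Ln (w i s)))" by (simp add: T_def)
  have "Im T \<le> 0" unfolding imT using Suc by (intro sum_nonpos) auto
  have imT2: "- pi - Arg s < Im T" using Suc imT by simp
  have ima: "Im a = Arg s + Im T" using s0 by (simp add: a_def Arg_eq_Im_Ln)
  have a: "- pi < Im a" "Im a < 0" using ima imT2 \<open>Im T \<le> 0\<close> args by auto
  note arg = Arg_one_minus_lower[OF a]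
  have wn: "w (n + r) s = 1 / (1 - exp a)"
    using step_ratio_step[OF nz[of "n + r"]] v by simp
  have "p (Suc (n + r)) s \<noteq> 0"
    using reduced_P_step[OF nz[of "n + r"]] v arg(1) nz[of "n + r"] by simp
  then have A: "\<forall>m\<le>Suc n + r. p m s \<noteq> 0" using nz by (auto simp: le_Suc_eq)
  have B: "\<forall>m<Suc n + r. Im (Ln (w m s)) \<le> 0"
    using Suc arg(2) by (auto simp: less_Suc_eq wn)
  have "(\<Sum>i\<in>{Suc n..<Suc n + r}. Im (Ln (w i s))) =
     Im T - Im (Ln (w n s)) + Im (Ln (w (n + r) s))"
  proof -
    have "(\<Sum>i\<in>{n..<Suc (n + r)}. Im (Ln (w i s))) = Im T + Im (Ln (w (n + r) s))"
      by (simp add: imT)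
    moreover have "(\<Sum>i\<in>{n..<Suc (n + r)}. Im (Ln (w i s))) =
       Im (Ln (w n s)) + (\<Sum>i\<in>{Suc n..<Suc n + r}. Im (Ln (w i s)))"
      by (subst sum.atLeast_Suc_lessThan) auto
    ultimately show ?thesis by linarith
  qed
  moreover have "Im (Ln (w n s)) \<le> 0" using Suc r_pos by auto
  moreover have "- (pi + Im a) < Im (Ln (w (n + r) s))" using arg(3) by (simp only: wn)
  ultimately have "- pi - Arg s < (\<Sum>i\<in>{Suc n..<Suc n + r}. Im (Ln (w i s)))"
    using ima by linarith
  with A B show ?case by blast
qed

text \<open>For Im s < 0 the window bound puts the argument of f_n into (-pi, 0]: it exceeds -pi -
  Arg s, and Arg s < 0. As the coefficients are real, conjugation transfers this to Im s > 0. The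
  negative axis is treated directly.\<close>

lemma reduced_P_and_block_ratio_off_cut:
  assumes s: "s \<notin> \<real>\<^sub>\<ge>\<^sub>0"
  shows "p n s \<noteq> 0 \<and> f n s \<notin> \<real>\<^sub>\<le>\<^sub>0"
proof -
  have lower: "p n s \<noteq> 0 \<and> f n s \<notin> \<real>\<^sub>\<le>\<^sub>0" if s: "Im s < 0" for s
  proof -
    note * = lower_half_plane_aux[OF s, of n]
    have nz: "p m s \<noteq> 0" if "m \<le> n + r" for m using * that by blast
    have wnz: "w m s \<noteq> 0" if "m < n + r" for m
      using nz[of m] nz[of "Suc m"] that by (simp add: step_ratio_def)
    define T where "T = (\<Sum>i\<in>{n..<n + r}. Ln (w i s))"
    have fT: "f n s = exp T"
      using nz wnz by (simp add: block_ratio_eq_prod_step_ratio T_def exp_sum)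
    have imT: "Im T = (\<Sum>i\<in>{n..<n + r}. Im (Ln (w i s)))" by (simp add: T_def)
    have "Im T \<le> 0" unfolding imT using * by (intro sum_nonpos) auto
    moreover have "Arg s < 0" using s Arg_neg_iff[of s] by auto
    ultimately have "\<bar>Im T\<bar> < pi" using * imT by auto
    with exp_notin_nonpos_Reals[of T] nz[of n] fT show ?thesis by simp
  qed
  consider "Im s < 0" | "Im s > 0" | "Im s = 0" "Re s < 0"
    using s by (force simp: complex_nonneg_Reals_iff)
  then show ?thesis
  proof cases
    case 1
    then show ?thesis by (rule lower)
  next
    case 2
    then have "p n (cnj s) \<noteq> 0 \<and> f n (cnj s) \<notin> \<real>\<^sub>\<le>\<^sub>0" by (intro lower) simp
    then show ?thesis
      by (auto simp: reduced_P_cnj block_ratio_def complex_nonpos_Reals_iff simp flip: complex_cnj_divide)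
  next
    case 3
    then obtain x where x: "s = of_real x" "x < 0" by (metis complex_is_Real_iff Reals_cases Re_complex_of_real)
    \<comment> \<open>For s < 0 the recurrence adds a nonnegative multiple of an earlier value, so
      all values are real and at least 1, and their quotients are positive.\<close>
    have "\<exists>a\<ge>1. p n s = of_real a" for n
    proof (induction n rule: less_induct)
      case (less n)
      show ?case
      proof (cases "n \<le> r")
        case True
        then show ?thesis by (auto simp: reduced_P_initial intro!: exI[of _ 1])
      next
        case False
        then obtain m where n: "n = Suc (m + r)" by (metis add.commute less_imp_Suc_add not_le)
        from less[of m] less[of "m + r"] n obtain a b
          where "a \<ge> 1" "b \<ge> 1" "p m s = of_real a" "p (m + r) s = of_real b" by auto
        moreover from this have "c m * x * a \<le> 0"
          using c_pos[of m] x by (simp add: mult_nonneg_nonpos mult_nonpos_nonneg)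
        ultimately show ?thesis
          unfolding n reduced_P_add_Suc x
          by (intro exI[of _ "b - c m * x * a"]) (auto simp: x)
      qed
    qed
    from this[of n] this[of "n + r"] show ?thesis
      by (auto simp: block_ratio_def complex_nonpos_Reals_iff divide_le_0_iff simp flip: of_real_divide)
  qed
qed

lemmas reduced_P_nonzero = reduced_P_and_block_ratio_off_cut[THEN conjunct1]
lemmas block_ratio_notin_nonpos = reduced_P_and_block_ratio_off_cut[THEN conjunct2]

end

section \<open>Convergence near the origin\<close>

text \<open>Halved factors lie in the closed unit disc, where \<open>norm_prod_diff\<close> bounds a
  difference of products by the sum of the differences. Undoing the halving costs 2 to the power
  \<open>card I\<close>; the last factor 2 is the Lipschitz constant of (1/2) / (1 - u) on the disc
  of radius 1/2.\<close>

lemma norm_prod_inverse_diff_le: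
  fixes x y :: "'a \<Rightarrow> complex"
  assumes "\<And>i. i \<in> I \<Longrightarrow> norm (x i) \<le> 1 / 2" "\<And>i. i \<in> I \<Longrightarrow> norm (y i) \<le> 1 / 2"
  shows "norm ((\<Prod>i\<in>I. 1 / (1 - x i)) - (\<Prod>i\<in>I. 1 / (1 - y i))) \<le> 2 ^ (card I + 1) * (\<Sum>i\<in>I. norm (x i - y i))"
proof -
  have low: "1 / 2 \<le> norm (1 - u)" if "norm u \<le> 1 / 2" for u :: complex
    using norm_triangle_ineq2[of 1 u] that by simp
  have half: "norm ((1 / 2) / (1 - u)) \<le> 1" if "norm u \<le> 1 / 2" for u :: complex
  proof -
    have "norm ((1 / 2) / (1 - u)) = (1 / 2) / norm (1 - u)" by (simp only: norm_divide) simp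
    also have "\<dots> \<le> 1" using low[OF that] by (subst divide_le_eq_1) auto
    finally show ?thesis .
  qed
  have diff: "norm ((1 / 2) / (1 - u) - (1 / 2) / (1 - v)) \<le> 2 * norm (u - v)"
    if "norm u \<le> 1 / 2" "norm v \<le> 1 / 2" for u v :: complex
  proof -
    have "1 - u \<noteq> 0" "1 - v \<noteq> 0" using low[OF that(1)] low[OF that(2)] by auto
    moreover have "(1 / 2) / a - (1 / 2) / b = ((1 / 2) / a) * ((b - a) / b)"
      if "a \<noteq> 0" "b \<noteq> 0" for a b :: complex
      using that by (simp add: divide_simps)
    ultimately have "(1 / 2) / (1 - u) - (1 / 2) / (1 - v) = ((1 / 2) / (1 - u)) * (((1 - v) - (1 - u)) / (1 - v))"
      by blast
    also have "(1 - v) - (1 - u) = u - v" by simp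
    finally have "(1 / 2) / (1 - u) - (1 / 2) / (1 - v) = ((1 / 2) / (1 - u)) * ((u - v) / (1 - v))" .
    then have "norm ((1 / 2) / (1 - u) - (1 / 2) / (1 - v)) \<le> 1 * (norm (u - v) / norm (1 - v))"
      using half[OF that(1)] by (simp only: norm_mult norm_divide) (intro mult_right_mono, auto simp: norm_divide)
    also have "\<dots> \<le> norm (u - v) / (1 / 2)"
      using low[OF that(2)] by (simp only: mult_1) (intro divide_left_mono, auto)
    finally show ?thesis by simp
  qed
  have scale: "(\<Prod>i\<in>I. 1 / (1 - u i)) = 2 ^ card I * (\<Prod>i\<in>I. (1 / 2) / (1 - u i))" for u :: "'a \<Rightarrow> complex"
  proof -
    have "(\<Prod>i\<in>I. 1 / (1 - u i)) = (\<Prod>i\<in>I. 2 * ((1 / 2) / (1 - u i)))"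
      by (intro prod.cong refl) (simp only: times_divide_eq_right, simp)
    then show ?thesis by (simp only: prod.distrib prod_constant)
  qed
  have "norm ((\<Prod>i\<in>I. 1 / (1 - x i)) - (\<Prod>i\<in>I. 1 / (1 - y i))) =
     2 ^ card I * norm ((\<Prod>i\<in>I. (1 / 2) / (1 - x i)) - (\<Prod>i\<in>I. (1 / 2) / (1 - y i)))"
    unfolding scale by (simp only: right_diff_distrib[symmetric] norm_mult norm_power) simp
  also have "\<dots> \<le> 2 ^ card I * (\<Sum>i\<in>I. norm ((1 / 2) / (1 - x i) - (1 / 2) / (1 - y i)))"
    by (intro mult_left_mono norm_prod_diff half assms) auto
  also have "\<dots> \<le> 2 ^ card I * (\<Sum>i\<in>I. 2 * norm (x i - y i))"
    by (intro mult_left_mono sum_mono diff assms) auto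
  finally show ?thesis by (simp add: sum_distrib_left mult_ac)
qed

lemma bij_betw_add_mod:
  fixes n :: nat
  assumes "0 < n"
  shows "bij_betw (\<lambda>i. (m + i) mod n) {..<n} {..<n}"
proof -
  have "inj_on (\<lambda>i. (m + i) mod n) {..<n}"
  proof (rule inj_onI)
    fix i j assume ij: "i \<in> {..<n}" "j \<in> {..<n}" "(m + i) mod n = (m + j) mod n"
    then have "[m + i = m + j] (mod n)" by (simp add: cong_def)
    then have "[i = j] (mod n)" by (simp add: cong_add_lcancel_nat)
    with ij show "i = j" by (simp add: cong_def)
  qed
  moreover have "(\<lambda>i. (m + i) mod n) ` {..<n} \<subseteq> {..<n}" using assms by auto
  ultimately show ?thesis by (simp add: bij_betw_def endo_inj_surj)
qed

text \<open>A window of r consecutive indices meets every residue once. Hence a periodic product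
  over a block does not depend on where the block starts, and all residue classes share one
  limit.\<close>

lemma prod_mod_shift:
  fixes h :: "nat \<Rightarrow> 'a::comm_monoid_mult"
  assumes "0 < r"
  shows "(\<Prod>i<r. h ((n + i) mod r + 1)) = (\<Prod>k=1..r. h k)"
proof -
  have "(\<Prod>i<r. h ((n + i) mod r + 1)) = (\<Prod>i<r. h (i + 1))"
    using prod.reindex_bij_betw[OF bij_betw_add_mod[OF assms, of n], of "\<lambda>i. h (i + 1)"] .
  then show ?thesis by (simp add: prod.atLeast1_atMost_eq)
qed

lemma A_continuous_at: "isCont (A r \<alpha>) u"
  unfolding A_def by (intro continuous_intros)

lemma A_holomorphic [holomorphic_intros]: "g holomorphic_on S \<Longrightarrow> (\<lambda>s. A r \<alpha> (g s)) holomorphic_on S"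
  unfolding A_def by (intro holomorphic_intros)

lemma A_0 [simp]: "A r \<alpha> 0 = 1"
  by (simp add: A_def)

text \<open>The derivative of u A(u) at 0 is A(0) = 1, so there is a local inverse. The injectivity
  clause serves the uniqueness of F near infinity.\<close>

lemma inverse_of_uA:
  assumes "0 < \<eta>"
  obtains \<epsilon> K where "0 < \<epsilon>" "K holomorphic_on ball 0 \<epsilon>" "K 0 = 0"
    "\<And>s. s \<in> ball 0 \<epsilon> \<Longrightarrow> K s * A r \<alpha> (K s) = s" "\<And>s. s \<in> ball 0 \<epsilon> \<Longrightarrow> norm (K s) < \<eta>"
    "\<exists>\<delta>>0. inj_on (\<lambda>u. u * A r \<alpha> u) (ball 0 \<delta>)"
proof -
  let ?h = "\<lambda>u. u * A r \<alpha> u"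
  have hol: "?h holomorphic_on UNIV" by (intro holomorphic_intros)
  have "((\<lambda>u. A r \<alpha> u) has_field_derivative deriv (A r \<alpha>) 0) (at 0)"
    using holomorphic_derivI[of "A r \<alpha>" UNIV 0] A_holomorphic[of "\<lambda>x. x" UNIV] by auto
  then have "(?h has_field_derivative 1) (at 0)"
    by (auto intro!: derivative_eq_intros)
  then have "deriv ?h 0 \<noteq> 0" by (simp add: DERIV_imp_deriv)
  then obtain \<delta> where \<delta>: "\<delta> > 0" "open (?h ` ball 0 \<delta>)" "inj_on ?h (ball 0 \<delta>)"
    using has_complex_derivative_locally_invertible[OF hol, of 0] by auto
  obtain g where g: "g holomorphic_on ?h ` ball 0 \<delta>" "\<And>z. z \<in> ball 0 \<delta> \<Longrightarrow> g (?h z) = z"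
    using holomorphic_has_inverse[of ?h "ball 0 \<delta>"] holomorphic_on_subset[OF hol] \<delta> by (metis open_ball subset_UNIV)
  have "?h 0 \<in> ?h ` ball 0 \<delta>" using \<delta> by (intro imageI) simp
  then have 0: "0 \<in> ?h ` ball 0 \<delta>" by simp
  have g0: "g 0 = 0" using g(2)[of 0] \<delta> by simp
  obtain e1 where e1: "e1 > 0" "ball 0 e1 \<subseteq> ?h ` ball 0 \<delta>"
    using \<delta>(2) 0 by (meson open_contains_ball)
  have "isCont g 0"
    using g(1) \<delta>(2) 0 by (metis continuous_on_eq_continuous_at holomorphic_on_imp_continuous_on)
  then obtain e2 where e2: "e2 > 0" "\<And>s. norm s < e2 \<Longrightarrow> norm (g s) < \<eta>"
    using assms g0 unfolding continuous_at_eps_delta by (metis dist_0_norm dist_commute)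
  show ?thesis
  proof (rule that[of "min e1 e2" g])
    show "g holomorphic_on ball 0 (min e1 e2)"
      using g(1) by (rule holomorphic_on_subset) (use e1 in auto)
    fix s assume s: "s \<in> ball (0::complex) (min e1 e2)"
    then have "s \<in> ?h ` ball 0 \<delta>" using e1 by auto
    then show "g s * A r \<alpha> (g s) = s" using g(2) by force
    show "norm (g s) < \<eta>" using s e2 by auto
  qed (use e1 e2 g0 \<delta> in auto)
qed

section \<open>Asymptotically periodic coefficients\<close>

locale regular_recurrence = positive_recurrence +
  fixes \<gamma> :: real and \<alpha> :: "nat \<Rightarrow> real"
  assumes gamma_pos: "0 < \<gamma>"
    and alpha_pos: "\<And>k. k \<in> {1..r} \<Longrightarrow> 0 < \<alpha> k"
    and c_asymp: "\<And>k. k \<in> {1..r} \<Longrightarrow> ((\<lambda>n. c n / real n powr \<gamma>) \<longlongrightarrow> \<alpha> k)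
           (inf sequentially (principal {n. [n = k - 1] (mod r)}))"
begin

definition \<beta> where "\<beta> n = c n / real n powr \<gamma>"
definition a where "a n = \<alpha> (n mod r + 1)"

lemma mod_in: "n mod r + 1 \<in> {1..r}"
  using r_pos by (simp add: Suc_le_eq)

lemma a_pos: "0 < a n"
  unfolding a_def by (intro alpha_pos mod_in)

lemma a_bounds: obtains m M where "0 < m" "\<And>n. m \<le> a n" "\<And>n. a n \<le> M" "\<And>k. k \<in> {1..r} \<Longrightarrow> \<alpha> k \<le> M" "0 < M"
proof -
  have ne: "{1..r} \<noteq> {}" using r_pos by auto
  show ?thesis
  proof (rule that[of "Min (\<alpha> ` {1..r})" "Max (\<alpha> ` {1..r})"])
    show "0 < Min (\<alpha> ` {1..r})" using ne alpha_pos by (subst Min_gr_iff) auto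
    show "0 < Max (\<alpha> ` {1..r})" using ne alpha_pos[of 1] r_pos by (subst Max_gr_iff) auto
  qed (use mod_in in \<open>auto simp: a_def\<close>)
qed

lemma beta_minus_a: "(\<lambda>n. \<beta> n - a n) \<longlonglongrightarrow> 0"
proof (rule tendstoI)
  fix e :: real assume e: "e > 0"
  have "\<forall>\<^sub>F n in sequentially. [n = k - 1] (mod r) \<longrightarrow> dist (\<beta> n) (\<alpha> k) < e" if "k \<in> {1..r}" for k
    using tendstoD[OF c_asymp[OF that] e] by (simp add: eventually_inf_principal \<beta>_def)
  then have "\<forall>\<^sub>F n in sequentially. \<forall>k\<in>{1..r}. [n = k - 1] (mod r) \<longrightarrow> dist (\<beta> n) (\<alpha> k) < e"
    by (intro eventually_ball_finite) auto
  then show "\<forall>\<^sub>F n in sequentially. dist (\<beta> n - a n) 0 < e"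
  proof eventually_elim
    case (elim n)
    have "[n = (n mod r + 1) - 1] (mod r)" by (simp add: cong_def)
    with elim mod_in[of n] have "dist (\<beta> n) (\<alpha> (n mod r + 1)) < e" by blast
    then show ?case by (simp add: a_def dist_norm)
  qed
qed

lemma c_bound: obtains C where "0 < C" "\<And>N m. 1 \<le> N \<Longrightarrow> m \<le> N \<Longrightarrow> c m \<le> C * real N powr \<gamma>"
proof -
  obtain m M where M: "\<And>n. a n \<le> M" by (rule a_bounds) blast
  from beta_minus_a have "Bseq (\<lambda>n. \<beta> n - a n)" by (simp add: convergentI convergent_imp_Bseq)
  then obtain B where B: "\<And>n. \<bar>\<beta> n - a n\<bar> \<le> B" unfolding Bseq_def real_norm_def by blast
  have \<beta>: "\<beta> n \<le> M + B" for n using M[of n] B[of n] by linarith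
  show ?thesis
  \<comment> \<open>\<open>\<beta> 0\<close> is 0 because division by 0 yields 0. It says nothing
    about \<open>c 0\<close>, which therefore enters the constant separately.\<close>
  proof (rule that[of "max (c 0) (M + B)"])
    show "0 < max (c 0) (M + B)" using c_pos[of 0] by simp
    fix N m :: nat assume N: "1 \<le> N" "m \<le> N"
    show "c m \<le> max (c 0) (M + B) * real N powr \<gamma>"
    proof (cases "m = 0")
      case True
      have "c 0 * 1 \<le> max (c 0) (M + B) * real N powr \<gamma>"
        using c_pos[of 0] N gamma_pos by (intro mult_mono ge_one_powr_ge_zero) auto
      then show ?thesis using True by simp
    next
      case False
      then have "c m = \<beta> m * real m powr \<gamma>" by (simp add: \<beta>_def)
      also have "\<dots> \<le> max (c 0) (M + B) * real N powr \<gamma>"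
        using \<beta>[of m] N gamma_pos c_pos[of 0] by (intro mult_mono powr_mono2) auto
      finally show ?thesis .
    qed
  qed
qed

text \<open>This quantity obeys a closed recurrence: the quotient with index n + r is 1 / (1 - v_n)
  by \<open>step_ratio_step\<close>, and f_(n+r) is a product of r such quotients, so v_n, ...,
  v_(n+r-1) determine v_(n+r).\<close>

definition v where "v n s = of_real (c n) * s * f n s"

text \<open>A bootstrap: if the quotients before index n + r are bounded by 2, then |f_n| <= 2^r,
  hence |v_n| <= C \<rho> 2^r = 1/2, and the next quotient 1 / (1 - v_n) is again at most 2.
  Measuring s by |s| N^\<gamma> covers all indices up to N at once.\<close>

lemma small_disc:
  obtains \<rho> where "0 < \<rho>"
    "\<And>N s n. 1 \<le> N \<Longrightarrow> norm s * real N powr \<gamma> \<le> \<rho> \<Longrightarrow> n \<le> N \<Longrightarrow> p n s \<noteq> 0 \<and> p (Suc n) s \<noteq> 0 \<and> norm (w n s) \<le> 2"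
    "\<And>N s n. 1 \<le> N \<Longrightarrow> norm s * real N powr \<gamma> \<le> \<rho> \<Longrightarrow> n + r \<le> N \<Longrightarrow> norm (v n s) \<le> 1 / 2"
proof -
  obtain C where C: "0 < C" "\<And>N m. 1 \<le> N \<Longrightarrow> m \<le> N \<Longrightarrow> c m \<le> C * real N powr \<gamma>"
    by (rule c_bound) blast
  define \<rho> where "\<rho> = 1 / (2 * C * 2 ^ r)"
  have \<rho>: "0 < \<rho>" using C by (simp add: \<rho>_def)
  have vb: "norm (v n s) \<le> 1 / 2" if "1 \<le> N" "norm s * real N powr \<gamma> \<le> \<rho>" "n + r \<le> N"
    "\<And>m. m \<le> n + r \<Longrightarrow> p m s \<noteq> 0" "\<And>m. m < n + r \<Longrightarrow> norm (w m s) \<le> 2" for N s n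
  proof -
    have f: "norm (f n s) \<le> 2 ^ r"
      using that(4,5) prod_mono[of "{n..<n+r}" "\<lambda>i. norm (w i s)" "\<lambda>_. 2"]
      by (simp add: block_ratio_eq_prod_step_ratio flip: prod_norm)
    have "norm (v n s) = c n * norm s * norm (f n s)"
      using c_pos[of n] by (simp add: v_def norm_mult)
    also have "\<dots> \<le> (C * real N powr \<gamma>) * norm s * 2 ^ r"
      using that(1,3) f c_pos[of n] C(1) by (intro mult_mono C(2)) (auto simp: less_imp_le)
    also have "\<dots> = C * (norm s * real N powr \<gamma>) * 2 ^ r" by simp
    also have "\<dots> \<le> C * \<rho> * 2 ^ r"
      using that(2) C(1) by (intro mult_right_mono mult_left_mono) auto
    also have "\<dots> = 1 / 2" using C(1) by (simp add: \<rho>_def)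
    finally show ?thesis .
  qed
  have main: "p n s \<noteq> 0 \<and> p (Suc n) s \<noteq> 0 \<and> norm (w n s) \<le> 2"
    if N: "1 \<le> N" "norm s * real N powr \<gamma> \<le> \<rho>" "n \<le> N" for N s n
    using N(3)
  proof (induction n rule: less_induct)
    case (less n)
    show ?case
    proof (cases "n < r")
      case True
      then show ?thesis by (simp add: reduced_P_initial step_ratio_def)
    next
      case False
      then obtain m where n: "n = m + r" by (metis add.commute le_add_diff_inverse not_le)
      have nz: "p i s \<noteq> 0" if "i \<le> n" for i
      proof (cases "i = n")
        case True
        have "p (Suc (n - 1)) s \<noteq> 0" using less.IH[of "n - 1"] less.prems n r_pos by auto
        moreover have "Suc (n - 1) = i" using True n r_pos by simp
        ultimately show ?thesis by simp
      qed (use less that in auto)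
      have "norm (v m s) \<le> 1 / 2"
        using nz n less by (intro vb[OF N(1,2)]) auto
      then have low: "1 / 2 \<le> norm (1 - v m s)"
        using norm_triangle_ineq2[of 1 "v m s"] by simp
      moreover have "p (Suc n) s = p n s * (1 - v m s)"
        using reduced_P_step[of r c m s] nz[of n] n by (simp add: v_def)
      moreover have "w n s = 1 / (1 - v m s)"
        using step_ratio_step[of r c m s] nz[of n] n by (simp add: v_def)
      ultimately show ?thesis
        using nz[of n] by (auto simp: norm_divide divide_le_eq)
    qed
  qed
  show ?thesis
  proof (rule that[OF \<rho> main])
    fix N n :: nat and s :: complex assume *: "1 \<le> N" "norm s * real N powr \<gamma> \<le> \<rho>" "n + r \<le> N"
    show "norm (v n s) \<le> 1 / 2"
      using main[OF *(1,2)] * by (intro vb[OF *]) auto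
  qed
qed

text \<open>The property \<open>S e\<close> in the proof says that the error is eventually at most \<open>e\<close>, uniformly in the
  disc. The radius is so small that one turn of the recurrence halves the error up to an
  arbitrarily small term.\<close>

lemma local_convergence:
  obtains \<rho> K where "0 < \<rho>" "K holomorphic_on ball 0 \<rho>" "K 0 = 0"
    "\<And>s. s \<in> ball 0 \<rho> \<Longrightarrow> K s * A r \<alpha> (K s) = s" "\<And>s. s \<in> ball 0 \<rho> \<Longrightarrow> norm (1 / A r \<alpha> (K s) - 1) < 1"
    "\<And>s. s \<in> ball 0 \<rho> \<Longrightarrow> A r \<alpha> (K s) \<noteq> 0"
    "\<And>s. s \<in> ball 0 \<rho> \<Longrightarrow> s \<noteq> 0 \<Longrightarrow> (\<lambda>n. f n (s / of_real (real n powr \<gamma>))) \<longlonglongrightarrow> 1 / A r \<alpha> (K s)"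
proof -
  obtain m M where M: "0 < m" "\<And>n. m \<le> a n" "\<And>n. a n \<le> M" "\<And>k. k \<in> {1..r} \<Longrightarrow> \<alpha> k \<le> M" "0 < M"
    by (rule a_bounds) blast
  obtain \<rho>1 where \<rho>1: "0 < \<rho>1"
    "\<And>N s n. 1 \<le> N \<Longrightarrow> norm s * real N powr \<gamma> \<le> \<rho>1 \<Longrightarrow> n \<le> N \<Longrightarrow> p n s \<noteq> 0 \<and> p (Suc n) s \<noteq> 0 \<and> norm (w n s) \<le> 2"
    "\<And>N s n. 1 \<le> N \<Longrightarrow> norm s * real N powr \<gamma> \<le> \<rho>1 \<Longrightarrow> n + r \<le> N \<Longrightarrow> norm (v n s) \<le> 1 / 2"
    by (rule small_disc) blast
  have "((\<lambda>u. 1 / A r \<alpha> u) \<longlongrightarrow> 1 / A r \<alpha> 0) (at 0)"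
    using A_continuous_at[where r = r and \<alpha> = \<alpha> and u = 0] by (intro tendsto_intros) (auto simp: isCont_def)
  then have "\<forall>\<^sub>F u in at 0. norm (1 / A r \<alpha> u - 1) < 1"
    by (auto dest: tendstoD[of _ _ _ 1] simp: dist_norm)
  then obtain \<eta>1 where \<eta>1: "\<eta>1 > 0" "\<And>u. norm u < \<eta>1 \<Longrightarrow> norm (1 / A r \<alpha> u - 1) < 1"
    unfolding eventually_at by (metis A_0 cancel_comm_monoid_add_class.diff_cancel diff_zero dist_norm div_by_1 norm_zero zero_less_one UNIV_I)
  \<comment> \<open>The first bound keeps 1 / A(K s) within distance 1 of 1, away from the branch
    cut of the logarithm; the second keeps all \<alpha>_k K s in the disc of radius 1/2 on which
    \<open>norm_prod_inverse_diff_le\<close> works.\<close>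
  define \<eta> where "\<eta> = min \<eta>1 (1 / (2 * M))"
  have \<eta>: "0 < \<eta>" using \<eta>1 M by (simp add: \<eta>_def)
  obtain \<epsilon> K where K: "0 < \<epsilon>" "K holomorphic_on ball 0 \<epsilon>" "K 0 = 0"
    "\<And>s. s \<in> ball 0 \<epsilon> \<Longrightarrow> K s * A r \<alpha> (K s) = s" "\<And>s. s \<in> ball 0 \<epsilon> \<Longrightarrow> norm (K s) < \<eta>"
    by (rule inverse_of_uA[OF \<eta>, where r = r and \<alpha> = \<alpha>]) blast
  have Ksmall: "norm (of_real (\<alpha> k) * K s) \<le> 1 / 2" if "s \<in> ball 0 \<epsilon>" "k \<in> {1..r}" for s k
  proof -
    have "norm (of_real (\<alpha> k) * K s) \<le> M * (1 / (2 * M))"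
      unfolding norm_mult using K(5)[OF that(1)] M(4)[OF that(2)] alpha_pos[OF that(2)] M(5)
      by (intro mult_mono) (auto simp: \<eta>_def)
    then show ?thesis using M by simp
  qed
  have Anz: "A r \<alpha> (K s) \<noteq> 0" if "s \<in> ball 0 \<epsilon>" for s
  proof
    assume "A r \<alpha> (K s) = 0"
    then obtain k where "k \<in> {1..r}" "of_real (\<alpha> k) * K s = 1"
      unfolding A_def by auto
    with Ksmall[OF that, of k] show False by simp
  qed
  \<comment> \<open>The last bound makes the contraction factor \<rho> M 2^(r+1) r at most 1/2;
    \<epsilon>/2 leaves the closed disc inside the domain of K.\<close>
  define \<rho> where "\<rho> = min \<rho>1 (min (\<epsilon> / 2) (1 / (2 * M * 2 ^ (r + 1) * real r)))"
  have \<rho>: "0 < \<rho>" "\<rho> \<le> \<rho>1" "\<rho> < \<epsilon>" using \<rho>1 K M r_pos by (auto simp: \<rho>_def)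
  have "\<rho> \<le> 1 / (2 * M * 2 ^ (r + 1) * real r)" by (simp add: \<rho>_def)
  then have \<rho>2: "\<rho> * M * 2 ^ (r + 1) * real r \<le> 1 / 2"
    using M r_pos by (simp add: pos_le_divide_eq mult_ac)
  have cball: "cball 0 \<rho> \<subseteq> ball (0::complex) \<epsilon>" using \<rho> by auto
  \<comment> \<open>Here \<sigma> is the unscaled variable and n^\<gamma> \<sigma> the argument of
    K. The disc is measured with n + r because v_n involves the reduced polynomials up to that
    index.\<close>
  define S where "S e \<longleftrightarrow> (\<forall>\<^sub>F n in sequentially. \<forall>\<sigma>. norm \<sigma> * real (n + r) powr \<gamma> \<le> \<rho> \<longrightarrow>
      norm (v n \<sigma> - of_real (a n) * K (of_real (real n powr \<gamma>) * \<sigma>)) \<le> e)" for e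
  have in_cball: "of_real (real n powr \<gamma>) * \<sigma> \<in> cball 0 \<rho>" if "norm \<sigma> * real m powr \<gamma> \<le> \<rho>" "n \<le> m" for n m and \<sigma> :: complex
  proof -
    have "norm \<sigma> * real n powr \<gamma> \<le> norm \<sigma> * real m powr \<gamma>"
      using that gamma_pos by (intro mult_left_mono powr_mono2) auto
    then show ?thesis using that by (simp add: norm_mult mult.commute)
  qed
  have aK: "norm (of_real (a n) * K s) \<le> 1 / 2" if "s \<in> cball 0 \<rho>" for n s
    unfolding a_def using Ksmall[OF _ mod_in] cball that by blast
  have S1: "S 1"
    unfolding S_def
  proof (intro eventually_sequentiallyI[of 1] allI impI)
    fix n :: nat and \<sigma> :: complex assume n: "1 \<le> n" "norm \<sigma> * real (n + r) powr \<gamma> \<le> \<rho>"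
    have "norm (v n \<sigma>) \<le> 1 / 2" using n \<rho> by (intro \<rho>1(3)[of "n + r"]) auto
    moreover have "norm (of_real (a n) * K (of_real (real n powr \<gamma>) * \<sigma>)) \<le> 1 / 2"
      by (rule aK[OF in_cball[OF n(2)]]) simp
    ultimately show "norm (v n \<sigma> - of_real (a n) * K (of_real (real n powr \<gamma>) * \<sigma>)) \<le> 1"
      by (intro norm_triangle_le_diff) simp
  qed
  \<comment> \<open>For m = n + r the error has three sources: the errors inherited from the r
    predecessors, the variation of K between the arguments belonging to n + i and to m, and
    \<beta>_m - a_m. The tolerances make them add up to (e + \<eta>)/2 + \<eta>/2.\<close>
  have step: "S (e / 2 + \<eta>)" if Se: "S e" and \<eta>: "\<eta> > 0" for e \<eta>
  proof -
    have "uniformly_continuous_on (cball 0 \<rho>) K"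
      using K(2) cball by (intro compact_uniformly_continuous)
        (auto intro: holomorphic_on_imp_continuous_on holomorphic_on_subset)
    then obtain \<delta> where \<delta>: "\<delta> > 0" "\<And>x y. x \<in> cball 0 \<rho> \<Longrightarrow> y \<in> cball 0 \<rho> \<Longrightarrow> dist x y < \<delta> \<Longrightarrow> dist (K x) (K y) < \<eta> / M"
      using \<eta> M unfolding uniformly_continuous_on_def
      by (metis divide_pos_pos)
    have "(\<lambda>n. \<rho> * (1 - (real n / real (n + r)) powr \<gamma>)) \<longlonglongrightarrow> \<rho> * (1 - 1 powr \<gamma>)"
    proof (intro tendsto_intros)
      show "(\<lambda>n. real n / real (n + r)) \<longlonglongrightarrow> 1" by real_asymp
    qed auto
    then have E1: "\<forall>\<^sub>F n in sequentially. \<rho> * (1 - (real n / real (n + r)) powr \<gamma>) < \<delta>"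
      using \<delta> by (auto dest!: order_tendstoD(2)[of _ _ _ \<delta>])
    have E2: "\<forall>\<^sub>F n in sequentially. \<bar>\<beta> n - a n\<bar> < \<eta> / (2 * \<rho> * 2 ^ r)"
      using tendstoD[OF beta_minus_a, of "\<eta> / (2 * \<rho> * 2 ^ r)"] \<eta> \<rho> by (simp add: dist_norm)
    from eventually_conj[OF Se[unfolded S_def] eventually_conj[OF E1 E2]] obtain n0 where n0:
      "\<And>n \<sigma>. n \<ge> n0 \<Longrightarrow> norm \<sigma> * real (n + r) powr \<gamma> \<le> \<rho> \<Longrightarrow>
          norm (v n \<sigma> - of_real (a n) * K (of_real (real n powr \<gamma>) * \<sigma>)) \<le> e"
      "\<And>n. n \<ge> n0 \<Longrightarrow> \<rho> * (1 - (real n / real (n + r)) powr \<gamma>) < \<delta>"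
      "\<And>n. n \<ge> n0 \<Longrightarrow> \<bar>\<beta> n - a n\<bar> < \<eta> / (2 * \<rho> * 2 ^ r)"
      unfolding eventually_sequentially by auto
    show ?thesis unfolding S_def
    proof (intro eventually_sequentiallyI[of "n0 + r + 1"] allI impI)
      fix m :: nat and \<sigma> :: complex assume m: "n0 + r + 1 \<le> m" and \<sigma>: "norm \<sigma> * real (m + r) powr \<gamma> \<le> \<rho>"
      define n where "n = m - r"
      have mn: "m = n + r" "n0 \<le> n" "1 \<le> n" using m by (auto simp: n_def)
      define s where "s = of_real (real m powr \<gamma>) * \<sigma>"
      have s: "s \<in> cball 0 \<rho>" unfolding s_def using \<sigma> by (rule in_cball) simp
      then have sb: "s \<in> ball 0 \<epsilon>" using cball by blast
      define x where "x i = v (n + i) \<sigma>" for i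
      define y where "y i = of_real (a (n + i)) * K s" for i
      let ?X = "\<Prod>i<r. 1 / (1 - x i)"
      let ?Y = "\<Prod>i<r. 1 / (1 - y i)"
      have \<sigma>i: "norm \<sigma> * real (n + i + r) powr \<gamma> \<le> \<rho>" if "i < r" for i
      proof -
        have "norm \<sigma> * real (n + i + r) powr \<gamma> \<le> norm \<sigma> * real (m + r) powr \<gamma>"
          using that mn gamma_pos by (intro mult_left_mono powr_mono2) auto
        then show ?thesis using \<sigma> by simp
      qed
      have nz: "p i \<sigma> \<noteq> 0" if "i \<le> m + r" for i
        using \<rho>1(2)[of "m + r" \<sigma> i] \<sigma> \<rho> that mn by auto
      have x: "norm (x i) \<le> 1 / 2" if "i < r" for i
        unfolding x_def using that \<sigma> \<rho> mn by (intro \<rho>1(3)[of "m + r"]) auto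
      have y: "norm (y i) \<le> 1 / 2" for i
        unfolding y_def using s by (rule aK)
      have fm: "f m \<sigma> = ?X"
      proof -
        have "f m \<sigma> = (\<Prod>i\<in>{m..<m + r}. w i \<sigma>)" using nz by (intro block_ratio_eq_prod_step_ratio) auto
        also have "\<dots> = (\<Prod>i<r. w (n + i + r) \<sigma>)"
          using mn by (intro prod.reindex_bij_witness[of _ "\<lambda>i. m + i" "\<lambda>i. i - m"]) (auto simp: ac_simps)
        also have "\<dots> = ?X"
          using nz mn by (intro prod.cong refl) (auto simp: x_def v_def intro!: step_ratio_step)
        finally show ?thesis .
      qed
      have AK: "1 / A r \<alpha> (K s) = ?Y"
        using prod_mod_shift[of r "\<lambda>k. 1 / (1 - of_real (\<alpha> k) * K s)" n] r_pos
        by (simp add: A_def y_def a_def prod_dividef)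
      \<comment> \<open>K solves the limiting recurrence exactly: this is K A(K) = s, rewritten with
        the product over a block. Subtracting it from \<open>vm\<close> isolates the errors.\<close>
      have Ks: "K s = s * ?Y"
        unfolding AK[symmetric] using K(4)[OF sb] Anz[OF sb] by (simp add: field_simps)
      have vm: "v m \<sigma> = of_real (\<beta> m) * s * ?X"
      proof -
        have "real m powr \<gamma> \<noteq> 0" using mn by simp
        then show ?thesis unfolding v_def fm s_def \<beta>_def by simp
      qed
      have normX: "norm ?X \<le> 2 ^ r"
      proof -
        have "norm (1 / (1 - x i)) \<le> 2" if "i < r" for i
          using norm_triangle_ineq2[of 1 "x i"] x[OF that] by (auto simp: norm_divide divide_le_eq)
        then show ?thesis
          using prod_mono[of "{..<r}" "\<lambda>i. norm (1 / (1 - x i))" "\<lambda>_. 2"] by (simp flip: prod_norm)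
      qed
      have xy: "norm (x i - y i) \<le> e + \<eta>" if "i < r" for i
      proof -
        define si where "si = of_real (real (n + i) powr \<gamma>) * \<sigma>"
        have si: "si \<in> cball 0 \<rho>" unfolding si_def using \<sigma>i[OF that] by (rule in_cball) simp
        have "si = of_real ((real (n + i) / real m) powr \<gamma>) * s"
          using mn by (simp add: si_def s_def powr_divide)
        then have "s - si = of_real (1 - (real (n + i) / real m) powr \<gamma>) * s"
          by (simp add: algebra_simps)
        then have "norm (s - si) = \<bar>1 - (real (n + i) / real m) powr \<gamma>\<bar> * norm s"
          by (simp only: norm_mult norm_of_real)
        also have "(real (n + i) / real m) powr \<gamma> \<le> 1 powr \<gamma>"
          using that mn gamma_pos by (intro powr_mono2) auto
        then have "\<bar>1 - (real (n + i) / real m) powr \<gamma>\<bar> * norm s \<le> (1 - (real (n + i) / real m) powr \<gamma>) * \<rho>"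
          using s by (intro mult_mono) auto
        also have "\<dots> \<le> (1 - (real n / real m) powr \<gamma>) * \<rho>"
          using gamma_pos \<rho> by (intro mult_right_mono diff_left_mono powr_mono2 divide_right_mono) auto
        also have "\<dots> < \<delta>" using n0(2)[OF mn(2)] mn(1) by (simp add: mult.commute)
        finally have "dist (K si) (K s) < \<eta> / M"
          using \<delta>(2)[OF si s] by (simp add: dist_norm norm_minus_commute)
        then have "norm (of_real (a (n + i)) * (K si - K s)) \<le> M * (\<eta> / M)"
          unfolding norm_mult using M(3)[of "n + i"] a_pos[of "n + i"] M(5)
          by (intro mult_mono) (auto simp: dist_norm)
        then have 2: "norm (of_real (a (n + i)) * (K si - K s)) \<le> \<eta>" using M by simp
        have 1: "norm (v (n + i) \<sigma> - of_real (a (n + i)) * K si) \<le> e"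
          unfolding si_def using mn \<sigma>i[OF that] by (intro n0(1)) auto
        have "x i - y i = (v (n + i) \<sigma> - of_real (a (n + i)) * K si) + of_real (a (n + i)) * (K si - K s)"
          by (simp add: x_def y_def algebra_simps)
        then show ?thesis by (simp only:) (rule norm_triangle_le[OF add_mono[OF 1 2]])
      qed
      have "norm (?X - ?Y) \<le> 2 ^ (r + 1) * (\<Sum>i<r. norm (x i - y i))"
        using norm_prod_inverse_diff_le[of "{..<r}" x y] x y by simp
      also have "\<dots> \<le> 2 ^ (r + 1) * (real r * (e + \<eta>))"
        using sum_bounded_above[of "{..<r}" "\<lambda>i. norm (x i - y i)" "e + \<eta>"] xy by (intro mult_left_mono) auto
      finally have XY: "norm (?X - ?Y) \<le> 2 ^ (r + 1) * (real r * (e + \<eta>))" .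
      have e0: "0 \<le> e + \<eta>" using xy[of 0] r_pos norm_ge_zero[of "x 0 - y 0"] by linarith
      have "v m \<sigma> - of_real (a m) * K s = s * (of_real (\<beta> m - a m) * ?X +
          of_real (a m) * (?X - ?Y))"
        unfolding vm by (subst Ks) (simp add: algebra_simps)
      then have "norm (v m \<sigma> - of_real (a m) * K s) = norm s * norm (of_real (\<beta> m - a m) * ?X +
          of_real (a m) * (?X - ?Y))"
        by (simp only: norm_mult)
      also have "\<dots> \<le> \<rho> * (\<bar>\<beta> m - a m\<bar> * 2 ^ r + M * (2 ^ (r + 1) * (real r * (e + \<eta>))))"
      proof (intro mult_mono norm_triangle_le add_mono)
        show "norm (of_real (\<beta> m - a m) * ?X) \<le> \<bar>\<beta> m - a m\<bar> * 2 ^ r"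
          unfolding norm_mult norm_of_real using normX by (intro mult_left_mono) auto
        show "norm (of_real (a m) * (?X - ?Y)) \<le> M * (2 ^ (r + 1) * (real r * (e + \<eta>)))"
          unfolding norm_mult norm_of_real using XY M(3)[of m] a_pos[of m] M(5) by (intro mult_mono) auto
      qed (use s \<rho> in auto)
      also have "\<dots> = \<rho> * 2 ^ r * \<bar>\<beta> m - a m\<bar> + (\<rho> * M * 2 ^ (r + 1) * real r) * (e + \<eta>)"
        by (simp add: algebra_simps)
      also have "\<dots> \<le> \<rho> * 2 ^ r * (\<eta> / (2 * \<rho> * 2 ^ r)) + (1 / 2) * (e + \<eta>)"
        using n0(3)[of m] mn \<rho> \<rho>2 e0 by (intro add_mono mult_left_mono mult_right_mono) auto
      also have "\<dots> = e / 2 + \<eta>" using \<rho> by (simp add: field_simps)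
      finally show "norm (v m \<sigma> - of_real (a m) * K (of_real (real m powr \<gamma>) * \<sigma>)) \<le> e / 2 + \<eta>"
        by (simp add: s_def)
    qed
  qed
  \<comment> \<open>With \<eta> = e/4 every turn of the recurrence multiplies the bound by
    3/4.\<close>
  have Spow: "S ((3 / 4) ^ k)" for k
  proof (induction k)
    case (Suc k)
    from step[OF Suc, of "(3 / 4) ^ k / 4"] show ?case by simp
  qed (use S1 in simp)
  have lim: "(\<lambda>n. f n (s / of_real (real n powr \<gamma>))) \<longlonglongrightarrow> 1 / A r \<alpha> (K s)"
    if s: "s \<in> ball 0 \<rho>" "s \<noteq> 0" for s
  proof -
    define \<sigma> where "\<sigma> n = s / of_real (real n powr \<gamma>)" for n
    have "(\<lambda>n. norm s * (real (n + r) / real n) powr \<gamma>) \<longlonglongrightarrow> norm s * 1 powr \<gamma>"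
    proof (intro tendsto_intros)
      show "(\<lambda>n. real (n + r) / real n) \<longlonglongrightarrow> 1" by real_asymp
    qed auto
    then have E: "\<forall>\<^sub>F n in sequentially. norm s * (real (n + r) / real n) powr \<gamma> < \<rho>"
      using s by (auto dest!: order_tendstoD(2)[of _ _ _ \<rho>])
    have D0: "(\<lambda>n. v n (\<sigma> n) - of_real (a n) * K s) \<longlonglongrightarrow> 0"
    proof (rule tendstoI)
      fix e :: real assume "e > 0"
      then obtain k where k: "(3 / 4) ^ k < e" using real_arch_pow_inv[of e "3 / 4"] by auto
      show "\<forall>\<^sub>F n in sequentially. dist (v n (\<sigma> n) - of_real (a n) * K s) 0 < e"
        using Spow[of k, unfolded S_def] E eventually_gt_at_top[of 0]
      proof eventually_elim
        case (elim n)
        have "norm (\<sigma> n) * real (n + r) powr \<gamma> \<le> \<rho>"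
          using elim(2,3) by (simp add: \<sigma>_def norm_divide powr_divide)
        moreover have "of_real (real n powr \<gamma>) * \<sigma> n = s" using elim(3) by (simp add: \<sigma>_def)
        ultimately have "norm (v n (\<sigma> n) - of_real (a n) * K s) \<le> (3 / 4) ^ k" using elim(1) by metis
        then show ?case using k by (simp add: dist_norm)
      qed
    qed
    \<comment> \<open>a_n is periodic and need not converge. Exchanging it for \<beta>_n makes
      \<beta>_n a common factor, which can be divided out because it is eventually above
      m/2.\<close>
    have "(\<lambda>n. (v n (\<sigma> n) - of_real (a n) * K s) - of_real (\<beta> n - a n) * K s) \<longlonglongrightarrow> 0 - of_real 0 * K s"
      by (intro tendsto_intros D0 beta_minus_a)
    moreover have "\<forall>\<^sub>F n in sequentially. (v n (\<sigma> n) - of_real (a n) * K s) - of_real (\<beta> n - a n) * K s =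
         of_real (\<beta> n) * (s * f n (\<sigma> n) - K s)"
      using eventually_gt_at_top[of 0]
      by eventually_elim (simp add: v_def \<sigma>_def \<beta>_def algebra_simps)
    ultimately have "(\<lambda>n. of_real (\<beta> n) * (s * f n (\<sigma> n) - K s)) \<longlonglongrightarrow> 0 - of_real 0 * K s"
      by (rule Lim_transform_eventually)
    then have D1: "(\<lambda>n. of_real (\<beta> n) * (s * f n (\<sigma> n) - K s)) \<longlonglongrightarrow> 0" by simp
    have "\<forall>\<^sub>F n in sequentially. m / 2 < \<beta> n"
      using tendstoD[OF beta_minus_a half_gt_zero[OF M(1)]]
    proof eventually_elim
      case (elim n)
      then show ?case using M(2)[of n] by (auto simp: dist_norm abs_if split: if_splits)
    qed
    then have "\<forall>\<^sub>F n in sequentially. norm (s * f n (\<sigma> n) - K s) \<le> (2 / m) * norm (of_real (\<beta> n) * (s * f n (\<sigma> n) - K s))"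
    proof eventually_elim
      case (elim n)
      have "1 \<le> (2 / m) * \<beta> n" using elim M by (simp add: field_simps)
      then have "1 * norm (s * f n (\<sigma> n) - K s) \<le> ((2 / m) * \<beta> n) * norm (s * f n (\<sigma> n) - K s)"
        by (intro mult_right_mono) auto
      then show ?case using elim M by (simp add: norm_mult)
    qed
    moreover have "(\<lambda>n. (2 / m) * norm (of_real (\<beta> n) * (s * f n (\<sigma> n) - K s))) \<longlonglongrightarrow> 0"
      using tendsto_mult_right_zero[OF tendsto_norm_zero[OF D1]] by blast
    ultimately have "(\<lambda>n. s * f n (\<sigma> n) - K s) \<longlonglongrightarrow> 0"
      by (rule Lim_null_comparison)
    then have "(\<lambda>n. ((s * f n (\<sigma> n) - K s) + K s) / s) \<longlonglongrightarrow> (0 + K s) / s"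
      using s by (intro tendsto_intros) auto
    moreover have "K s / s = 1 / A r \<alpha> (K s)"
    proof -
      have sb: "s \<in> ball 0 \<epsilon>" using s \<rho> by auto
      have "K s * A r \<alpha> (K s) = s" using K(4)[OF sb] .
      then show ?thesis using Anz[OF sb] s by (simp add: frac_eq_eq)
    qed
    ultimately show ?thesis using s by (simp add: \<sigma>_def)
  qed
  have sub: "ball 0 \<rho> \<subseteq> ball (0::complex) \<epsilon>" using \<rho> by auto
  show ?thesis
  proof (rule that[of \<rho> K])
    show "norm (1 / A r \<alpha> (K s) - 1) < 1" if "s \<in> ball 0 \<rho>" for s
      using K(5)[of s] sub that by (intro \<eta>1(2)) (auto simp: \<eta>_def)
  qed (use \<rho> K sub Anz lim in \<open>auto intro: holomorphic_on_subset\<close>)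
qed

end

section \<open>Convergence on the cut plane\<close>

lemma connected_cut_plane: "connected (- (\<real>\<^sub>\<ge>\<^sub>0 :: complex set))"
proof (intro starlike_imp_connected)
  show "starlike (- (\<real>\<^sub>\<ge>\<^sub>0 :: complex set))"
    unfolding starlike_def
  proof (intro bexI ballI subsetI)
    fix x z assume x: "x \<in> - (\<real>\<^sub>\<ge>\<^sub>0 :: complex set)" and z: "z \<in> closed_segment (- 1) x"
    then obtain u where u: "0 \<le> u" "u \<le> 1" "z = (1 - u) *\<^sub>R (- 1) + u *\<^sub>R x"
      unfolding closed_segment_def by auto
    show "z \<in> - \<real>\<^sub>\<ge>\<^sub>0"
    proof
      assume "z \<in> \<real>\<^sub>\<ge>\<^sub>0"
      then have "u * Im x = 0" "1 - u \<le> u * Re x"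
        using u by (auto simp: complex_nonneg_Reals_iff)
      moreover from this u have "u \<noteq> 0" by auto
      ultimately have "Im x = 0" "0 \<le> u * Re x" using u by auto
      with \<open>u \<noteq> 0\<close> u x show False
        by (auto simp: complex_nonneg_Reals_iff zero_le_mult_iff)
    qed
  qed (simp add: complex_nonneg_Reals_iff)
qed

lemma open_cut_plane: "open (- (\<real>\<^sub>\<ge>\<^sub>0 :: complex set))"
  using closed_nonneg_Reals_complex by (rule open_Compl)

lemma scale_notin_nonneg_Reals:
  assumes "s \<notin> \<real>\<^sub>\<ge>\<^sub>0" "0 < x"
  shows "of_real x * s \<notin> (\<real>\<^sub>\<ge>\<^sub>0 :: complex set)"
  using assms by (auto simp: complex_nonneg_Reals_iff zero_le_mult_iff)

lemma inverse_notin_nonneg_Reals: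
  assumes "s \<notin> \<real>\<^sub>\<ge>\<^sub>0"
  shows "1 / s \<notin> (\<real>\<^sub>\<ge>\<^sub>0 :: complex set)"
proof
  assume "1 / s \<in> \<real>\<^sub>\<ge>\<^sub>0"
  then have "inverse (1 / s) \<in> \<real>\<^sub>\<ge>\<^sub>0" by (rule nonneg_Reals_inverse_I)
  with assms show False by simp
qed

lemma star_iff: "z \<in> star r \<longleftrightarrow> z ^ (r + 1) \<in> \<real>\<^sub>\<ge>\<^sub>0"
proof
  assume "z \<in> star r"
  then obtain k x where k: "k \<le> r" and x: "0 \<le> x"
    and z: "z = of_real x * exp (2 * of_real pi * \<i> * of_nat k / of_nat (r + 1))"
    unfolding star_def by auto
  have "exp (2 * of_real pi * \<i> * of_nat k / of_nat (r + 1)) ^ (r + 1) = 1"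
    using complex_roots_unity[of "r + 1"] k by fastforce
  then have "z ^ (r + 1) = of_real (x ^ (r + 1))"
    unfolding z power_mult_distrib by simp
  then show "z ^ (r + 1) \<in> \<real>\<^sub>\<ge>\<^sub>0"
    using x by (metis nonneg_Reals_of_real_iff zero_le_power)
next
  assume "z ^ (r + 1) \<in> \<real>\<^sub>\<ge>\<^sub>0"
  then obtain y where y: "0 \<le> y" "z ^ (r + 1) = of_real y" by (auto elim: nonneg_Reals_cases)
  define x where "x = root (r + 1) y"
  have x: "0 \<le> x" "x ^ (r + 1) = y" using y real_root_pow_pos2[of "r + 1" y] by (auto simp: x_def simp del: power_Suc)
  show "z \<in> star r"
  proof (cases "x = 0")
    case True
    then have "z = 0" using x y by (simp del: power_Suc)
    then have "z = of_real 0 * exp (2 * of_real pi * \<i> * of_nat 0 / of_nat (r + 1))" by simp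
    then show ?thesis unfolding star_def by (auto intro!: bexI[of _ 0] exI[of _ 0])
  next
    case False
    have "(z / of_real x) ^ (r + 1) = 1"
      unfolding power_divide y(2) x(2)[symmetric] using False by simp
    then have "z / of_real x \<in> {exp (2 * of_real pi * \<i> * of_nat j / of_nat (r + 1)) | j. j < r + 1}"
      using complex_roots_unity[of "r + 1"] by (metis (mono_tags) le_add2 mem_Collect_eq)
    then obtain j where "j < r + 1" "z / of_real x = exp (2 * of_real pi * \<i> * of_nat j / of_nat (r + 1))"
      by blast
    with False have "j \<in> {0..r}" "z = of_real x * exp (2 * of_real pi * \<i> * of_nat j / of_nat (r + 1))"
      by (auto simp: field_simps)
    then show ?thesis unfolding star_def using x(1) by blast
  qed
qed

lemma star_ray:
  assumes "x \<in> star r"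
  obtains j where "j \<le> r" "x = of_real (norm x) * exp (2 * of_real pi * \<i> / of_nat (r + 1)) ^ j"
proof -
  obtain t k where tk: "0 \<le> t" "k \<le> r" "x = of_real t * exp (2 * of_real pi * \<i> * of_nat k / of_nat (r + 1))"
    using assms unfolding star_def by auto
  have pow: "exp (2 * of_real pi * \<i> * of_nat k / of_nat (r + 1)) = exp (2 * of_real pi * \<i> / of_nat (r + 1)) ^ k"
    by (subst exp_of_nat_mult[symmetric]) (simp add: mult_ac)
  have "norm (exp (2 * of_real pi * \<i> * of_nat k / of_nat (r + 1))) = 1"
    by (simp add: norm_exp_eq_Re)
  then have "norm x = t" using tk(1) unfolding tk(3) norm_mult by simp
  then show ?thesis using that[OF tk(2)] tk(3) pow by simp
qed

lemma closed_star: "closed (star r)"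
proof -
  have "star r = (\<lambda>z. z ^ (r + 1)) -` \<real>\<^sub>\<ge>\<^sub>0" using star_iff by auto
  then show ?thesis
    by (simp only:) (intro closed_vimage closed_nonneg_Reals_complex continuous_intros)
qed

lemma off_star:
  assumes "z \<notin> star r"
  shows "z \<noteq> 0" "1 / z ^ (r + 1) \<notin> \<real>\<^sub>\<ge>\<^sub>0"
proof -
  show "z \<noteq> 0" using assms star_iff[of z r] by auto
  show "1 / z ^ (r + 1) \<notin> \<real>\<^sub>\<ge>\<^sub>0"
    using assms star_iff[of z r] by (intro inverse_notin_nonneg_Reals) auto
qed

text \<open>The function $\exp(i \log f)$ is bounded above and below because the argument of \<open>f\<close> is
  bounded, and its logarithmic derivative is $i$ times that of \<open>f\<close>.\<close>

lemma norm_logderiv_le: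
  assumes S: "open S" "f holomorphic_on S" "\<And>x. x \<in> S \<Longrightarrow> f x \<notin> \<real>\<^sub>\<le>\<^sub>0"
    and d: "0 < d" "cball s d \<subseteq> S"
  shows "norm (deriv f s / f s) \<le> exp (2 * pi) / d"
proof -
  define E where "E x = exp (\<i> * Ln (f x))" for x
  have bound: "exp (- pi) \<le> norm (E x)" "norm (E x) \<le> exp pi" if "x \<in> S" for x
  proof -
    have "f x \<noteq> 0" using S(3)[OF that] by auto
    then have "\<bar>Im (Ln (f x))\<bar> \<le> pi" using mpi_less_Im_Ln Im_Ln_le_pi by (auto simp: abs_le_iff less_imp_le minus_le_iff)
    then show "exp (- pi) \<le> norm (E x)" "norm (E x) \<le> exp pi"
      by (auto simp: E_def norm_exp_eq_Re)
  qed
  have holE: "E holomorphic_on S"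
    unfolding E_def using S by (intro holomorphic_intros) auto
  have s: "s \<in> S" using d by auto
  \<comment> \<open>Cauchy's inequality gives exp pi / d for the derivative of E; dividing by |E| >=
    exp (-pi) contributes the second factor exp pi.\<close>
  have "norm ((deriv ^^ 1) E s) \<le> fact 1 * exp pi / d ^ 1"
  proof (rule Cauchy_inequality)
    show "E holomorphic_on ball s d"
      using holE d(2) by (metis holomorphic_on_subset ball_subset_cball subset_trans)
    show "continuous_on (cball s d) E"
      using holE d(2) by (metis holomorphic_on_imp_continuous_on continuous_on_subset)
  qed (use d bound in \<open>auto simp: dist_norm\<close>)
  then have E': "norm (deriv E s) \<le> exp pi / d" by simp
  have "(f has_field_derivative deriv f s) (at s)"
    using S s by (intro holomorphic_derivI)
  then have "(E has_field_derivative (E s * (\<i> * (deriv f s / f s)))) (at s)"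
    unfolding E_def using S(3)[OF s] by (auto intro!: derivative_eq_intros simp: field_simps)
  then have "norm (deriv E s) = norm (E s) * norm (deriv f s / f s)"
    by (simp add: DERIV_imp_deriv norm_mult norm_divide)
  then have "exp (- pi) * norm (deriv f s / f s) \<le> exp pi / d"
    using E' mult_right_mono[OF bound(1)[OF s], of "norm (deriv f s / f s)"] by simp
  then have "exp pi * (exp (- pi) * norm (deriv f s / f s)) \<le> exp pi * (exp pi / d)"
    by (intro mult_left_mono) auto
  moreover have "exp pi * (exp (- pi) * norm (deriv f s / f s)) = norm (deriv f s / f s)"
    by (simp add: exp_minus)
  moreover have "exp pi * (exp pi / d) = exp (2 * pi) / d"
    by (metis exp_add mult_2 times_divide_eq_right)
  ultimately show ?thesis by (simp only:)
qed

text \<open>By Montel some subsequence converges to a function g. If uniform convergence of the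
  whole sequence failed on K, the indices where it stays e away from g would again contain a
  convergent subsequence. Its limit equals g on U, where the full sequence converges, and hence on S
  by the identity theorem.\<close>

lemma Vitali:
  fixes h :: "nat \<Rightarrow> complex \<Rightarrow> complex"
  assumes S: "open S" "connected S"
    and hol: "\<And>n. h n holomorphic_on S"
    and bdd: "\<And>K. compact K \<Longrightarrow> K \<subseteq> S \<Longrightarrow> \<exists>B. \<forall>n. \<forall>z\<in>K. norm (h n z) \<le> B"
    and U: "open U" "U \<subseteq> S" "U \<noteq> {}"
    and conv: "\<And>z. z \<in> U \<Longrightarrow> convergent (\<lambda>n. h n z)"
  obtains g where "g holomorphic_on S" "\<And>K. compact K \<Longrightarrow> K \<subseteq> S \<Longrightarrow> uniform_limit K h g sequentially"
proof -
  have montel: "\<exists>g r. g holomorphic_on S \<and> strict_mono (r :: nat \<Rightarrow> nat) \<and>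
      (\<forall>x\<in>S. (\<lambda>n. h (q (r n)) x) \<longlonglongrightarrow> g x) \<and>
      (\<forall>K. compact K \<longrightarrow> K \<subseteq> S \<longrightarrow> uniform_limit K (\<lambda>n. h (q (r n))) g sequentially)" for q :: "nat \<Rightarrow> nat"
  proof -
    have bdd': "\<exists>B. \<forall>f\<in>range h. \<forall>z\<in>K. norm (f z) \<le> B" if "compact K" "K \<subseteq> S" for K
      using bdd[OF that] by auto
    have sub: "range (\<lambda>n. h (q n)) \<subseteq> range h" by auto
    have hol': "f holomorphic_on S" if "f \<in> range h" for f using that hol by auto
    show ?thesis
      by (rule Montel[OF S(1) hol' bdd' sub]) (auto simp: o_def)
  qed
  from montel[of "\<lambda>n. n"] obtain g r0 where g: "g holomorphic_on S" "strict_mono (r0 :: nat \<Rightarrow> nat)"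
    "\<And>x. x \<in> S \<Longrightarrow> (\<lambda>n. h (r0 n) x) \<longlonglongrightarrow> g x" by blast
  have hU: "(\<lambda>n. h n x) \<longlonglongrightarrow> g x" if x: "x \<in> U" for x
  proof -
    obtain l where l: "(\<lambda>n. h n x) \<longlonglongrightarrow> l" using conv[OF x] by (auto simp: convergent_def)
    then have "(\<lambda>n. h (r0 n) x) \<longlonglongrightarrow> l" using LIMSEQ_subseq_LIMSEQ[OF l g(2)] by (simp add: o_def)
    moreover have "(\<lambda>n. h (r0 n) x) \<longlonglongrightarrow> g x" using g(3) that U by blast
    ultimately show ?thesis using l LIMSEQ_unique by blast
  qed
  show ?thesis
  proof (rule that[OF g(1)])
    fix K assume K: "compact K" "K \<subseteq> S"
    show "uniform_limit K h g sequentially"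
    proof (rule ccontr)
      assume "\<not> uniform_limit K h g sequentially"
      then obtain e where e: "e > 0" "\<not> (\<forall>\<^sub>F n in sequentially. \<forall>x\<in>K. dist (h n x) (g x) < e)"
        unfolding uniform_limit_iff by blast
      define B where "B = {n. \<not> (\<forall>x\<in>K. dist (h n x) (g x) < e)}"
      have "infinite B"
        using e(2) unfolding B_def eventually_cofinite[symmetric] cofinite_eq_sequentially .
      then obtain q :: "nat \<Rightarrow> nat" where q: "strict_mono q" "\<And>n. q n \<in> B"
        using infinite_enumerate by blast
      obtain g2 r2 where g2: "g2 holomorphic_on S" "strict_mono (r2 :: nat \<Rightarrow> nat)"
        "\<And>x. x \<in> S \<Longrightarrow> (\<lambda>n. h (q (r2 n)) x) \<longlonglongrightarrow> g2 x"
        "uniform_limit K (\<lambda>n. h (q (r2 n))) g2 sequentially"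
        using montel[of q] K by blast
      have "g2 x = g x" if "x \<in> U" for x
      proof -
        have "(\<lambda>n. h (q (r2 n)) x) \<longlonglongrightarrow> g x"
          using LIMSEQ_subseq_LIMSEQ[OF hU[OF that] strict_mono_o[OF q(1) g2(2)]] by (simp add: o_def)
        then show ?thesis using g2(3) that U LIMSEQ_unique by blast
      qed
      then have eq: "g2 x = g x" if "x \<in> S" for x
        using analytic_continuation_open[OF U(1) S(1) U(3) S(2) U(2) g2(1) g(1)] that by blast
      have "\<forall>\<^sub>F n in sequentially. \<forall>x\<in>K. dist (h (q (r2 n)) x) (g2 x) < e"
        using g2(4) e(1) unfolding uniform_limit_iff by blast
      then obtain n where "\<forall>x\<in>K. dist (h (q (r2 n)) x) (g2 x) < e"
        by (auto simp: eventually_sequentially)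
      then have "\<forall>x\<in>K. dist (h (q (r2 n)) x) (g x) < e" using eq K by (metis subsetD)
      then show False using q(2)[of "r2 n"] by (simp add: B_def)
    qed
  qed
qed

lemma Vitali_pointwise:
  fixes h :: "nat \<Rightarrow> complex \<Rightarrow> complex"
  assumes S: "open S" "connected S" "S \<noteq> {}"
    and hol: "\<And>n. h n holomorphic_on S"
    and bdd: "\<And>K. compact K \<Longrightarrow> K \<subseteq> S \<Longrightarrow> \<exists>B. \<forall>n. \<forall>z\<in>K. norm (h n z) \<le> B"
    and lim: "\<And>z. z \<in> S \<Longrightarrow> (\<lambda>n. h n z) \<longlonglongrightarrow> g z"
  shows "compact K \<Longrightarrow> K \<subseteq> S \<Longrightarrow> uniform_limit K h g sequentially"
proof -
  assume K: "compact K" "K \<subseteq> S"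
  have "convergent (\<lambda>n. h n z)" if "z \<in> S" for z using lim[OF that] by (rule convergentI)
  then obtain g' where g': "\<And>K. compact K \<Longrightarrow> K \<subseteq> S \<Longrightarrow> uniform_limit K h g' sequentially"
    using Vitali[OF S(1,2) hol bdd S(1) order_refl S(3)] by blast
  have "g' z = g z" if "z \<in> K" for z
    using tendsto_uniform_limitI[OF g'[OF K] that] lim[of z] that K LIMSEQ_unique by blast
  then show ?thesis
    using g'[OF K] uniform_limit_cong'[of K h h g' g] by simp
qed

section \<open>The limit of the block quotients\<close>

context regular_recurrence begin

abbreviation D :: "complex set" where "D \<equiv> - \<real>\<^sub>\<ge>\<^sub>0"

text \<open>The operator s d/ds applied to -log f_n. The sign makes it the increment of s p'/p from
  index n to n + r, so that sums over a residue class telescope.\<close>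

definition g where "g n s = - s * deriv (f n) s / f n s"

lemma block_ratio_holomorphic: "f n holomorphic_on D"
  unfolding block_ratio_def using reduced_P_nonzero by (intro holomorphic_intros) blast

text \<open>The cut plane and the operator s d/ds are invariant under positive dilations, so every
  rescaled quotient satisfies the hypotheses of \<open>norm_logderiv_le\<close> on the same
  domain.\<close>

lemma scaled_block_ratio:
  assumes "0 < x"
  shows "(\<lambda>s. f n (of_real x * s)) holomorphic_on D"
    and "s \<in> D \<Longrightarrow> f n (of_real x * s) \<notin> \<real>\<^sub>\<le>\<^sub>0"
    and "s \<in> D \<Longrightarrow> g n (of_real x * s) = - s * (deriv (\<lambda>s. f n (of_real x * s)) s / f n (of_real x * s))"
proof -
  have maps: "of_real x * s \<in> D" if "s \<in> D" for s
    using scale_notin_nonneg_Reals[OF _ assms] that by auto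
  show "(\<lambda>s. f n (of_real x * s)) holomorphic_on D"
    by (rule holomorphic_on_compose_gen[OF _ block_ratio_holomorphic, unfolded o_def])
      (use maps in \<open>auto intro!: holomorphic_intros\<close>)
  show "f n (of_real x * s) \<notin> \<real>\<^sub>\<le>\<^sub>0" if "s \<in> D"
    using maps[OF that] block_ratio_notin_nonpos by auto
  assume s: "s \<in> D"
  have "(f n has_field_derivative deriv (f n) (of_real x * s)) (at (of_real x * s))"
    using block_ratio_holomorphic open_cut_plane maps[OF s] by (rule holomorphic_derivI)
  then have "((\<lambda>s. f n (of_real x * s)) has_field_derivative of_real x * deriv (f n) (of_real x * s)) (at s)"
    by (rule DERIV_chain2[THEN DERIV_cong]) (auto intro!: derivative_eq_intros)
  then have "deriv (\<lambda>s. f n (of_real x * s)) s = of_real x * deriv (f n) (of_real x * s)"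
    by (rule DERIV_imp_deriv)
  then show "g n (of_real x * s) = - s * (deriv (\<lambda>s. f n (of_real x * s)) s / f n (of_real x * s))"
    by (simp add: g_def)
qed

text \<open>The bound depends neither on n nor on x. It dominates the terms of small index in the
  Riemann sums, where no convergence is available.\<close>

lemma norm_g_le:
  assumes "0 < x" "0 < d" "cball s d \<subseteq> D"
  shows "norm (g n (of_real x * s)) \<le> norm s * (exp (2 * pi) / d)"
proof -
  have s: "s \<in> D" using assms by (meson centre_in_cball less_imp_le subsetD)
  have "norm (deriv (\<lambda>s. f n (of_real x * s)) s / f n (of_real x * s)) \<le> exp (2 * pi) / d"
    using scaled_block_ratio(1,2)[OF assms(1)] by (intro norm_logderiv_le[OF open_cut_plane _ _ assms(2,3)])
  then show ?thesis
    unfolding scaled_block_ratio(3)[OF assms(1) s] norm_mult norm_minus_cancel by (intro mult_left_mono) auto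
qed

text \<open>Bundled so that one function can be fixed by choice with all its properties, while the
  local inverse it comes from is forgotten. The equation and the limit at 0 identify F; the uniform
  limits identify Phi and the limit of the logarithmic derivatives.\<close>

definition is_ratio_limit :: "(complex \<Rightarrow> complex) \<Rightarrow> bool" where
  "is_ratio_limit h \<longleftrightarrow> h holomorphic_on D \<and> (\<forall>s\<in>D. h s \<noteq> 0) \<and>
     (\<forall>K. compact K \<longrightarrow> K \<subseteq> D \<longrightarrow>
        uniform_limit K (\<lambda>n s. f n (s / of_real (real n powr \<gamma>))) h sequentially \<and>
        uniform_limit K (\<lambda>n s. g n (s / of_real (real n powr \<gamma>))) (\<lambda>s. - s * (deriv h s / h s)) sequentially) \<and>
     (\<forall>s\<in>D. s * h s * A r \<alpha> (s * h s) = s) \<and> (h \<longlongrightarrow> 1) (at 0 within D)"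

text \<open>Vitali's theorem is applied to the logarithms: their derivatives are locally bounded
  uniformly in n, they converge near 0, and integration from a point near 0 then bounds them on
  compact sets.\<close>

lemma ex_ratio_limit: "\<exists>h. is_ratio_limit h"
proof -
  obtain \<rho> K0 where \<rho>: "0 < \<rho>" and K0: "K0 holomorphic_on ball 0 \<rho>" "K0 0 = 0"
    "\<And>s. s \<in> ball 0 \<rho> \<Longrightarrow> K0 s * A r \<alpha> (K0 s) = s" "\<And>s. s \<in> ball 0 \<rho> \<Longrightarrow> norm (1 / A r \<alpha> (K0 s) - 1) < 1"
    "\<And>s. s \<in> ball 0 \<rho> \<Longrightarrow> A r \<alpha> (K0 s) \<noteq> 0"
    "\<And>s. s \<in> ball 0 \<rho> \<Longrightarrow> s \<noteq> 0 \<Longrightarrow> (\<lambda>n. f n (s / of_real (real n powr \<gamma>))) \<longlonglongrightarrow> 1 / A r \<alpha> (K0 s)"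
    by (rule local_convergence) blast
  \<comment> \<open>The index is shifted because at n = 0 the factor 1 / n^\<gamma> degenerates to
    0, whereas a positive dilation is required.\<close>
  define x where "x n = 1 / real (Suc n) powr \<gamma>" for n
  have x: "0 < x n" for n by (simp add: x_def)
  define \<phi> where "\<phi> n s = f (Suc n) (of_real (x n) * s)" for n s
  define \<psi> where "\<psi> n s = Ln (\<phi> n s)" for n s
  have \<phi>_eq: "\<phi> n s = f (Suc n) (s / of_real (real (Suc n) powr \<gamma>))" for n s
    by (simp add: \<phi>_def x_def)
  have \<phi>: "\<phi> n holomorphic_on D" "s \<in> D \<Longrightarrow> \<phi> n s \<notin> \<real>\<^sub>\<le>\<^sub>0" for n s
    unfolding \<phi>_def using scaled_block_ratio(1,2)[OF x] by auto
  have \<psi>: "\<psi> n holomorphic_on D" for n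
    unfolding \<psi>_def using \<phi> by (intro holomorphic_intros) auto
  have \<phi>_exp: "\<phi> n s = exp (\<psi> n s)" if "s \<in> D" for n s
  proof -
    have "\<phi> n s \<noteq> 0" using \<phi>(2)[OF that, of n] by auto
    then show ?thesis by (simp add: \<psi>_def)
  qed
  have \<psi>': "norm (deriv (\<psi> n) s) \<le> exp (2 * pi) / d" if "0 < d" "cball s d \<subseteq> D" for n s d
  proof -
    have s: "s \<in> D" using that by (meson centre_in_cball less_imp_le subsetD)
    have "(\<phi> n has_field_derivative deriv (\<phi> n) s) (at s)"
      using \<phi>(1) open_cut_plane s by (rule holomorphic_derivI)
    then have "(\<psi> n has_field_derivative deriv (\<phi> n) s / \<phi> n s) (at s)"
      unfolding \<psi>_def using \<phi>(2)[OF s] by (auto intro!: derivative_eq_intros simp: field_simps)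
    then have "deriv (\<psi> n) s = deriv (\<phi> n) s / \<phi> n s" by (rule DERIV_imp_deriv)
    also have "norm \<dots> \<le> exp (2 * pi) / d"
      using \<phi> that by (intro norm_logderiv_le[OF open_cut_plane]) auto
    finally show ?thesis .
  qed
  define U where "U = D \<inter> ball 0 \<rho>"
  have U: "open U" "U \<subseteq> D" unfolding U_def using open_cut_plane by auto
  have s0: "of_real (- \<rho> / 2) \<in> U"
    using \<rho> by (auto simp: U_def complex_nonneg_Reals_iff)
  then have Une: "U \<noteq> {}" by blast
  have U_lim: "(\<lambda>n. \<phi> n s) \<longlonglongrightarrow> 1 / A r \<alpha> (K0 s)" if "s \<in> U" for s
  proof -
    have "s \<noteq> 0" "s \<in> ball 0 \<rho>" using that by (auto simp: U_def)
    then show ?thesis unfolding \<phi>_eq by (intro LIMSEQ_Suc K0(6))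
  qed
  have \<psi>_lim: "convergent (\<lambda>n. \<psi> n s)" if "s \<in> U" for s
  proof -
    \<comment> \<open>A number within distance 1 of 1 has positive real part. The limit is thus off
      the branch cut and \<open>Ln\<close> may be passed to the limit.\<close>
    have "norm (1 / A r \<alpha> (K0 s) - 1) < 1" using that K0(4)[of s] by (auto simp: U_def)
    then have "0 < Re (1 / A r \<alpha> (K0 s))"
      using abs_Re_le_cmod[of "1 / A r \<alpha> (K0 s) - 1"] by (auto simp: abs_if split: if_splits)
    then have "1 / A r \<alpha> (K0 s) \<notin> \<real>\<^sub>\<le>\<^sub>0" by (auto simp: complex_nonpos_Reals_iff)
    then have "(\<lambda>n. \<psi> n s) \<longlonglongrightarrow> Ln (1 / A r \<alpha> (K0 s))"
      unfolding \<psi>_def by (intro tendsto_Ln U_lim that)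
    then show ?thesis by (rule convergentI)
  qed
  have bdd: "\<exists>B. \<forall>n. \<forall>s\<in>K. norm (\<psi> n s) \<le> B" if K: "compact K" "K \<subseteq> D" for K
  proof -
    define s0 :: complex where "s0 = of_real (- \<rho> / 2)"
    \<comment> \<open>The union of the segments from the anchor s0 to K. It stays in the cut plane,
      which is starlike about each negative real number; being compact, it admits one radius d for
      all derivative bounds.\<close>
    define T where "T = (\<lambda>(u, s). (1 - u) *\<^sub>R s0 + u *\<^sub>R s) ` ({0..1} \<times> K)"
    have "compact T" unfolding T_def case_prod_unfold
      using K by (intro compact_continuous_image compact_Times continuous_intros) auto
    have Tseg: "closed_segment s0 s \<subseteq> T" if "s \<in> K" for s
      using that by (force simp: closed_segment_def T_def)
    have "T \<subseteq> D"
    proof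
      fix z assume "z \<in> T"
      then obtain u s where us: "0 \<le> u" "u \<le> 1" "s \<in> K" "z = (1 - u) *\<^sub>R s0 + u *\<^sub>R s"
        by (auto simp: T_def)
      then have s: "s \<in> D" using K by auto
      show "z \<in> D"
      proof
        assume "z \<in> \<real>\<^sub>\<ge>\<^sub>0"
        then have *: "u * Im s = 0" "(1 - u) * (\<rho> / 2) \<le> u * Re s"
          using us by (auto simp: complex_nonneg_Reals_iff s0_def)
        have "u \<noteq> 0" using * \<rho> by auto
        then have u: "0 < u" using us by simp
        have "0 \<le> (1 - u) * (\<rho> / 2)" using us \<rho> by simp
        then have "0 \<le> u * Re s" using *(2) by linarith
        then have "0 \<le> Re s" using u by (simp add: zero_le_mult_iff)
        moreover have "Im s = 0" using *(1) u by simp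
        ultimately have "s \<in> \<real>\<^sub>\<ge>\<^sub>0" by (simp add: complex_nonneg_Reals_iff)
        then show False using s by simp
      qed
    qed
    obtain d where d: "d > 0" "(\<Union>s\<in>T. cball s d) \<subseteq> D"
      using compact_subset_open_imp_cball_epsilon_subset[OF \<open>compact T\<close> open_cut_plane \<open>T \<subseteq> D\<close>] by blast
    have "Bseq (\<lambda>n. \<psi> n s0)"
      using \<psi>_lim[OF s0] unfolding s0_def by (rule convergent_imp_Bseq)
    then obtain B0 where B0: "\<And>n. norm (\<psi> n s0) \<le> B0" unfolding Bseq_def by blast
    obtain R where R: "\<And>s. s \<in> K \<Longrightarrow> norm s \<le> R" using compact_imp_bounded[OF K(1)] bounded_iff by blast
    have "norm (\<psi> n s) \<le> exp (2 * pi) / d * (R + norm s0) + B0" if s: "s \<in> K" for n s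
    proof -
      have "norm (\<psi> n s - \<psi> n s0) \<le> exp (2 * pi) / d * norm (s - s0)"
      proof (rule field_differentiable_bound[OF convex_closed_segment[of s0 s]])
        fix z assume "z \<in> closed_segment s0 s"
        then have z: "z \<in> T" using Tseg[OF s] by blast
        show "norm (deriv (\<psi> n) z) \<le> exp (2 * pi) / d"
          using z d by (intro \<psi>') auto
        show "(\<psi> n has_field_derivative deriv (\<psi> n) z) (at z within closed_segment s0 s)"
          by (rule has_field_derivative_at_within, rule holomorphic_derivI[OF \<psi> open_cut_plane])
            (use z \<open>T \<subseteq> D\<close> in blast)
      qed simp_all
      also have "\<dots> \<le> exp (2 * pi) / d * (R + norm s0)"
        using R[OF s] norm_triangle_ineq4[of s s0] d by (intro mult_left_mono) auto
      finally show ?thesis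
        using norm_triangle_ineq2[of "\<psi> n s" "\<psi> n s0"] B0[of n] by linarith
    qed
    then show ?thesis by blast
  qed
  obtain \<psi>0 where \<psi>0: "\<psi>0 holomorphic_on D"
    "\<And>K. compact K \<Longrightarrow> K \<subseteq> D \<Longrightarrow> uniform_limit K \<psi> \<psi>0 sequentially"
    using Vitali[OF open_cut_plane connected_cut_plane \<psi> bdd U Une \<psi>_lim] by blast
  \<comment> \<open>As an exponential the limit has no zeros, so the logarithmic derivatives pass to
    the limit as well.\<close>
  define h where "h s = exp (\<psi>0 s)" for s
  have h: "h holomorphic_on D" "h s \<noteq> 0" for s
    unfolding h_def using \<psi>0(1) by (auto intro!: holomorphic_intros)
  have h_lim: "(\<lambda>n. \<phi> n s) \<longlonglongrightarrow> h s" if "s \<in> D" for s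
  proof -
    have "(\<lambda>n. \<psi> n s) \<longlonglongrightarrow> \<psi>0 s"
      using tendsto_uniform_limitI[OF \<psi>0(2)[of "{s}"]] that by auto
    then show ?thesis unfolding h_def \<phi>_exp[OF that] by (intro tendsto_exp)
  qed
  have Dne: "D \<noteq> {}" using Une U by blast
  have \<phi>_unif: "uniform_limit K \<phi> h sequentially" if K: "compact K" "K \<subseteq> D" for K
  proof (rule Vitali_pointwise[OF open_cut_plane connected_cut_plane Dne \<phi>(1) _ h_lim K])
    fix K' :: "complex set" assume K': "compact K'" "K' \<subseteq> D"
    then obtain B where B: "\<And>n s. s \<in> K' \<Longrightarrow> norm (\<psi> n s) \<le> B" using bdd by meson
    have "norm (\<phi> n s) \<le> exp B" if "s \<in> K'" for n s
      using B[OF that, of n] complex_Re_le_cmod[of "\<psi> n s"] K' that by (subst \<phi>_exp) auto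
    then show "\<exists>B. \<forall>n. \<forall>z\<in>K'. norm (\<phi> n z) \<le> B" by blast
  qed
  define G where "G n s = - s * (deriv (\<phi> n) s / \<phi> n s)" for n s
  have G_eq: "G n s = g (Suc n) (s / of_real (real (Suc n) powr \<gamma>))" if "s \<in> D" for n s
    using scaled_block_ratio(3)[OF x[of n] that, of "Suc n"] by (simp add: G_def \<phi>_def[abs_def] x_def)
  have G_hol: "G n holomorphic_on D" for n
    unfolding G_def using \<phi>(1) by (intro holomorphic_intros open_cut_plane) (simp_all add: \<phi>_exp)
  have G_lim: "(\<lambda>n. G n s) \<longlonglongrightarrow> - s * (deriv h s / h s)" if s: "s \<in> D" for s
  proof -
    obtain d where d: "d > 0" "cball s d \<subseteq> D"
      using open_cut_plane s open_contains_cball by blast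
    have "uniform_limit (ball s d) \<phi> h sequentially"
      using \<phi>_unif[OF compact_cball d(2)] by (rule uniform_limit_on_subset) auto
    moreover have "\<phi> n holomorphic_on ball s d" for n
      using \<phi>(1) d(2) by (metis ball_subset_cball holomorphic_on_subset subset_trans)
    ultimately have "(\<lambda>n. (deriv ^^ 1) (\<phi> n) s) \<longlonglongrightarrow> (deriv ^^ 1) h s"
      using d by (intro higher_deriv_complex_uniform_limit[where A = "ball s d"]) auto
    then have "(\<lambda>n. deriv (\<phi> n) s) \<longlonglongrightarrow> deriv h s" by simp
    then show ?thesis
      unfolding G_def using h(2)[of s] h_lim[OF s] by (intro tendsto_intros)
  qed
  have G_unif: "uniform_limit K G (\<lambda>s. - s * (deriv h s / h s)) sequentially" if K: "compact K" "K \<subseteq> D" for K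
  proof (rule Vitali_pointwise[OF open_cut_plane connected_cut_plane Dne G_hol _ G_lim K])
    fix K' :: "complex set" assume K': "compact K'" "K' \<subseteq> D"
    obtain d where d: "d > 0" "(\<Union>s\<in>K'. cball s d) \<subseteq> D"
      using compact_subset_open_imp_cball_epsilon_subset[OF K'(1) open_cut_plane K'(2)] by blast
    obtain R where R: "\<And>s. s \<in> K' \<Longrightarrow> norm s \<le> R" using compact_imp_bounded[OF K'(1)] bounded_iff by blast
    have "norm (G n s) \<le> R * (exp (2 * pi) / d)" if "s \<in> K'" for n s
    proof -
      have "norm (deriv (\<phi> n) s / \<phi> n s) \<le> exp (2 * pi) / d"
        using \<phi> d that by (intro norm_logderiv_le[OF open_cut_plane]) auto
      then show ?thesis
        unfolding G_def norm_mult norm_minus_cancel using R[OF that] norm_ge_zero[of s] order_trans[OF norm_ge_zero R[OF that]]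
        by (intro mult_mono) auto
    qed
    then show "\<exists>B. \<forall>n. \<forall>z\<in>K'. norm (G n z) \<le> B" by blast
  qed
  have hU: "h s = 1 / A r \<alpha> (K0 s)" "s * h s = K0 s" if "s \<in> U" for s
  proof -
    show *: "h s = 1 / A r \<alpha> (K0 s)"
      using h_lim[of s] U_lim[OF that] U that LIMSEQ_unique by blast
    show "s * h s = K0 s"
      unfolding * using K0(3)[of s] K0(5)[of s] that by (auto simp: U_def field_simps)
  qed
  \<comment> \<open>On U this is the equation of the local inverse; the identity theorem carries it
    to the whole cut plane.\<close>
  have eq: "s * h s * A r \<alpha> (s * h s) = s" if "s \<in> D" for s
  proof (rule analytic_continuation_open[OF U(1) open_cut_plane Une connected_cut_plane U(2)])
    show "(\<lambda>s. s * h s * A r \<alpha> (s * h s)) holomorphic_on D" by (intro holomorphic_intros h(1))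
    show "z * h z * A r \<alpha> (z * h z) = z" if "z \<in> U" for z
      unfolding hU(2)[OF that] using that K0(3)[of z] by (auto simp: U_def)
  qed (use that in \<open>auto intro!: holomorphic_intros\<close>)
  have "(K0 \<longlongrightarrow> K0 0) (at 0)"
    using K0(1) \<rho> by (metis centre_in_ball continuous_on_eq_continuous_at holomorphic_on_imp_continuous_on isCont_def open_ball)
  then have "(K0 \<longlongrightarrow> 0) (at 0 within D)"
    unfolding K0(2) using at_within_le_at by (rule tendsto_mono[rotated])
  then have "((\<lambda>s. A r \<alpha> (K0 s)) \<longlongrightarrow> A r \<alpha> 0) (at 0 within D)"
    by (rule isCont_tendsto_compose[OF A_continuous_at])
  then have "((\<lambda>s. 1 / A r \<alpha> (K0 s)) \<longlongrightarrow> 1 / 1) (at 0 within D)"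
    unfolding A_0 by (intro tendsto_divide tendsto_const) auto
  moreover have "\<forall>\<^sub>F s in at 0 within D. 1 / A r \<alpha> (K0 s) = h s"
    unfolding eventually_at using \<rho> hU(1) by (intro exI[of _ \<rho>]) (auto simp: U_def)
  ultimately have "(h \<longlongrightarrow> 1 / 1) (at 0 within D)"
    by (rule Lim_transform_eventually)
  then have "(h \<longlongrightarrow> 1) (at 0 within D)" by simp
  moreover have "uniform_limit K (\<lambda>n s. f n (s / of_real (real n powr \<gamma>))) h sequentially"
    if "compact K" "K \<subseteq> D" for K
    using \<phi>_unif[OF that] unfolding \<phi>_eq[abs_def]
    by (subst filterlim_sequentially_Suc[symmetric])
  moreover have "uniform_limit K (\<lambda>n s. g n (s / of_real (real n powr \<gamma>))) (\<lambda>s. - s * (deriv h s / h s)) sequentially"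
    if "compact K" "K \<subseteq> D" for K
  proof (subst filterlim_sequentially_Suc[symmetric])
    have "\<forall>\<^sub>F n in sequentially. \<forall>s\<in>K. G n s = g (Suc n) (s / of_real (real (Suc n) powr \<gamma>))"
      using that(2) G_eq by (intro always_eventually allI ballI) blast
    then show "uniform_limit K (\<lambda>n s. g (Suc n) (s / of_real (real (Suc n) powr \<gamma>))) (\<lambda>s. - s * (deriv h s / h s)) sequentially"
      by (rule uniform_limit_cong[THEN iffD1, OF _ refl G_unif[OF that]])
  qed
  ultimately show ?thesis
    unfolding is_ratio_limit_def using h eq by blast
qed

end

section \<open>The functions $F$ and $\Phi$\<close>

text \<open>The prefactor cancels the n-th power of the dilation x = N^(\<gamma>/(r+1)), and x^(r+1)
  = N^\<gamma>. Rescaling by N thus acts on s alone.\<close>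

lemma poly_Q_eq:
  assumes "1 \<le> N" "z \<noteq> 0"
  shows "poly (Q r \<gamma> c n N) z = z ^ n * reduced_P r c n (1 / z ^ (r + 1) / of_real (real N powr \<gamma>))"
proof -
  define x where "x = real N powr (\<gamma> / real (r + 1))"
  have x: "0 < x" using assms by (simp add: x_def)
  have xn: "real N powr (- (real n * \<gamma> / real (r + 1))) = inverse (x ^ n)"
    unfolding x_def powr_minus using assms by (simp add: powr_power mult.commute)
  have xr: "x ^ (r + 1) = real N powr \<gamma>"
    unfolding x_def using assms by (simp add: powr_power del: power_Suc)
  have "poly (Q r \<gamma> c n N) z = of_real (inverse (x ^ n)) * poly (P r c n) (of_real x * z)"
    unfolding Q_def xn by (simp add: poly_pcompose x_def mult.commute)
  also have "\<dots> = of_real (inverse (x ^ n)) * ((of_real x * z) ^ n * reduced_P r c n (1 / (of_real x * z) ^ (r + 1)))"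
    using x assms by (subst poly_P_eq) auto
  also have "\<dots> = z ^ n * reduced_P r c n (1 / (of_real x * z) ^ (r + 1))"
    using x by (simp add: power_mult_distrib del: power_Suc)
  also have "1 / (of_real x * z) ^ (r + 1) = 1 / z ^ (r + 1) / of_real (real N powr \<gamma>)"
    unfolding power_mult_distrib of_real_power[symmetric] xr by (simp del: power_Suc)
  finally show ?thesis .
qed

text \<open>\<open>Lim\<close> is determined only along a proper filter. The pairs (floor (t k), k)
  witness that this one is proper.\<close>

lemma ratio_filter_nontrivial:
  assumes "0 < t"
  shows "ratio_filter t \<noteq> bot"
proof
  assume bot: "ratio_filter t = bot"
  have fl: "filterlim (\<lambda>k. nat \<lfloor>t * real k\<rfloor>) at_top sequentially"
    unfolding filterlim_at_top
  proof
    fix Z :: nat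
    have "\<forall>\<^sub>F k in sequentially. real Z / t \<le> real k" by real_asymp
    then show "\<forall>\<^sub>F k in sequentially. Z \<le> nat \<lfloor>t * real k\<rfloor>"
      by eventually_elim (use assms in \<open>simp add: le_nat_floor field_simps\<close>)
  qed
  have "(\<lambda>k. real (nat \<lfloor>t * real k\<rfloor>) / real k) \<longlonglongrightarrow> t"
  proof (rule tendsto_sandwich)
    show "\<forall>\<^sub>F k in sequentially. t - 1 / real k \<le> real (nat \<lfloor>t * real k\<rfloor>) / real k"
      using eventually_gt_at_top[of 0]
    proof eventually_elim
      case (elim k)
      have "t * real k - 1 \<le> real (nat \<lfloor>t * real k\<rfloor>)" using assms by linarith
      then have "(t * real k - 1) / real k \<le> real (nat \<lfloor>t * real k\<rfloor>) / real k"
        by (rule divide_right_mono) simp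
      moreover have "(t * real k - 1) / real k = t - 1 / real k" using elim by (simp add: field_simps)
      ultimately show ?case by simp
    qed
    show "\<forall>\<^sub>F k in sequentially. real (nat \<lfloor>t * real k\<rfloor>) / real k \<le> t"
      using eventually_gt_at_top[of 0]
    proof eventually_elim
      case (elim k)
      have "real (nat \<lfloor>t * real k\<rfloor>) \<le> t * real k" using assms by (simp add: of_nat_floor)
      then show ?case using elim by (simp add: field_simps)
    qed
  qed (real_asymp, simp)
  with fl have "filterlim (\<lambda>k. (nat \<lfloor>t * real k\<rfloor>, k)) (ratio_filter t) sequentially"
    unfolding ratio_filter_def by (simp add: filterlim_inf filterlim_filtercomap_iff o_def)
  then have "\<forall>\<^sub>F k::nat in sequentially. False"
    unfolding bot filterlim_iff by (auto dest: spec[of _ "\<lambda>_. False"])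
  then show False by simp
qed

lemma eventually_ratio_filter_fst:
  "eventually Pn at_top \<Longrightarrow> \<forall>\<^sub>F x in ratio_filter t. Pn (fst x)"
  unfolding ratio_filter_def
  by (rule filter_leD[OF inf_le1]) (rule eventually_filtercomapI)

lemma tendsto_ratio_filter: "((\<lambda>x. real (fst x) / real (snd x)) \<longlongrightarrow> t) (ratio_filter t)"
  unfolding ratio_filter_def case_prod_unfold
  by (rule filterlim_mono[OF filterlim_filtercomap order_refl inf_le2])

lemma has_field_derivative_inverse_power:
  fixes z :: complex
  assumes "z \<noteq> 0"
  shows "((\<lambda>w. 1 / w ^ n) has_field_derivative - (of_nat n * (1 / z ^ n) / z)) (at z)"
proof (cases n)
  case (Suc m)
  have "((\<lambda>w. inverse (w ^ Suc m)) has_field_derivative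
      - (inverse (z ^ Suc m) * ((1 + of_nat m) * (1 * z ^ m)) * inverse (z ^ Suc m))) (at z)"
    using assms by (intro DERIV_inverse' DERIV_power_Suc DERIV_ident) auto
  then have "((\<lambda>w. inverse (w ^ Suc m)) has_field_derivative - (of_nat (Suc m) * (1 / z ^ Suc m) / z)) (at z)"
    by (rule DERIV_cong) (use assms in \<open>simp add: field_simps\<close>)
  then show ?thesis by (simp add: Suc inverse_eq_divide del: power_Suc of_nat_Suc)
qed simp

section \<open>Identification of F and Phi\<close>

context regular_recurrence begin

definition H where "H = (SOME h. is_ratio_limit h)"
definition g_limit where "g_limit s = - s * (deriv H s / H s)"

lemma is_ratio_limit_H: "is_ratio_limit H"
  unfolding H_def using ex_ratio_limit by (rule someI_ex)

lemma H_holomorphic: "H holomorphic_on D"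
  and H_nonzero: "s \<in> D \<Longrightarrow> H s \<noteq> 0"
  and H_uniform: "compact K \<Longrightarrow> K \<subseteq> D \<Longrightarrow> uniform_limit K (\<lambda>n s. f n (s / of_real (real n powr \<gamma>))) H sequentially"
  and g_limit_uniform: "compact K \<Longrightarrow> K \<subseteq> D \<Longrightarrow> uniform_limit K (\<lambda>n s. g n (s / of_real (real n powr \<gamma>))) g_limit sequentially"
  and H_eq: "s \<in> D \<Longrightarrow> s * H s * A r \<alpha> (s * H s) = s"
  and H_tendsto: "(H \<longlongrightarrow> 1) (at 0 within D)"
  using is_ratio_limit_H unfolding is_ratio_limit_def g_limit_def[abs_def] by simp_all

lemma H_has_derivative: "s \<in> D \<Longrightarrow> (H has_field_derivative deriv H s) (at s)"
  by (rule holomorphic_derivI[OF H_holomorphic open_cut_plane])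

lemma g_limit_continuous: "continuous_on D g_limit"
  unfolding g_limit_def using H_nonzero
  by (intro continuous_intros holomorphic_on_imp_continuous_on H_holomorphic holomorphic_deriv open_cut_plane) auto

text \<open>H(1/y)/y satisfies the three conditions, so the chosen F satisfies them too. Both
  functions tend to 0 at infinity, because y times either tends to 1. There u A(u) = 1/y has only
  one small solution, and the identity theorem extends the equality to the cut plane.\<close>

lemma F_eq:
  assumes y: "y \<in> D"
  shows "F r \<alpha> y = H (1 / y) / y"
proof -
  define K where "K y = H (1 / y) / y" for y
  define Fl where "Fl = inf at_infinity (principal D)"
  have inv: "1 / y \<in> D" "y \<noteq> 0" if "y \<in> D" for y
    using inverse_notin_nonneg_Reals[of y] that by (simp, use that in auto)
  have holK: "K holomorphic_on D"
    unfolding K_def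
    by (intro holomorphic_intros holomorphic_on_compose_gen[OF _ H_holomorphic, unfolded o_def]) (use inv in auto)
  have eqK: "y * K y * A r \<alpha> (K y) = 1" if "y \<in> D" for y
    using H_eq[OF inv(1)[OF that]] inv(2)[OF that] by (simp add: K_def field_simps)
  have inv0: "((\<lambda>y. inverse y) \<longlongrightarrow> (0 :: complex)) Fl"
    unfolding Fl_def using tendsto_inverse_0 by (rule tendsto_mono[OF inf_le1])
  have ev: "\<forall>\<^sub>F y in Fl. y \<in> D" unfolding Fl_def by (simp add: eventually_inf_principal)
  have "filterlim (\<lambda>y. 1 / y) (at 0 within D) Fl"
    unfolding filterlim_at
  proof
    show "\<forall>\<^sub>F y in Fl. 1 / y \<in> D \<and> 1 / y \<noteq> 0"
      using ev by eventually_elim (use inv in auto)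
    show "((\<lambda>y. 1 / y) \<longlongrightarrow> (0 :: complex)) Fl" using inv0 by (simp add: inverse_eq_divide)
  qed
  then have "((\<lambda>y. H (1 / y)) \<longlongrightarrow> 1) Fl" by (rule filterlim_compose[OF H_tendsto])
  moreover have "\<forall>\<^sub>F y in Fl. H (1 / y) = y * K y"
    using ev by eventually_elim (use inv in \<open>auto simp: K_def\<close>)
  ultimately have limK: "((\<lambda>y. y * K y) \<longlongrightarrow> 1) Fl" by (rule Lim_transform_eventually)
  have "F r \<alpha> holomorphic_on D \<and> (\<forall>y\<in>D. 1 = y * F r \<alpha> y * A r \<alpha> (F r \<alpha> y)) \<and> ((\<lambda>y. y * F r \<alpha> y) \<longlongrightarrow> 1) Fl"
    unfolding F_def Fl_def
    by (rule someI[where x = K]) (use holK eqK limK in \<open>auto simp: Fl_def\<close>)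
  then have holF: "F r \<alpha> holomorphic_on D"
    and eqF: "\<And>y. y \<in> D \<Longrightarrow> y * F r \<alpha> y * A r \<alpha> (F r \<alpha> y) = 1"
    and limF: "((\<lambda>y. y * F r \<alpha> y) \<longlongrightarrow> 1) Fl" by auto
  obtain \<delta> where \<delta>: "\<delta> > 0" "inj_on (\<lambda>u. u * A r \<alpha> u) (ball 0 \<delta>)"
    by (rule inverse_of_uA[of 1 r \<alpha>]) auto
  have small: "\<forall>\<^sub>F y in Fl. f y \<in> ball 0 \<delta>" if "((\<lambda>y. y * f y) \<longlongrightarrow> 1) Fl" for f :: "complex \<Rightarrow> complex"
  proof -
    have "((\<lambda>y. inverse y * (y * f y)) \<longlongrightarrow> 0 * 1) Fl" by (intro tendsto_mult inv0 that)
    moreover have "\<forall>\<^sub>F y in Fl. inverse y * (y * f y) = f y"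
      using ev by eventually_elim (use inv in auto)
    ultimately have "(f \<longlongrightarrow> 0 * 1) Fl" by (rule Lim_transform_eventually)
    then show ?thesis using tendstoD[of f 0 Fl \<delta>] \<delta> by (simp add: dist_commute)
  qed
  have "\<forall>\<^sub>F y in Fl. F r \<alpha> y = K y"
    using ev small[OF limF] small[OF limK]
  proof eventually_elim
    case (elim y)
    have "F r \<alpha> y * A r \<alpha> (F r \<alpha> y) = K y * A r \<alpha> (K y)"
      using eqF[OF elim(1)] eqK[OF elim(1)] inv(2)[OF elim(1)]
      by (metis mult.assoc mult_left_cancel)
    then show ?case using inj_onD[OF \<delta>(2)] elim(2,3) by blast
  qed
  then obtain b where b: "\<And>y. b \<le> norm y \<Longrightarrow> y \<in> D \<Longrightarrow> F r \<alpha> y = K y"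
    unfolding Fl_def eventually_inf_principal eventually_at_infinity by blast
  define U where "U = D - cball 0 \<bar>b\<bar>"
  have U: "open U" "U \<subseteq> D" unfolding U_def using open_cut_plane by auto
  have "norm (of_real (- \<bar>b\<bar> - 1) :: complex) = \<bar>b\<bar> + 1" unfolding norm_of_real by simp
  then have "of_real (- \<bar>b\<bar> - 1) \<in> U" unfolding U_def by (simp add: complex_nonneg_Reals_iff)
  then have "U \<noteq> {}" by blast
  have "F r \<alpha> y = K y"
    by (rule analytic_continuation_open[OF U(1) open_cut_plane \<open>U \<noteq> {}\<close> connected_cut_plane U(2) holF holK _ y])
      (use b in \<open>auto simp: U_def\<close>)
  then show ?thesis by (simp add: K_def)
qed

text \<open>With x = (n/N)^\<gamma> s one has s / N^\<gamma> = x / n^\<gamma>, and x tends to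
  t^\<gamma> s. Since this argument moves with (n, N), convergence uniform near the limit point is
  used.\<close>

lemma Phi_eq:
  assumes z: "z \<notin> star r" and t: "0 < t"
  shows "Phi r \<gamma> c z t = H (of_real (t powr \<gamma>) / z ^ (r + 1)) / z ^ r"
proof -
  define s where "s = 1 / z ^ (r + 1)"
  have s: "s \<in> D" and z0: "z \<noteq> 0" using off_star[OF z] by (auto simp: s_def)
  define \<sigma> where "\<sigma> = of_real (t powr \<gamma>) * s"
  have \<sigma>: "\<sigma> \<in> D" unfolding \<sigma>_def using scale_notin_nonneg_Reals[of s] s t by auto
  obtain d where d: "d > 0" "cball \<sigma> d \<subseteq> D"
    using open_cut_plane \<sigma> open_contains_cball by blast
  define x where "x p = of_real ((real (fst p) / real (snd p)) powr \<gamma>) * s" for p :: "nat \<times> nat"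
  have xlim: "(x \<longlongrightarrow> \<sigma>) (ratio_filter t)"
    unfolding x_def \<sigma>_def using tendsto_ratio_filter t by (intro tendsto_intros) auto
  have pos: "\<forall>\<^sub>F p in ratio_filter t. 0 < real (fst p) / real (snd p)"
    using order_tendstoD(1)[OF tendsto_ratio_filter t] .
  have "((\<lambda>p. f (fst p) (s / of_real (real (snd p) powr \<gamma>))) \<longlongrightarrow> H \<sigma>) (ratio_filter t)"
  proof (rule tendstoI)
    fix e :: real assume e: "e > 0"
    have "\<forall>\<^sub>F n in sequentially. \<forall>s\<in>cball \<sigma> d. dist (f n (s / of_real (real n powr \<gamma>))) (H s) < e / 2"
      using uniform_limitD[OF H_uniform[OF compact_cball d(2)], of "e / 2"] e by simp
    then have E1: "\<forall>\<^sub>F p in ratio_filter t. \<forall>s\<in>cball \<sigma> d. dist (f (fst p) (s / of_real (real (fst p) powr \<gamma>))) (H s) < e / 2"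
      by (rule eventually_ratio_filter_fst)
    have "isCont H \<sigma>" using H_has_derivative[OF \<sigma>] by (rule DERIV_isCont)
    then have "((\<lambda>p. H (x p)) \<longlongrightarrow> H \<sigma>) (ratio_filter t)" using xlim by (rule isCont_tendsto_compose)
    then have E2: "\<forall>\<^sub>F p in ratio_filter t. dist (H (x p)) (H \<sigma>) < e / 2"
      using e by (intro tendstoD) auto
    have E3: "\<forall>\<^sub>F p in ratio_filter t. dist (x p) \<sigma> < d" using d(1) by (rule tendstoD[OF xlim])
    show "\<forall>\<^sub>F p in ratio_filter t. dist (f (fst p) (s / of_real (real (snd p) powr \<gamma>))) (H \<sigma>) < e"
      using E1 E2 E3 pos
    proof eventually_elim
      case (elim p)
      have "0 < fst p" "0 < snd p" using elim(4) by (auto simp: zero_less_divide_iff)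
      then have "s / of_real (real (snd p) powr \<gamma>) = x p / of_real (real (fst p) powr \<gamma>)"
        by (simp add: x_def powr_divide)
      moreover have "x p \<in> cball \<sigma> d" using elim(3) by (simp add: dist_commute)
      ultimately have "dist (f (fst p) (s / of_real (real (snd p) powr \<gamma>))) (H (x p)) < e / 2"
        using elim(1) by simp
      then show ?case using elim(2) dist_triangle_half_r dist_commute by (metis dist_triangle_half_l)
    qed
  qed
  then have "((\<lambda>p. f (fst p) (s / of_real (real (snd p) powr \<gamma>)) / z ^ r) \<longlongrightarrow> H \<sigma> / z ^ r) (ratio_filter t)"
    using z0 by (intro tendsto_intros) auto
  moreover have "\<forall>\<^sub>F p in ratio_filter t. f (fst p) (s / of_real (real (snd p) powr \<gamma>)) / z ^ r =
      (case p of (n, N) \<Rightarrow> poly (Q r \<gamma> c n N) z / poly (Q r \<gamma> c (n + r) N) z)"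
    using pos
  proof eventually_elim
    case (elim p)
    then have "1 \<le> snd p" by (cases "snd p") auto
    then show ?case using z0
      by (cases p) (simp add: poly_Q_eq block_ratio_def s_def power_add)
  qed
  ultimately have "((\<lambda>(n, N). poly (Q r \<gamma> c n N) z / poly (Q r \<gamma> c (n + r) N) z) \<longlongrightarrow> H \<sigma> / z ^ r) (ratio_filter t)"
    by (rule Lim_transform_eventually)
  then show ?thesis
    unfolding Phi_def by (subst tendsto_Lim[OF ratio_filter_nontrivial[OF t]]) (auto simp: \<sigma>_def s_def)
qed

lemma Phi_log_deriv:
  assumes z: "z \<notin> star r" and t: "0 < t"
  shows "deriv (\<lambda>w. Phi r \<gamma> c w t) z / Phi r \<gamma> c z t =
    (of_nat (r + 1) * g_limit (of_real (t powr \<gamma>) * (1 / z ^ (r + 1))) - of_nat r) / z"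
proof -
  define \<tau> :: complex where "\<tau> = of_real (t powr \<gamma>)"
  have z0: "z \<noteq> 0" using off_star[OF z] by auto
  define \<sigma> where "\<sigma> = \<tau> / z ^ (r + 1)"
  have \<sigma>: "\<sigma> \<in> D" unfolding \<sigma>_def \<tau>_def
    using scale_notin_nonneg_Reals[OF off_star(2)[OF z], of "t powr \<gamma>"] t by simp
  have "((\<lambda>w. \<tau> / w ^ (r + 1)) has_field_derivative - (of_nat (r + 1) * \<sigma> / z)) (at z)"
    using DERIV_cmult[OF has_field_derivative_inverse_power[OF z0, of "r + 1"], of \<tau>]
    by (simp add: \<sigma>_def mult_ac del: power_Suc of_nat_Suc)
  then have d1: "((\<lambda>w. H (\<tau> / w ^ (r + 1))) has_field_derivative deriv H \<sigma> * - (of_nat (r + 1) * \<sigma> / z)) (at z)"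
    using H_has_derivative[OF \<sigma>] unfolding \<sigma>_def by (rule DERIV_chain2[rotated])
  have d2: "((\<lambda>w. 1 / w ^ r) has_field_derivative - (of_nat r * (1 / z ^ r) / z)) (at z)"
    by (rule has_field_derivative_inverse_power[OF z0])
  have "((\<lambda>w. H (\<tau> / w ^ (r + 1)) * (1 / w ^ r)) has_field_derivative
      deriv H \<sigma> * - (of_nat (r + 1) * \<sigma> / z) * (1 / z ^ r) + - (of_nat r * (1 / z ^ r) / z) * H \<sigma>) (at z)"
    using DERIV_mult[OF d1 d2] unfolding \<sigma>_def by simp
  then have "((\<lambda>w. Phi r \<gamma> c w t) has_field_derivative
      deriv H \<sigma> * - (of_nat (r + 1) * \<sigma> / z) * (1 / z ^ r) + - (of_nat r * (1 / z ^ r) / z) * H \<sigma>) (at z)"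
    by (rule has_field_derivative_transform_within_open[where S = "- star r"])
      (use z t closed_star in \<open>auto simp: Phi_eq \<tau>_def\<close>)
  then have "deriv (\<lambda>w. Phi r \<gamma> c w t) z =
      deriv H \<sigma> * - (of_nat (r + 1) * \<sigma> / z) * (1 / z ^ r) + - (of_nat r * (1 / z ^ r) / z) * H \<sigma>"
    by (rule DERIV_imp_deriv)
  moreover have "Phi r \<gamma> c z t = H \<sigma> / z ^ r" using Phi_eq[OF z t] by (simp add: \<sigma>_def \<tau>_def)
  moreover have "of_real (t powr \<gamma>) * (1 / z ^ (r + 1)) = \<sigma>" by (simp add: \<sigma>_def \<tau>_def)
  moreover have "(Y * - (R' * \<sigma> / z) * (1 / Z) + - (R * (1 / Z) / z) * X) / (X / Z) = (R' * (- \<sigma> * (Y / X)) - R) / z"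
    if "X \<noteq> 0" "Z \<noteq> 0" for X Y Z R R' :: complex
    using that z0 by (simp add: field_simps)
  ultimately show ?thesis
    using z0 H_nonzero[OF \<sigma>] by (simp add: g_limit_def del: of_nat_Suc)
qed

text \<open>0 is a boundary point of the cut plane, so H' is not controlled there directly. With
  \<tau> = t^\<gamma>, the disc of radius \<tau> d about \<tau> s lies in the cut plane, and
  Cauchy's inequality for H - 1 gives |H'| <= \<epsilon> / (\<tau> d); the factor \<tau> s in
  \<open>g_limit\<close> compensates 1/\<tau>.\<close>

lemma g_limit_tendsto_0:
  assumes s: "s \<in> D"
  shows "((\<lambda>t. g_limit (of_real (t powr \<gamma>) * s)) \<longlongrightarrow> 0) (at_right 0)"
proof (rule tendstoI)
  fix e :: real assume e: "e > 0"
  obtain d where d: "d > 0" "cball s d \<subseteq> D"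
    using open_cut_plane s open_contains_cball by blast
  \<comment> \<open>The first bound ensures |H| >= 1/2; the second makes the final estimate at most
    e/2.\<close>
  define \<epsilon> where "\<epsilon> = min (1 / 2) (e * d / (4 * (norm s + 1)))"
  have "0 < e * d / (4 * (norm s + 1))"
    using e d by (intro divide_pos_pos mult_pos_pos add_nonneg_pos) auto
  then have \<epsilon>: "0 < \<epsilon>" "\<epsilon> \<le> 1 / 2" "\<epsilon> \<le> e * d / (4 * (norm s + 1))"
    unfolding \<epsilon>_def by (simp_all only: min_less_iff_conj min.cobounded1 min.cobounded2) simp
  obtain \<eta> where \<eta>: "\<eta> > 0" "\<And>x. x \<in> D \<Longrightarrow> norm x < \<eta> \<Longrightarrow> norm (H x - 1) < \<epsilon>"
  proof -
    have "\<forall>\<^sub>F x in at 0 within D. dist (H x) 1 < \<epsilon>" using H_tendsto \<epsilon> by (intro tendstoD)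
    then obtain \<eta> where "\<eta> > 0" "\<And>x. x \<in> D \<Longrightarrow> x \<noteq> 0 \<Longrightarrow> dist x 0 < \<eta> \<Longrightarrow> dist (H x) 1 < \<epsilon>"
      unfolding eventually_at by blast
    moreover have "x \<noteq> 0" if "x \<in> D" for x using that by auto
    ultimately show ?thesis using that by (auto simp: dist_norm)
  qed
  have "((\<lambda>t. t powr \<gamma> * (norm s + d)) \<longlongrightarrow> 0 * (norm s + d)) (at_right 0)"
  proof (intro tendsto_mult tendsto_const)
    show "((\<lambda>t. t powr \<gamma>) \<longlongrightarrow> 0) (at_right 0)" using gamma_pos by real_asymp
  qed
  then have "\<forall>\<^sub>F t in at_right 0. t powr \<gamma> * (norm s + d) < \<eta>"
    using \<eta>(1) by (auto dest: order_tendstoD(2))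
  then show "\<forall>\<^sub>F t in at_right 0. dist (g_limit (of_real (t powr \<gamma>) * s)) 0 < e"
    using eventually_at_right_less[of 0]
  proof eventually_elim
    case (elim t)
    define \<tau> where "\<tau> = t powr \<gamma>"
    have \<tau>: "0 < \<tau>" using elim by (simp add: \<tau>_def)
    define \<sigma> where "\<sigma> = of_real \<tau> * s"
    have near: "x \<in> D \<and> norm (H x - 1) < \<epsilon>" if "x \<in> cball \<sigma> (\<tau> * d)" for x
    proof -
      define x' where "x' = x / of_real \<tau>"
      have x: "x = of_real \<tau> * x'" using \<tau> by (simp add: x'_def)
      have "norm (\<sigma> - x) = \<tau> * norm (s - x')"
        unfolding x \<sigma>_def right_diff_distrib[symmetric] norm_mult using \<tau> by simp
      then have x': "x' \<in> cball s d" using that \<tau> by (simp add: dist_norm)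
      then have "x' \<in> D" using d by blast
      then have 1: "x \<in> D" unfolding x using scale_notin_nonneg_Reals[of x' \<tau>] \<tau> by simp
      have "norm x' \<le> norm s + d"
        using x' norm_triangle_ineq2[of x' s] by (simp add: dist_norm norm_minus_commute)
      then have "norm x \<le> \<tau> * (norm s + d)" unfolding x norm_mult using \<tau> by simp
      then have "norm x < \<eta>" using elim by (simp add: \<tau>_def)
      with 1 \<eta>(2) show ?thesis by blast
    qed
    have sub: "cball \<sigma> (\<tau> * d) \<subseteq> D" using near by blast
    have \<sigma>D: "\<sigma> \<in> D" using near[of \<sigma>] \<tau> d by simp
    have hol: "(\<lambda>x. H x - 1) holomorphic_on D" by (intro holomorphic_intros H_holomorphic)
    have "norm ((deriv ^^ 1) (\<lambda>x. H x - 1) \<sigma>) \<le> fact 1 * \<epsilon> / (\<tau> * d) ^ 1"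
    proof (rule Cauchy_inequality)
      show "(\<lambda>x. H x - 1) holomorphic_on ball \<sigma> (\<tau> * d)"
        using hol sub by (metis holomorphic_on_subset ball_subset_cball subset_trans)
      show "continuous_on (cball \<sigma> (\<tau> * d)) (\<lambda>x. H x - 1)"
        using hol sub by (metis holomorphic_on_imp_continuous_on continuous_on_subset)
      show "0 < \<tau> * d" using \<tau> d by simp
      fix x assume "norm (\<sigma> - x) = \<tau> * d"
      then have "x \<in> cball \<sigma> (\<tau> * d)" by (simp add: dist_norm)
      then show "norm (H x - 1) \<le> \<epsilon>" using near less_imp_le by blast
    qed
    moreover have "deriv (\<lambda>x. H x - 1) \<sigma> = deriv H \<sigma>"
      using H_has_derivative[OF \<sigma>D] by (intro DERIV_imp_deriv) (auto intro!: derivative_eq_intros)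
    ultimately have d1: "norm (deriv H \<sigma>) \<le> \<epsilon> / (\<tau> * d)" by simp
    have "norm (H \<sigma> - 1) < \<epsilon>" using near[of \<sigma>] \<tau> d by simp
    then have H2: "1 / 2 \<le> norm (H \<sigma>)"
      using norm_triangle_ineq2[of 1 "1 - H \<sigma>"] \<epsilon>(2) by (simp add: norm_minus_commute)
    have "norm (g_limit \<sigma>) = norm \<sigma> * (norm (deriv H \<sigma>) / norm (H \<sigma>))"
      by (simp add: g_limit_def norm_mult norm_divide)
    also have "\<dots> \<le> norm \<sigma> * ((\<epsilon> / (\<tau> * d)) / (1 / 2))"
      using d1 H2 \<epsilon> \<tau> d by (intro mult_left_mono frac_le) auto
    also have "\<dots> = 2 * norm s * \<epsilon> / d"
      using \<tau> by (simp add: \<sigma>_def norm_mult)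
    also have "\<dots> \<le> 2 * norm s * (e * d / (4 * (norm s + 1))) / d"
      using \<epsilon> d by (intro divide_right_mono mult_left_mono) auto
    also have "\<dots> = (e / 2) * (norm s / (norm s + 1))"
    proof -
      have "norm s + 1 \<noteq> 0" using norm_ge_zero[of s] by linarith
      then show ?thesis using d by (simp add: divide_simps)
    qed
    also have "\<dots> \<le> (e / 2) * 1"
      using e by (intro mult_left_mono) (auto simp: divide_le_eq_1 add_nonneg_pos)
    also have "\<dots> < e" using e by simp
    finally show ?case by (simp add: \<sigma>_def \<tau>_def)
  qed
qed

text \<open>The value at t = 0 is the right-hand limit; it is prescribed because
  \<open>g_limit\<close> is controlled only on the cut plane, which omits 0.\<close>

definition \<phi> where "\<phi> s t = (if t = 0 then 0 else g_limit (of_real (t powr \<gamma>) * s))"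

lemma \<phi>_continuous:
  assumes s: "s \<in> D"
  shows "continuous_on {0..1} (\<phi> s)"
  unfolding continuous_on_eq_continuous_within
proof
  fix t :: real assume t: "t \<in> {0..1}"
  show "continuous (at t within {0..1}) (\<phi> s)"
  proof (cases "t = 0")
    case True
    have "(\<phi> s \<longlongrightarrow> 0) (at_right 0)"
      using g_limit_tendsto_0[OF s] by (rule Lim_transform_eventually)
        (auto simp: \<phi>_def eventually_at_filter)
    then have "(\<phi> s \<longlongrightarrow> 0) (at 0 within {0..1})"
      by (simp add: at_within_Icc_at_right)
    then show ?thesis by (simp add: True continuous_within \<phi>_def)
  next
    case False
    then have t: "0 < t" using t by simp
    have "of_real (t powr \<gamma>) * s \<in> D" using scale_notin_nonneg_Reals[of s] s t by simp
    then have "isCont g_limit (of_real (t powr \<gamma>) * s)"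
      using g_limit_continuous open_cut_plane by (simp add: continuous_on_eq_continuous_at)
    moreover have "isCont (\<lambda>t. of_real (t powr \<gamma>) * s) t"
      using t by (intro continuous_intros) auto
    ultimately have "isCont (\<lambda>t. g_limit (of_real (t powr \<gamma>) * s)) t"
      by (rule isCont_o2[rotated])
    then have "((\<lambda>t. g_limit (of_real (t powr \<gamma>) * s)) \<longlongrightarrow> \<phi> s t) (at t)"
      using t by (simp add: isCont_def \<phi>_def)
    moreover have "\<forall>\<^sub>F x in at t. g_limit (of_real (x powr \<gamma>) * s) = \<phi> s x"
      using eventually_neq_at_within[of 0] by eventually_elim (simp add: \<phi>_def)
    ultimately have "(\<phi> s \<longlongrightarrow> \<phi> s t) (at t)" by (rule Lim_transform_eventually)
    then show ?thesis
      by (simp add: continuous_within tendsto_within_subset[of _ _ _ UNIV])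
  qed
qed

lemma \<phi>_has_integral: "s \<in> D \<Longrightarrow> (\<phi> s has_integral integral {0..1} (\<phi> s)) {0..1}"
  by (rule integrable_integral[OF integrable_continuous_real[OF \<phi>_continuous]])

lemma Phi_integral:
  assumes z: "z \<notin> star r"
  defines "s \<equiv> 1 / z ^ (r + 1)"
  shows "((\<lambda>t. deriv (\<lambda>w. Phi r \<gamma> c w t) z / Phi r \<gamma> c z t) has_integral
    (of_nat (r + 1) * integral {0..1} (\<phi> s) - of_nat r) / z) {0..1}"
\<comment> \<open>\<open>Phi_log_deriv\<close> describes the integrand for t > 0 only; a single
  point does not affect the integral.\<close>
proof (rule has_integral_spike_finite[where S = "{0}"])
  have s: "s \<in> D" using off_star[OF z] by (simp add: s_def)
  show "((\<lambda>t. (of_nat (r + 1) * \<phi> s t - of_nat r) / z) has_integral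
    (of_nat (r + 1) * integral {0..1} (\<phi> s) - of_nat r) / z) {0..1}"
    using has_integral_const_real[of "of_nat r :: complex" 0 1]
    by (intro has_integral_divide has_integral_diff has_integral_mult_right \<phi>_has_integral s) auto
  fix t :: real assume "t \<in> {0..1} - {0}"
  then have t: "0 < t" by auto
  show "deriv (\<lambda>w. Phi r \<gamma> c w t) z / Phi r \<gamma> c z t = (of_nat (r + 1) * \<phi> s t - of_nat r) / z"
    unfolding Phi_log_deriv[OF z t] using t by (simp add: \<phi>_def s_def)
qed simp

text \<open>Along the path u = \<sigma> H(\<sigma>) with \<sigma> = t^\<gamma> s, so du/u = (1 +
  \<sigma> H'/H) d\<sigma>/\<sigma> = \<gamma> (1 - \<phi>) dt/t. The power of the quotient is t and
  cancels 1/t.\<close>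

lemma F_contour_integral:
  assumes y: "y \<in> D"
  defines "s \<equiv> 1 / y"
  shows "(F_integrand r \<gamma> \<alpha> y has_contour_integral of_real \<gamma> * (1 - integral {0..1} (\<phi> s))) (F_path r \<gamma> \<alpha> y)"
  unfolding has_contour_integral_def
proof (rule has_integral_spike_finite[where S = "{0}"])
  have s: "s \<in> D" and y0: "y \<noteq> 0" using inverse_notin_nonneg_Reals[of y] y by (simp add: s_def, use y in auto)
  then have s0: "s \<noteq> 0" by auto
  show "((\<lambda>t. of_real \<gamma> * (1 - \<phi> s t)) has_integral of_real \<gamma> * (1 - integral {0..1} (\<phi> s))) {0..1}"
    using has_integral_const_real[of "1 :: complex" 0 1]
    by (intro has_integral_diff has_integral_mult_right \<phi>_has_integral s) auto
  have path: "F_path r \<gamma> \<alpha> y t = of_real (t powr \<gamma>) * s * H (of_real (t powr \<gamma>) * s)" if "0 < t" for t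
  proof -
    have "of_real (t powr (- \<gamma>)) * y \<in> D" using scale_notin_nonneg_Reals[of y] y that by simp
    then show ?thesis
      using that by (simp add: F_path_def F_eq s_def powr_minus divide_simps)
  qed
  fix t :: real assume "t \<in> {0..1} - {0}"
  then have t: "0 < t" "t \<le> 1" by auto
  define \<tau> where "\<tau> = t powr \<gamma>"
  have \<tau>: "0 < \<tau>" using t by (simp add: \<tau>_def)
  define \<sigma> where "\<sigma> = of_real \<tau> * s"
  have \<sigma>: "\<sigma> \<in> D" unfolding \<sigma>_def using scale_notin_nonneg_Reals[of s] s \<tau> by auto
  then have \<sigma>0: "\<sigma> \<noteq> 0" by auto
  have u: "F_path r \<gamma> \<alpha> y t = \<sigma> * H \<sigma>" using path[OF t(1)] by (simp add: \<sigma>_def \<tau>_def)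
  have "((\<lambda>t. t powr \<gamma>) has_real_derivative \<gamma> * \<tau> / t) (at t)"
    using t by (auto intro!: derivative_eq_intros simp: \<tau>_def powr_diff)
  then have "((\<lambda>t. of_real (t powr \<gamma>) :: complex) has_vector_derivative of_real (\<gamma> * \<tau> / t)) (at t)"
    by (intro has_vector_derivative_of_real) (simp add: has_real_derivative_iff_has_vector_derivative)
  then have vd: "((\<lambda>t. of_real (t powr \<gamma>) * s) has_vector_derivative of_real (\<gamma> * \<tau> / t) * s) (at t)"
    by (rule has_vector_derivative_mult_left)
  have "((\<lambda>x. x * H x) has_field_derivative H \<sigma> + \<sigma> * deriv H \<sigma>) (at \<sigma>)"
    using H_has_derivative[OF \<sigma>] by (auto intro!: derivative_eq_intros)
  then have "((\<lambda>x. x * H x) \<circ> (\<lambda>t. of_real (t powr \<gamma>) * s) has_vector_derivative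
     of_real (\<gamma> * \<tau> / t) * s * (H \<sigma> + \<sigma> * deriv H \<sigma>)) (at t)"
    by (intro field_vector_diff_chain_at vd) (simp add: \<sigma>_def \<tau>_def)
  then have vF: "(F_path r \<gamma> \<alpha> y has_vector_derivative of_real (\<gamma> * \<tau> / t) * s * (H \<sigma> + \<sigma> * deriv H \<sigma>)) (at t)"
    by (rule has_vector_derivative_transform_within_open[where S = "{0<..}"]) (use t path in \<open>auto simp: o_def\<close>)
  have "vector_derivative (F_path r \<gamma> \<alpha> y) (at t within {0..1}) = of_real (\<gamma> * \<tau> / t) * s * (H \<sigma> + \<sigma> * deriv H \<sigma>)"
    using t by (intro vector_derivative_within_closed_interval[OF zero_less_one _ has_vector_derivative_at_within[OF vF]]) simp
  moreover have "F_integrand r \<gamma> \<alpha> y (F_path r \<gamma> \<alpha> y t) = of_real t / (\<sigma> * H \<sigma>)"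
  proof -
    \<comment> \<open>Since F(y) A(F(y)) = s, the quotient in the integrand is \<sigma>/s =
      t^\<gamma>, a positive real number whose principal power is t.\<close>
    have Fy: "F r \<alpha> y * A r \<alpha> (F r \<alpha> y) = s"
      using H_eq[OF s] F_eq[OF y] by (simp add: s_def)
    have "F_integrand r \<gamma> \<alpha> y (F_path r \<gamma> \<alpha> y t) = (\<sigma> / s) powr of_real (1 / \<gamma>) * (1 / (\<sigma> * H \<sigma>))"
      unfolding F_integrand_def u Fy H_eq[OF \<sigma>] ..
    also have "\<sigma> / s = of_real \<tau>" using s0 by (simp add: \<sigma>_def)
    also have "of_real \<tau> powr of_real (1 / \<gamma>) = (of_real (\<tau> powr (1 / \<gamma>)) :: complex)"
      using \<tau> by (intro powr_of_real) auto
    also have "\<tau> powr (1 / \<gamma>) = t" using t gamma_pos by (simp add: \<tau>_def powr_powr)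
    finally show ?thesis by simp
  qed
  ultimately show "F_integrand r \<gamma> \<alpha> y (F_path r \<gamma> \<alpha> y t) * vector_derivative (F_path r \<gamma> \<alpha> y) (at t within {0..1}) =
      of_real \<gamma> * (1 - \<phi> s t)"
  proof (simp only:)
    have "\<phi> s t = - \<sigma> * (deriv H \<sigma> / H \<sigma>)" using t by (simp add: \<phi>_def g_limit_def \<sigma>_def \<tau>_def)
    moreover have "of_real t / (\<sigma> * H \<sigma>) * (of_real (\<gamma> * \<tau> / t) * s * (H \<sigma> + \<sigma> * deriv H \<sigma>)) =
       of_real \<gamma> * ((of_real \<tau> * s) / \<sigma>) * ((H \<sigma> + \<sigma> * deriv H \<sigma>) / H \<sigma>)"
      using t \<sigma>0 H_nonzero[OF \<sigma>] by (simp add: field_simps)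
    moreover have "of_real \<tau> * s / \<sigma> = 1" using \<sigma>0 by (simp add: \<sigma>_def)
    moreover have "(H \<sigma> + \<sigma> * deriv H \<sigma>) / H \<sigma> = 1 - - \<sigma> * (deriv H \<sigma> / H \<sigma>)"
      using H_nonzero[OF \<sigma>] by (simp add: field_simps)
    ultimately show "of_real t / (\<sigma> * H \<sigma>) * (of_real (\<gamma> * \<tau> / t) * s * (H \<sigma> + \<sigma> * deriv H \<sigma>)) = of_real \<gamma> * (1 - \<phi> s t)"
      by simp
  qed
qed simp

end

section \<open>Logarithmic derivatives as Riemann sums\<close>

text \<open>The nodes (N mod r + j r)/N have spacing r/N, and the node after the last one is 1. They
  miss only an initial interval shorter than r/N, on which \<phi> is bounded.\<close>

lemma riemann_sum_residue:
  fixes \<phi> :: "real \<Rightarrow> complex"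
  assumes r: "1 \<le> r" and cont: "continuous_on {0..1} \<phi>"
  shows "(\<lambda>N. of_nat r / of_nat N * (\<Sum>j<N div r. \<phi> (real (N mod r + j * r) / real N))) \<longlonglongrightarrow> integral {0..1} \<phi>"
proof (rule tendstoI)
  fix e :: real assume e: "e > 0"
  obtain B where B: "\<And>x. x \<in> {0..1} \<Longrightarrow> norm (\<phi> x) \<le> B" "0 < B"
    using compact_imp_bounded[OF compact_continuous_image[OF cont compact_Icc]] unfolding bounded_pos by (auto simp del: atLeastAtMost_iff)
  have "uniformly_continuous_on {0..1} \<phi>" using cont by (rule compact_uniformly_continuous) simp
  then obtain \<delta> where \<delta>: "\<delta> > 0" "\<And>x y. x \<in> {0..1} \<Longrightarrow> y \<in> {0..1} \<Longrightarrow> dist x y < \<delta> \<Longrightarrow> dist (\<phi> x) (\<phi> y) < e / 2"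
    using e unfolding uniformly_continuous_on_def by (meson half_gt_zero)
  have int: "\<phi> integrable_on {a..b}" if "0 \<le> a" "b \<le> 1" for a b
    using that by (intro integrable_continuous_real continuous_on_subset[OF cont]) auto
  have E1: "\<forall>\<^sub>F N in sequentially. real r / real N < \<delta>" using \<delta>(1) by real_asymp
  have E2: "\<forall>\<^sub>F N in sequentially. real r / real N * B < e / 2" using e by real_asymp
  show "\<forall>\<^sub>F N in sequentially. dist (of_nat r / of_nat N * (\<Sum>j<N div r. \<phi> (real (N mod r + j * r) / real N))) (integral {0..1} \<phi>) < e"
    using E1 E2 eventually_gt_at_top[of 0]
  proof eventually_elim
    case (elim N)
    define x where "x j = real (N mod r + j * r) / real N" for j
    have "N mod r + N div r * r = N" by simp
    then have xN: "x (N div r) = 1" using elim(3) by (simp only: x_def) simp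
    have step: "x (Suc j) = x j + real r / real N" for j
      by (simp add: x_def add_divide_distrib algebra_simps)
    have x0: "0 \<le> x j" for j by (simp add: x_def)
    have mono: "x i \<le> x j" if "i \<le> j" for i j
      unfolding x_def using that by (intro divide_right_mono of_nat_mono add_left_mono mult_right_mono) auto
    have x1: "x j \<le> 1" if "j \<le> N div r" for j using mono[OF that] xN by simp
    let ?I = "\<lambda>j. integral {x j..x (Suc j)} \<phi>"
    let ?S = "\<Sum>j<N div r. of_real (real r / real N) * \<phi> (x j)"
    let ?T = "\<Sum>j<N div r. ?I j"
    have sum_int: "(\<Sum>j<k. ?I j) = integral {x 0..x k} \<phi>" if "k \<le> N div r" for k
      using that
    proof (induction k)
      case (Suc k)
      then show ?case
        using Henstock_Kurzweil_Integration.integral_combine[of "x 0" "x k" "x (Suc k)" \<phi>] mono x0 x1[of "Suc k"] int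
        by simp
    qed simp
    have one: "norm (of_real (real r / real N) * \<phi> (x j) - ?I j) \<le> e / 2 * (real r / real N)"
      if j: "j < N div r" for j
    proof -
      have "((\<lambda>t. \<phi> (x j) - \<phi> t) has_integral (of_real (real r / real N) * \<phi> (x j) - ?I j)) {x j..x (Suc j)}"
        using has_integral_const_real[of "\<phi> (x j)" "x j" "x (Suc j)"] x0 x1[of "Suc j"] j
        by (intro has_integral_diff integrable_integral int) (auto simp: step scaleR_conv_of_real)
      then have "norm (of_real (real r / real N) * \<phi> (x j) - ?I j) \<le> e / 2 * measure lborel {x j..x (Suc j)}"
      proof (rule has_integral_bound_real[where S = "{}", rotated 2])
        fix t assume t: "t \<in> {x j..x (Suc j)} - {}"
        then have "dist (x j) t < \<delta>" using elim(1) by (simp add: dist_real_def step)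
        then have "dist (\<phi> (x j)) (\<phi> t) < e / 2"
          using t x0[of j] x1[of "Suc j"] x1[of j] j by (intro \<delta>(2)) auto
        then show "norm (\<phi> (x j) - \<phi> t) \<le> e / 2" by (simp add: dist_norm)
      qed (use e in auto)
      then show ?thesis using r by (simp add: step)
    qed
    have "integral {0..1} \<phi> = integral {0..x 0} \<phi> + integral {x 0..1} \<phi>"
      using Henstock_Kurzweil_Integration.integral_combine[of 0 "x 0" 1 \<phi>] x0 x1[of 0] int by simp
    also have "integral {x 0..1} \<phi> = ?T"
      using sum_int[of "N div r"] xN by simp
    finally have I: "integral {0..1} \<phi> = integral {0..x 0} \<phi> + ?T" .
    have "norm (\<Sum>j<N div r. of_real (real r / real N) * \<phi> (x j) - ?I j) \<le> real (N div r) * (e / 2 * (real r / real N))"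
      using sum_norm_le[of "{..<N div r}" "\<lambda>j. of_real (real r / real N) * \<phi> (x j) - ?I j" "\<lambda>_. e / 2 * (real r / real N)"] one
      by simp
    also have "\<dots> = e / 2 * (real (N div r * r) / real N)" by simp
    also have "\<dots> \<le> e / 2 * 1"
    proof (intro mult_left_mono)
      have "N div r * r \<le> N" by simp
      then have "real (N div r * r) \<le> real N" by (simp only: of_nat_le_iff)
      then show "real (N div r * r) / real N \<le> 1" using elim(3) by (simp add: divide_le_eq_1)
    qed (use e in auto)
    finally have D1: "norm (?S - ?T) \<le> e / 2"
      by (simp add: sum_subtractf)
    have "norm (integral {0..x 0} \<phi>) \<le> B * (x 0 - 0)"
      using B x0[of 0] x1[of 0] by (intro integral_bound continuous_on_subset[OF cont]) auto
    also have "\<dots> \<le> B * (real r / real N)"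
    proof (rule mult_left_mono)
      have "N mod r \<le> r" using r by (simp add: less_imp_le)
      then show "x 0 - 0 \<le> real r / real N" by (simp add: x_def divide_right_mono)
    qed (use B(2) in simp)
    also have "\<dots> < e / 2" using elim(2) by (simp add: mult.commute)
    finally have D2: "norm (integral {0..x 0} \<phi>) < e / 2" .
    have S: "of_nat r / of_nat N * (\<Sum>j<N div r. \<phi> (real (N mod r + j * r) / real N)) = ?S"
      by (simp add: x_def sum_distrib_left)
    have "norm (?S - ?T - integral {0..x 0} \<phi>) < e"
      using norm_triangle_ineq4[of "?S - ?T" "integral {0..x 0} \<phi>"] D1 D2
      by linarith
    then show ?case unfolding S I dist_norm by (simp add: algebra_simps)
  qed
qed

text \<open>Closeness to \<phi> is assumed only for n >= \<delta> N. At most \<delta> N / r + 1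
  nodes of the residue class lie below; after multiplication by r/N a uniform bound C for their
  errors contributes no more than \<delta> C + r C / N.\<close>

lemma riemann_sum_residue_array:
  fixes \<phi> :: "real \<Rightarrow> complex" and b :: "nat \<Rightarrow> nat \<Rightarrow> complex"
  assumes r: "1 \<le> r" and cont: "continuous_on {0..1} \<phi>"
    and bdd: "\<And>n N. 1 \<le> N \<Longrightarrow> norm (b n N) \<le> B"
    and close: "\<And>\<delta> \<epsilon>. 0 < \<delta> \<Longrightarrow> 0 < \<epsilon> \<Longrightarrow>
      \<forall>\<^sub>F N in sequentially. \<forall>n<N. \<delta> * real N \<le> real n \<longrightarrow> norm (b n N - \<phi> (real n / real N)) \<le> \<epsilon>"
  shows "(\<lambda>N. of_nat r / of_nat N * (\<Sum>j<N div r. b (N mod r + j * r) N)) \<longlonglongrightarrow> integral {0..1} \<phi>"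
proof -
  obtain B' where B': "\<And>x. x \<in> {0..1} \<Longrightarrow> norm (\<phi> x) \<le> B'" "0 < B'"
    using compact_imp_bounded[OF compact_continuous_image[OF cont compact_Icc]] unfolding bounded_pos by (auto simp del: atLeastAtMost_iff)
  define C where "C = B + B'"
  have C: "0 < C" using bdd[of 1 0] B'(2) norm_ge_zero[of "b 0 1"] unfolding C_def by linarith
  have "(\<lambda>N. of_nat r / of_nat N * (\<Sum>j<N div r. b (N mod r + j * r) N) -
      of_nat r / of_nat N * (\<Sum>j<N div r. \<phi> (real (N mod r + j * r) / real N))) \<longlonglongrightarrow> 0"
  proof (rule tendstoI)
    fix e :: real assume e: "e > 0"
    \<comment> \<open>The total e leaves room for three parts of size e/4: the nodes where b is
      close to \<phi>, the share \<delta> C of the early nodes, and r C / N from rounding their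
      number.\<close>
    define \<delta> where "\<delta> = e / (4 * C)"
    have \<delta>: "0 < \<delta>" "\<delta> * C = e / 4" using e C by (auto simp: \<delta>_def)
    have e4: "0 < e / 4" using e by simp
    have E1: "\<forall>\<^sub>F N in sequentially. real r / real N * C < e / 4" using e by real_asymp
    show "\<forall>\<^sub>F N in sequentially. dist (of_nat r / of_nat N * (\<Sum>j<N div r. b (N mod r + j * r) N) -
      of_nat r / of_nat N * (\<Sum>j<N div r. \<phi> (real (N mod r + j * r) / real N))) 0 < e"
      using close[OF \<delta>(1) e4] E1 eventually_gt_at_top[of 0]
    proof eventually_elim
      case (elim N)
      define n where "n j = N mod r + j * r" for j
      have n: "n j < N" if "j < N div r" for j
      proof -
        have "j * r < N div r * r" using that r by simp
        moreover have "N mod r + N div r * r = N" by simp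
        ultimately show ?thesis unfolding n_def by linarith
      qed
      define J where "J = {j. j < N div r \<and> real (n j) < \<delta> * real N}"
      have one: "norm (b (n j) N - \<phi> (real (n j) / real N)) \<le> e / 4 + (if j \<in> J then C else 0)" if j: "j < N div r" for j
      proof (cases "j \<in> J")
        case True
        have "norm (b (n j) N - \<phi> (real (n j) / real N)) \<le> norm (b (n j) N) + norm (\<phi> (real (n j) / real N))"
          by (rule norm_triangle_ineq4)
        also have "\<dots> \<le> C" unfolding C_def
          using n[OF j] elim(3) by (intro add_mono bdd B'(1)) auto
        finally show ?thesis using True e by simp
      next
        case False
        then show ?thesis using elim(1) n[OF j] j by (auto simp: J_def)
      qed
      have cardJ: "real (card J) \<le> \<delta> * real N / real r + 1"
      proof -
        have "J \<subseteq> {..nat \<lfloor>\<delta> * real N / real r\<rfloor>}"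
        proof
          fix j assume "j \<in> J"
          then have "real j * real r < \<delta> * real N" by (simp add: J_def n_def)
          then have "real j \<le> \<delta> * real N / real r" using r by (simp add: field_simps)
          then show "j \<in> {..nat \<lfloor>\<delta> * real N / real r\<rfloor>}" by (simp add: le_nat_floor)
        qed
        then have "card J \<le> Suc (nat \<lfloor>\<delta> * real N / real r\<rfloor>)"
          using card_mono[of "{..nat \<lfloor>\<delta> * real N / real r\<rfloor>}" J] by simp
        then have "real (card J) \<le> real (nat \<lfloor>\<delta> * real N / real r\<rfloor>) + 1" by linarith
        also have "real (nat \<lfloor>\<delta> * real N / real r\<rfloor>) \<le> \<delta> * real N / real r"
          using \<delta> by (intro of_nat_floor) auto
        finally show ?thesis by simp
      qed
      have "norm (\<Sum>j<N div r. b (n j) N - \<phi> (real (n j) / real N)) \<le> (\<Sum>j<N div r. e / 4 + (if j \<in> J then C else 0))"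
        using one by (intro sum_norm_le) auto
      also have "\<dots> = real (N div r) * (e / 4) + (\<Sum>j<N div r. if j \<in> J then C else 0)"
        by (simp add: sum.distrib)
      also have "(\<Sum>j<N div r. if j \<in> J then C else 0) = real (card J) * C"
      proof -
        have "{..<N div r} \<inter> J = J" by (auto simp: J_def)
        then show ?thesis by (simp add: sum.If_cases)
      qed
      also have "real (card J) * C \<le> (\<delta> * real N / real r + 1) * C"
        using cardJ C by (intro mult_right_mono) auto
      finally have S: "norm (\<Sum>j<N div r. b (n j) N - \<phi> (real (n j) / real N)) \<le> real (N div r) * (e / 4) + (\<delta> * real N / real r + 1) * C"
        by simp
      have "norm (of_nat r / of_nat N * (\<Sum>j<N div r. b (n j) N - \<phi> (real (n j) / real N)) :: complex) =
          real r / real N * norm (\<Sum>j<N div r. b (n j) N - \<phi> (real (n j) / real N))"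
        by (simp add: norm_mult norm_divide)
      also have "\<dots> \<le> real r / real N * (real (N div r) * (e / 4) + (\<delta> * real N / real r + 1) * C)"
        using S by (intro mult_left_mono) auto
      also have "\<dots> = real (N div r * r) / real N * (e / 4) + \<delta> * C + real r / real N * C"
        using elim(3) r by (simp add: field_simps)
      also have "\<dots> \<le> 1 * (e / 4) + \<delta> * C + real r / real N * C"
      proof -
        have "N div r * r \<le> N" by simp
        then have "real (N div r * r) \<le> real N" by (simp only: of_nat_le_iff)
        then have "real (N div r * r) / real N \<le> 1" using elim(3) by (simp add: divide_le_eq_1)
        then have "real (N div r * r) / real N * (e / 4) \<le> 1 * (e / 4)" using e by (intro mult_right_mono) auto
        then show ?thesis by linarith
      qed
      also have "\<dots> < e" using elim(2) \<delta>(2) e by linarith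
      finally show ?case
        by (simp add: n_def sum_subtractf right_diff_distrib)
    qed
  qed
  from tendsto_add[OF this riemann_sum_residue[OF r cont]] show ?thesis by simp
qed

section \<open>Logarithmic derivatives of the reduced and the rescaled polynomials\<close>

context regular_recurrence begin

lemma reduced_P_has_derivative: "(p n has_field_derivative deriv (p n) s) (at s)"
proof -
  have "p n holomorphic_on UNIV" using reduced_P_holomorphic[of "\<lambda>s. s" UNIV r c n] by simp
  then show ?thesis by (rule holomorphic_derivI) auto
qed

text \<open>The summands are increments of s p'/p over steps of length r. The chain starts at N mod
  r, where p is the constant 1, so the initial value vanishes.\<close>

lemma logderiv_reduced_P:
  assumes s: "s \<in> D"
  shows "s * deriv (p N) s / p N s = (\<Sum>j<N div r. g (N mod r + j * r) s)"
proof -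
  define d where "d n = s * deriv (p n) s / p n s" for n
  have nz: "p n s \<noteq> 0" for n using reduced_P_nonzero s by auto
  have g: "g n s = d (n + r) - d n" for n
  proof -
    have "(f n has_field_derivative (deriv (p n) s * p (n + r) s - p n s * deriv (p (n + r)) s) / (p (n + r) s * p (n + r) s)) (at s)"
      unfolding block_ratio_def[abs_def] by (rule DERIV_divide[OF reduced_P_has_derivative reduced_P_has_derivative nz])
    then have "deriv (f n) s = (deriv (p n) s * p (n + r) s - p n s * deriv (p (n + r)) s) / (p (n + r) s * p (n + r) s)"
      by (rule DERIV_imp_deriv)
    moreover have "- s * ((x * q - b * y) / (q * q)) / (b / q) = s * y / q - s * x / b"
      if "b \<noteq> 0" "q \<noteq> 0" for x y b q :: complex
      using that by (simp add: field_simps)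
    ultimately show ?thesis
      using nz[of n] nz[of "n + r"] unfolding g_def d_def by (simp only: block_ratio_def) blast
  qed
  have "p (N mod r) = (\<lambda>s. 1)"
    using r_pos by (intro ext reduced_P_initial) (simp add: less_imp_le)
  then have "d (N mod r) = 0" by (simp add: d_def)
  moreover have "(\<Sum>j<k. g (N mod r + j * r) s) = d (N mod r + k * r) - d (N mod r)" for k
    by (induction k) (simp_all add: g ac_simps)
  moreover have "N mod r + N div r * r = N" by simp
  ultimately show ?thesis by (simp only: d_def) simp
qed

lemma logderiv_Q:
  assumes z: "z \<notin> star r" and N: "1 \<le> N"
  defines "\<sigma> \<equiv> 1 / z ^ (r + 1) / of_real (real N powr \<gamma>)"
  shows "poly (Q r \<gamma> c N N) z \<noteq> 0"
    and "poly (pderiv (Q r \<gamma> c N N)) z / poly (Q r \<gamma> c N N) z =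
      (of_nat N - of_nat (r + 1) * (\<Sum>j<N div r. g (N mod r + j * r) \<sigma>)) / z"
proof -
  have z0: "z \<noteq> 0" using off_star[OF z] by auto
  have \<sigma>: "\<sigma> \<in> D"
    using scale_notin_nonneg_Reals[OF off_star(2)[OF z], of "1 / real N powr \<gamma>"] N by (simp add: \<sigma>_def mult_ac)
  have nz: "p N \<sigma> \<noteq> 0" using reduced_P_nonzero \<sigma> by auto
  have Q: "poly (Q r \<gamma> c N N) w = w ^ N * p N (1 / w ^ (r + 1) / of_real (real N powr \<gamma>))" if "w \<noteq> 0" for w
    using poly_Q_eq[OF N that] .
  show "poly (Q r \<gamma> c N N) z \<noteq> 0" using Q[OF z0] nz z0 by (simp add: \<sigma>_def)
  have "((\<lambda>w. 1 / w ^ (r + 1) / of_real (real N powr \<gamma>)) has_field_derivative - (of_nat (r + 1) * \<sigma> / z)) (at z)"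
    using DERIV_cdivide[OF has_field_derivative_inverse_power[OF z0, of "r + 1"], of "of_real (real N powr \<gamma>)"]
    by (simp add: \<sigma>_def mult_ac del: power_Suc of_nat_Suc)
  then have d1: "((\<lambda>w. p N (1 / w ^ (r + 1) / of_real (real N powr \<gamma>))) has_field_derivative deriv (p N) \<sigma> * - (of_nat (r + 1) * \<sigma> / z)) (at z)"
    unfolding \<sigma>_def by (rule DERIV_chain2[OF reduced_P_has_derivative])
  have d2: "((\<lambda>w. w ^ N) has_field_derivative of_nat N * z ^ N / z) (at z)"
  proof (cases N)
    case (Suc m)
    then show ?thesis using DERIV_power_Suc[OF DERIV_ident, of m z] z0 by simp
  qed simp
  have "((\<lambda>w. w ^ N * p N (1 / w ^ (r + 1) / of_real (real N powr \<gamma>))) has_field_derivative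
      of_nat N * z ^ N / z * p N \<sigma> + deriv (p N) \<sigma> * - (of_nat (r + 1) * \<sigma> / z) * z ^ N) (at z)"
    using DERIV_mult[OF d2 d1] unfolding \<sigma>_def .
  then have "(poly (Q r \<gamma> c N N) has_field_derivative
      of_nat N * z ^ N / z * p N \<sigma> + deriv (p N) \<sigma> * - (of_nat (r + 1) * \<sigma> / z) * z ^ N) (at z)"
    by (rule has_field_derivative_transform_within_open[where S = "- {0}"]) (use z0 Q in auto)
  then have "poly (pderiv (Q r \<gamma> c N N)) z =
      of_nat N * z ^ N / z * p N \<sigma> + deriv (p N) \<sigma> * - (of_nat (r + 1) * \<sigma> / z) * z ^ N"
    by (rule DERIV_unique[OF poly_DERIV])
  moreover have "poly (Q r \<gamma> c N N) z = z ^ N * p N \<sigma>" using Q[OF z0] by (simp add: \<sigma>_def)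
  moreover have "(n * Z / z * X + Y * - (R * \<sigma> / z) * Z) / (Z * X) = (n - R * (\<sigma> * Y / X)) / z"
    if "X \<noteq> 0" "Z \<noteq> 0" for X Y Z R n :: complex
    using that z0 by (simp add: field_simps)
  ultimately show "poly (pderiv (Q r \<gamma> c N N)) z / poly (Q r \<gamma> c N N) z =
      (of_nat N - of_nat (r + 1) * (\<Sum>j<N div r. g (N mod r + j * r) \<sigma>)) / z"
    unfolding logderiv_reduced_P[OF \<sigma>, symmetric] using nz z0 by (simp del: of_nat_Suc)
qed

text \<open>The term with index n is g_n(s / N^\<gamma>) = g_n(x / n^\<gamma>) with x =
  (n/N)^\<gamma> s. For n >= \<delta> N the points x stay in a compact part of the ray through s,
  where the convergence is uniform; \<open>norm_g_le\<close> covers the earlier terms.\<close>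

lemma logderiv_Q_tendsto:
  assumes z: "z \<notin> star r"
  shows "(\<lambda>N. 1 / of_nat N * (poly (pderiv (Q r \<gamma> c N N)) z / poly (Q r \<gamma> c N N) z)) \<longlonglongrightarrow>
     - (1 / of_nat r) * ((of_nat (r + 1) * integral {0..1} (\<phi> (1 / z ^ (r + 1))) - of_nat r) / z)"
proof -
  define s where "s = 1 / z ^ (r + 1)"
  have s: "s \<in> D" and z0: "z \<noteq> 0" using off_star[OF z] by (auto simp: s_def)
  define b where "b n N = g n (s / of_real (real N powr \<gamma>))" for n N
  obtain d where d: "d > 0" "cball s d \<subseteq> D"
    using open_cut_plane s open_contains_cball by blast
  have lim: "(\<lambda>N. of_nat r / of_nat N * (\<Sum>j<N div r. b (N mod r + j * r) N)) \<longlonglongrightarrow> integral {0..1} (\<phi> s)"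
  proof (rule riemann_sum_residue_array[OF r_pos \<phi>_continuous[OF s]])
    show "norm (b n N) \<le> norm s * (exp (2 * pi) / d)" if "1 \<le> N" for n N
      using norm_g_le[of "1 / real N powr \<gamma>" d s n] that d by (simp add: b_def)
    fix \<delta> \<epsilon> :: real assume \<delta>: "0 < \<delta>" and \<epsilon>: "0 < \<epsilon>"
    define K where "K = (\<lambda>t. of_real (t powr \<gamma>) * s) ` {\<delta>..1}"
    have "compact K" unfolding K_def
      using \<delta> by (intro compact_continuous_image continuous_intros) auto
    moreover have "K \<subseteq> D"
      unfolding K_def using scale_notin_nonneg_Reals[of s] s \<delta> by auto
    ultimately have "\<forall>\<^sub>F n in sequentially. \<forall>x\<in>K. dist (g n (x / of_real (real n powr \<gamma>))) (g_limit x) < \<epsilon>"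
      using uniform_limitD[OF g_limit_uniform \<epsilon>] by blast
    then obtain n0 where n0: "\<And>n x. n0 \<le> n \<Longrightarrow> x \<in> K \<Longrightarrow> dist (g n (x / of_real (real n powr \<gamma>))) (g_limit x) < \<epsilon>"
      unfolding eventually_sequentially by blast
    have "\<forall>\<^sub>F N in sequentially. real (Suc n0) \<le> \<delta> * real N" using \<delta> by real_asymp
    then show "\<forall>\<^sub>F N in sequentially. \<forall>n<N. \<delta> * real N \<le> real n \<longrightarrow> norm (b n N - \<phi> s (real n / real N)) \<le> \<epsilon>"
    proof (eventually_elim, intro allI impI)
      fix N n assume N: "real (Suc n0) \<le> \<delta> * real N" and n: "n < N" "\<delta> * real N \<le> real n"
      have nn: "n0 \<le> n" "0 < n" "0 < N" using N n by linarith+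
      define x where "x = of_real ((real n / real N) powr \<gamma>) * s"
      have "x \<in> K" unfolding K_def x_def using n nn by (intro imageI) (auto simp: field_simps)
      then have "dist (g n (x / of_real (real n powr \<gamma>))) (g_limit x) < \<epsilon>" using nn by (intro n0)
      moreover have "x / of_real (real n powr \<gamma>) = s / of_real (real N powr \<gamma>)"
        using nn by (simp add: x_def powr_divide)
      ultimately show "norm (b n N - \<phi> s (real n / real N)) \<le> \<epsilon>"
        using nn by (simp add: b_def \<phi>_def x_def dist_norm)
    qed
  qed
  have L: "(\<lambda>N. (1 - of_nat (r + 1) / of_nat r * (of_nat r / of_nat N * (\<Sum>j<N div r. b (N mod r + j * r) N))) / z) \<longlonglongrightarrow>
     (1 - of_nat (r + 1) / of_nat r * integral {0..1} (\<phi> s)) / z"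
    using z0 by (intro tendsto_intros lim)
  have R: "(1 - of_nat (r + 1) / of_nat r * integral {0..1} (\<phi> s)) / z =
     - (1 / of_nat r) * ((of_nat (r + 1) * integral {0..1} (\<phi> s) - of_nat r) / z)"
    using r_pos z0 by (simp add: field_simps del: of_nat_Suc)
  have "\<forall>\<^sub>F N in sequentially. (1 - of_nat (r + 1) / of_nat r * (of_nat r / of_nat N * (\<Sum>j<N div r. b (N mod r + j * r) N))) / z =
     1 / of_nat N * (poly (pderiv (Q r \<gamma> c N N)) z / poly (Q r \<gamma> c N N) z)"
    using eventually_gt_at_top[of 0]
  proof eventually_elim
    case (elim N)
    then have "1 \<le> N" by simp
    have "(1 - R / R' * (R' / n * S)) / z = 1 / n * ((n - R * S) / z)" if "n \<noteq> 0" "R' \<noteq> 0" for R R' S n :: complex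
      using that z0 by (simp add: field_simps)
    then show ?case
      unfolding logderiv_Q(2)[OF z \<open>1 \<le> N\<close>] b_def s_def by this (use elim r_pos in simp_all)
  qed
  from Lim_transform_eventually[OF L this] show ?thesis unfolding R unfolding s_def .
qed

end

section \<open>Zero distributions\<close>

lemma sum_order_eq_degree:
  fixes q :: "complex poly"
  assumes "q \<noteq> 0"
  shows "(\<Sum>x | poly q x = 0. order x q) = degree q"
proof -
  have "degree q = (\<Sum>x\<in>set_mset (proots q). count (proots q) x)"
    using size_proots_complex[of q] by (simp add: size_multiset_overloaded_eq)
  then show ?thesis using assms by simp
qed

lemma poly_logderiv_eq_sum:
  fixes q :: "complex poly"
  assumes z: "poly q z \<noteq> 0"
  shows "poly (pderiv q) z / poly q z = (\<Sum>x | poly q x = 0. of_nat (order x q) / (z - x))"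
proof -
  define Z where "Z = {x. poly q x = 0}"
  have q0: "q \<noteq> 0" using z by auto
  then have fin: "finite Z" unfolding Z_def by (rule poly_roots_finite)
  have der: "((\<lambda>w. \<Prod>x\<in>Z'. (w - x) ^ order x q) has_field_derivative
      (\<Prod>x\<in>Z'. (z - x) ^ order x q) * (\<Sum>x\<in>Z'. of_nat (order x q) / (z - x))) (at z)" if "finite Z'" "Z' \<subseteq> Z" for Z'
    using that
  proof (induction Z' rule: finite_induct)
    case (insert x Z')
    have zx: "z - x \<noteq> 0" using insert.prems z by (auto simp: Z_def)
    have "((\<lambda>w. (w - x) ^ n) has_field_derivative (z - x) ^ n * (of_nat n / (z - x))) (at z)" for n
    proof (cases n)
      case (Suc m)
      have "((\<lambda>w. (w - x) ^ Suc m) has_field_derivative (1 + of_nat m) * (1 * (z - x) ^ m)) (at z)"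
        by (intro DERIV_power_Suc) (auto intro!: derivative_eq_intros)
      moreover have "(1 + of_nat m) * (1 * (z - x) ^ m) = (z - x) ^ Suc m * (of_nat (Suc m) / (z - x))"
        using zx by simp
      ultimately show ?thesis unfolding Suc by (rule DERIV_cong)
    qed simp
    from DERIV_mult[OF this insert.IH] insert show ?case
      by (simp add: algebra_simps)
  qed simp
  have q: "poly q w = lead_coeff q * (\<Prod>x\<in>Z. (w - x) ^ order x q)" for w
    by (subst complex_poly_decompose[of q, symmetric]) (simp add: poly_prod Z_def)
  have "(poly q has_field_derivative lead_coeff q * ((\<Prod>x\<in>Z. (z - x) ^ order x q) * (\<Sum>x\<in>Z. of_nat (order x q) / (z - x)))) (at z)"
    unfolding q[abs_def] by (intro DERIV_cmult der fin order_refl)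
  then have "poly (pderiv q) z = poly q z * (\<Sum>x\<in>Z. of_nat (order x q) / (z - x))"
    using DERIV_unique[OF poly_DERIV] by (simp add: q mult.assoc)
  then show ?thesis using z by (simp add: Z_def)
qed

text \<open>Substituting \<omega> z for z turns a zero at \<omega> x into one of at least the same
  order at x. Going once around the finite orbit of x yields the reverse inequality.\<close>

lemma order_rotate:
  fixes q :: "complex poly"
  assumes q: "q \<noteq> 0" and rot: "\<And>z. poly q (\<omega> * z) = k * poly q z" and \<omega>: "\<omega> ^ n = 1" "0 < n"
  shows "order (\<omega> * x) q = order x q"
proof -
  have \<omega>0: "\<omega> \<noteq> 0" using \<omega> by (auto simp: power_0_left)
  have k0: "k \<noteq> 0"
  proof
    assume "k = 0"
    then have "poly q z = 0" for z using rot[of "z / \<omega>"] \<omega>0 by simp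
    then show False using q poly_all_0_iff_0 by blast
  qed
  have "poly (pcompose q [:0, \<omega>:]) z = poly (smult k q) z" for z
    using rot[of z] by (simp add: poly_pcompose mult.commute)
  then have comp: "pcompose q [:0, \<omega>:] = smult k q" by (intro poly_eq_poly_eq_iff[THEN iffD1] ext)
  have le: "order (\<omega> * x) q \<le> order x q" for x
  proof -
    define m where "m = order (\<omega> * x) q"
    have "[:- (\<omega> * x), 1:] ^ m dvd q" unfolding m_def by (rule order_1)
    then obtain t where t: "q = [:- (\<omega> * x), 1:] ^ m * t" by (rule dvdE)
    have pow: "pcompose (a ^ m) b = pcompose a b ^ m" for a b :: "complex poly"
      by (induction m) (simp_all add: pcompose_1 pcompose_mult)
    have "smult k q = (pcompose [:- (\<omega> * x), 1:] [:0, \<omega>:]) ^ m * pcompose t [:0, \<omega>:]"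
      unfolding comp[symmetric] by (subst t) (simp only: pcompose_mult pow)
    also have "pcompose [:- (\<omega> * x), 1:] [:0, \<omega>:] = smult \<omega> [:- x, 1:]"
      by (simp add: pcompose_pCons)
    finally have E: "smult k q = smult \<omega> [:- x, 1:] ^ m * pcompose t [:0, \<omega>:]" .
    have "[:- x, 1:] ^ m dvd smult k q"
      unfolding E smult_power by (intro dvd_mult2 dvd_smult dvd_refl)
    then have "[:- x, 1:] ^ m dvd q" using k0 by (simp add: dvd_smult_iff)
    then show ?thesis using order_divides[of x m q] q by (simp add: m_def)
  qed
  have "order (\<omega> ^ j * x) q \<le> order x q" for j x
  proof (induction j)
    case (Suc j)
    then show ?case using le[of "\<omega> ^ j * x"] by (simp add: mult.assoc)
  qed simp
  from this[of "n - 1" "\<omega> * x"] have "order (\<omega> ^ n * x) q \<le> order (\<omega> * x) q"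
    using \<omega>(2) by (cases n) (simp_all add: mult_ac)
  then show ?thesis using le[of x] \<omega> by simp
qed

lemma degree_P: "degree (P r c n) = n" and P_nonzero: "P r c n \<noteq> 0"
proof -
  have "degree (P r c n) = n \<and> P r c n \<noteq> 0"
  proof (induction n rule: less_induct)
    case (less n)
    show ?case
    proof (cases n)
      case (Suc m)
      show ?thesis
      proof (cases "m < r")
        case True
        then show ?thesis by (simp add: Suc degree_monom_eq monom_eq_0_iff)
      next
        case False
        have IH: "degree (P r c m) = m" "P r c m \<noteq> 0" "degree (P r c (m - r)) = m - r"
          using less Suc by auto
        have "degree (smult (of_real (c (m - r))) (P r c (m - r))) \<le> m - r"
          using degree_smult_le[of _ "P r c (m - r)"] IH(3) by metis
        moreover have d1: "degree ([:0, 1:] * P r c m) = Suc m"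
          using IH by (subst degree_mult_eq) auto
        ultimately have "degree ([:0, 1:] * P r c m - smult (of_real (c (m - r))) (P r c (m - r))) = Suc m"
          by (subst diff_conv_add_uminus, subst degree_add_eq_left) auto
        then show ?thesis using False Suc by auto
      qed
    qed simp
  qed
  then show "degree (P r c n) = n" "P r c n \<noteq> 0" by auto
qed

lemma poly_P_rotate:
  assumes "\<omega> ^ (r + 1) = 1"
  shows "poly (P r c n) (\<omega> * z) = \<omega> ^ n * poly (P r c n) z"
proof (induction n rule: less_induct)
  case (less n)
  show ?case
  proof (cases n)
    case (Suc m)
    show ?thesis
    proof (cases "m < r")
      case True
      then show ?thesis by (simp add: Suc poly_monom power_mult_distrib)
    next
      case False
      have "\<omega> ^ Suc m = \<omega> ^ (m - r) * \<omega> ^ (r + 1)"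
        using False by (simp flip: power_add)
      then have "\<omega> ^ (m - r) = \<omega> ^ Suc m" unfolding assms by simp
      with less[of m] less[of "m - r"] Suc False show ?thesis
        by (simp add: algebra_simps)
    qed
  qed simp
qed

lemma
  assumes "1 \<le> N"
  shows degree_Q: "degree (Q r \<gamma> c n N) = n" and Q_nonzero: "Q r \<gamma> c n N \<noteq> 0"
    and poly_Q_rotate: "\<omega> ^ (r + 1) = 1 \<Longrightarrow> poly (Q r \<gamma> c n N) (\<omega> * z) = \<omega> ^ n * poly (Q r \<gamma> c n N) z"
proof -
  have N: "real N \<noteq> 0" using assms by simp
  show deg: "degree (Q r \<gamma> c n N) = n"
    using N by (simp add: Q_def degree_pcompose degree_P)
  show "Q r \<gamma> c n N \<noteq> 0"
  proof (cases "n = 0")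
    case True
    then show ?thesis using N by (simp add: Q_def pcompose_1)
  qed (use deg in auto)
  show "poly (Q r \<gamma> c n N) (\<omega> * z) = \<omega> ^ n * poly (Q r \<gamma> c n N) z" if "\<omega> ^ (r + 1) = 1"
    using poly_P_rotate[OF that, of c n "of_real (real N powr (\<gamma> / real (r + 1))) * z"]
    by (simp add: Q_def poly_pcompose mult_ac)
qed

lemma integral_zero_measure:
  fixes f :: "complex \<Rightarrow> 'b::{banach, second_countable_topology}"
  assumes q: "q \<noteq> 0" and f: "f \<in> borel_measurable borel"
  shows "integral\<^sup>L (zero_measure q N) f = (\<Sum>x | poly q x = 0. (real (order x q) / real N) *\<^sub>R f x)"
proof -
  have fin: "finite {x. poly q x = 0}" using q by (rule poly_roots_finite)
  have "integral\<^sup>L (zero_measure q N) f = integral\<^sup>L (point_measure {x. poly q x = 0} (\<lambda>x. ennreal (real (order x q) / real N))) f"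
    unfolding zero_measure_def by (rule integral_distr) (auto intro: f)
  also have "\<dots> = (\<Sum>x | poly q x = 0. (real (order x q) / real N) *\<^sub>R f x)"
    using fin by (intro lebesgue_integral_point_measure_finite) auto
  finally show ?thesis .
qed

lemma prob_space_zero_measure:
  assumes q: "q \<noteq> 0" and deg: "degree q = N" "1 \<le> N"
  shows "prob_space (zero_measure q N)"
proof -
  define Z where "Z = {x. poly q x = 0}"
  have fin: "finite Z" unfolding Z_def using q by (rule poly_roots_finite)
  have "(\<Sum>x\<in>Z. ennreal (real (order x q) / real N)) = ennreal (\<Sum>x\<in>Z. real (order x q) / real N)"
    by (rule sum_ennreal) simp
  also have "(\<Sum>x\<in>Z. real (order x q) / real N) = real (\<Sum>x\<in>Z. order x q) / real N"
    by (simp add: sum_divide_distrib)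
  also have "\<dots> = 1" using sum_order_eq_degree[OF q] deg by (simp add: Z_def)
  finally have "emeasure (point_measure Z (\<lambda>x. ennreal (real (order x q) / real N))) Z = 1"
    using fin by (subst emeasure_point_measure_finite) auto
  then have "prob_space (point_measure Z (\<lambda>x. ennreal (real (order x q) / real N)))"
    by (intro prob_spaceI) (simp add: space_point_measure)
  then show ?thesis
    unfolding zero_measure_def Z_def[symmetric] by (rule prob_space.prob_space_distr) simp
qed

lemma sets_zero_measure [simp]: "sets (zero_measure q N) = sets borel"
  by (simp add: zero_measure_def)

lemma convergent_if_approximable:
  fixes a :: "nat \<Rightarrow> 'a::banach"
  assumes "\<And>e. 0 < e \<Longrightarrow> \<exists>b. convergent b \<and> (\<forall>\<^sub>F N in sequentially. norm (a N - b N) \<le> e)"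
  shows "convergent a"
proof (rule Cauchy_convergent, rule metric_CauchyI)
  fix e :: real assume e: "0 < e"
  obtain b where b: "convergent b" "\<forall>\<^sub>F N in sequentially. norm (a N - b N) \<le> e / 4"
    using assms[of "e / 4"] e by auto
  obtain M1 where M1: "\<And>N. N \<ge> M1 \<Longrightarrow> norm (a N - b N) \<le> e / 4"
    using b(2) by (auto simp: eventually_sequentially)
  obtain M2 where M2: "\<And>m n. m \<ge> M2 \<Longrightarrow> n \<ge> M2 \<Longrightarrow> dist (b m) (b n) < e / 4"
    using metric_CauchyD[OF convergent_Cauchy[OF b(1)], of "e / 4"] e by auto
  have "dist (a m) (a n) < e" if "m \<ge> max M1 M2" "n \<ge> max M1 M2" for m n
  proof -
    have "a m - a n = (a m - b m) + (b m - b n) - (a n - b n)" by simp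
    then have "norm (a m - a n) \<le> norm (a m - b m) + norm (b m - b n) + norm (a n - b n)"
      by (metis norm_triangle_ineq norm_triangle_le_diff add_right_mono)
    then show ?thesis
      using M1[of m] M1[of n] M2[of m n] that e by (simp add: dist_norm)
  qed
  then show "\<exists>M. \<forall>m\<ge>M. \<forall>n\<ge>M. dist (a m) (a n) < e" by blast
qed

text \<open>The limit inherits the Lipschitz bound, so convergence on a finite \<delta>-net of K
  controls all of K; the net and the two Lipschitz estimates cost e/3 each.\<close>

lemma uniform_limit_equi_Lipschitz:
  fixes h :: "nat \<Rightarrow> 'a::metric_space \<Rightarrow> 'b::metric_space"
  assumes K: "compact K"
    and lip: "\<forall>\<^sub>F n in sequentially. \<forall>x\<in>K. \<forall>y\<in>K. dist (h n x) (h n y) \<le> L * dist x y"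
    and lim: "\<And>x. x \<in> K \<Longrightarrow> (\<lambda>n. h n x) \<longlonglongrightarrow> g x"
  shows "uniform_limit K h g sequentially"
proof (rule uniform_limitI)
  fix e :: real assume e: "e > 0"
  define L' where "L' = max L 1"
  have L': "0 < L'" "L \<le> L'" by (auto simp: L'_def)
  have lipg: "dist (g x) (g y) \<le> L * dist x y" if "x \<in> K" "y \<in> K" for x y
  proof (rule tendsto_upperbound)
    show "(\<lambda>n. dist (h n x) (h n y)) \<longlonglongrightarrow> dist (g x) (g y)" using lim that by (intro tendsto_intros)
    show "\<forall>\<^sub>F n in sequentially. dist (h n x) (h n y) \<le> L * dist x y"
      using lip by eventually_elim (use that in auto)
  qed simp
  define \<delta> where "\<delta> = e / (3 * L')"
  have \<delta>: "\<delta> > 0" "L' * \<delta> = e / 3" using e L' by (auto simp: \<delta>_def)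
  have "K \<subseteq> (\<Union>x\<in>K. ball x \<delta>)" using \<delta> by auto
  then obtain C where C: "C \<subseteq> K" "finite C" "K \<subseteq> (\<Union>x\<in>C. ball x \<delta>)"
    using compactE_image[OF K, of K "\<lambda>x. ball x \<delta>"] by auto
  have "\<forall>\<^sub>F n in sequentially. \<forall>x\<in>C. dist (h n x) (g x) < e / 3"
    using C lim e by (intro eventually_ball_finite tendstoD ballI) auto
  then show "\<forall>\<^sub>F n in sequentially. \<forall>x\<in>K. dist (h n x) (g x) < e"
    using lip
  proof eventually_elim
    case (elim n)
    show ?case
    proof
      fix x assume x: "x \<in> K"
      then obtain y where y: "y \<in> C" "dist y x < \<delta>" using C(3) by auto
      then have yK: "y \<in> K" using C by auto
      have "L * dist x y \<le> L' * \<delta>"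
        using y(2) L' by (intro mult_mono) (auto simp: dist_commute)
      then have small: "L * dist x y \<le> e / 3" using \<delta> by simp
      have "dist (h n x) (g x) \<le> dist (h n x) (h n y) + dist (h n y) (g y) + dist (g y) (g x)"
        using dist_triangle[of "h n x" "g x" "h n y"] dist_triangle[of "h n y" "g x" "g y"] by linarith
      moreover have "dist (h n x) (h n y) \<le> e / 3" using elim(2) x yK small by force
      moreover have "dist (g y) (g x) \<le> e / 3" using lipg[OF x yK] small by (simp add: dist_commute)
      moreover have "dist (h n y) (g y) < e / 3" using elim(1) y(1) by blast
      ultimately show "dist (h n x) (g x) < e" by linarith
    qed
  qed
qed

text \<open>The measure is the law of |X| \<omega>^k, with X distributed as \<nu> and k independent
  of X and uniform on {0..r}.\<close>

lemma ex_rotated_measure: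
  fixes \<nu> :: "real measure" and \<omega> :: complex
  assumes "real_distribution \<nu>"
  shows "\<exists>\<mu>. sets \<mu> = sets borel \<and> finite_measure \<mu> \<and>
    (\<forall>f :: complex \<Rightarrow> real. continuous_on UNIV f \<longrightarrow> bounded (range f) \<longrightarrow>
       integral\<^sup>L \<mu> f = (\<integral>x. (\<Sum>k\<le>r. f (of_real \<bar>x\<bar> * \<omega> ^ k)) / real (r + 1) \<partial>\<nu>))"
proof -
  interpret \<nu>: real_distribution \<nu> by fact
  define \<kappa> where "\<kappa> = measure_pmf (pmf_of_set {..r})"
  interpret \<kappa>: prob_space \<kappa> unfolding \<kappa>_def by (rule prob_space_measure_pmf)
  interpret pair: pair_prob_space \<nu> \<kappa> ..
  define T where "T p = of_real \<bar>fst p\<bar> * \<omega> ^ snd p" for p :: "real \<times> nat"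
  have [measurable]: "(\<lambda>k. \<omega> ^ k) \<in> borel_measurable \<kappa>" by (simp add: \<kappa>_def)
  have [measurable]: "T \<in> borel_measurable (\<nu> \<Otimes>\<^sub>M \<kappa>)" unfolding T_def by measurable
  define \<mu> where "\<mu> = distr (\<nu> \<Otimes>\<^sub>M \<kappa>) borel T"
  interpret \<mu>: prob_space \<mu> unfolding \<mu>_def by (rule pair.prob_space_distr) measurable
  have "integral\<^sup>L \<mu> f = (\<integral>x. (\<Sum>k\<le>r. f (of_real \<bar>x\<bar> * \<omega> ^ k)) / real (r + 1) \<partial>\<nu>)"
    if cont: "continuous_on UNIV f" and bd: "bounded (range f)" for f :: "complex \<Rightarrow> real"
  proof -
    have [measurable]: "f \<in> borel_measurable borel" using cont by (rule borel_measurable_continuous_onI)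
    obtain B where B: "\<And>x. norm (f x) \<le> B" using bd by (auto simp: bounded_iff)
    have "integral\<^sup>L \<mu> f = (\<integral>p. f (T p) \<partial>(\<nu> \<Otimes>\<^sub>M \<kappa>))"
      unfolding \<mu>_def by (rule integral_distr) measurable
    also have "\<dots> = (\<integral>x. \<integral>k. f (T (x, k)) \<partial>\<kappa> \<partial>\<nu>)"
    proof (rule pair.integral_fst'[symmetric])
      show "integrable (\<nu> \<Otimes>\<^sub>M \<kappa>) (\<lambda>p. f (T p))"
        by (rule pair.integrable_const_bound[where B = B]) (use B in auto)
    qed
    also have "(\<lambda>x. \<integral>k. f (T (x, k)) \<partial>\<kappa>) = (\<lambda>x. (\<Sum>k\<le>r. f (of_real \<bar>x\<bar> * \<omega> ^ k)) / real (r + 1))"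
      unfolding \<kappa>_def by (intro ext, subst integral_pmf_of_set) (auto simp: T_def)
    finally show ?thesis .
  qed
  moreover have "sets \<mu> = sets borel" by (simp add: \<mu>_def)
  ultimately show ?thesis using \<mu>.finite_measure_axioms by blast
qed

section \<open>Averages over the zeros and their limits\<close>

context regular_recurrence begin

abbreviation q where "q N \<equiv> Q r \<gamma> c N N"

definition zeros where "zeros N = {x. poly (q N) x = 0}"

text \<open>Integration against \<open>zero_measure (q N) N\<close> as a finite sum, for which
  linearity and rotations raise no measurability questions.\<close>

definition zero_mean :: "nat \<Rightarrow> (complex \<Rightarrow> 'a::real_normed_vector) \<Rightarrow> 'a" where
  "zero_mean N u = (\<Sum>x\<in>zeros N. (real (order x (q N)) / real N) *\<^sub>R u x)"

lemma integral_eq_zero_mean: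
  fixes f :: "complex \<Rightarrow> 'b::{banach, second_countable_topology}"
  shows "1 \<le> N \<Longrightarrow> f \<in> borel_measurable borel \<Longrightarrow> integral\<^sup>L (zero_measure (q N) N) f = zero_mean N f"
  unfolding zero_mean_def zeros_def by (intro integral_zero_measure Q_nonzero)

lemma zeros_subset_star: "1 \<le> N \<Longrightarrow> x \<in> zeros N \<Longrightarrow> x \<in> star r"
  unfolding zeros_def using logderiv_Q(1) by blast

text \<open>For x beyond the bound, 1 / x^(r+1) lies in the disc of \<open>small_disc\<close>, where
  the reduced polynomial does not vanish. The maximum with 1 ensures |x| <= |x|^(r+1).\<close>

lemma zeros_bounded: obtains R where "1 \<le> R" "\<And>N x. 1 \<le> N \<Longrightarrow> x \<in> zeros N \<Longrightarrow> norm x \<le> R"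
proof -
  obtain \<rho> where \<rho>: "0 < \<rho>"
    "\<And>N s n. 1 \<le> N \<Longrightarrow> norm s * real N powr \<gamma> \<le> \<rho> \<Longrightarrow> n \<le> N \<Longrightarrow> p n s \<noteq> 0 \<and> p (Suc n) s \<noteq> 0 \<and> norm (w n s) \<le> 2"
    by (rule small_disc) blast
  show ?thesis
  proof (rule that[of "max 1 (1 / \<rho>)"])
    fix N x assume N: "1 \<le> N" and x: "x \<in> zeros N"
    show "norm x \<le> max 1 (1 / \<rho>)"
    proof (rule ccontr)
      assume "\<not> norm x \<le> max 1 (1 / \<rho>)"
      then have nx: "1 < norm x" "1 / \<rho> < norm x" by auto
      then have x0: "x \<noteq> 0" by auto
      define s where "s = 1 / x ^ (r + 1) / of_real (real N powr \<gamma>)"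
      have "norm x ^ 1 \<le> norm x ^ (r + 1)" using nx by (intro power_increasing) auto
      then have "1 / \<rho> \<le> norm x ^ (r + 1)" using nx by simp
      then have "1 / norm x ^ (r + 1) \<le> \<rho>"
        using \<rho>(1) nx by (simp add: divide_le_eq mult.commute del: power_Suc)
      moreover have "norm s * real N powr \<gamma> = 1 / norm x ^ (r + 1)"
        using N by (simp add: s_def norm_divide norm_power norm_mult)
      ultimately have "p N s \<noteq> 0" using \<rho>(2)[OF N, of s N] by simp
      then have "poly (q N) x \<noteq> 0" using poly_Q_eq[OF N x0] x0 by (simp add: s_def)
      then show False using x by (simp add: zeros_def)
    qed
  qed simp
qed

lemma sum_weights: "1 \<le> N \<Longrightarrow> (\<Sum>x\<in>zeros N. real (order x (q N)) / real N) = 1"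
  using sum_order_eq_degree[OF Q_nonzero, of N r \<gamma> c N] degree_Q[of N r \<gamma> c N]
  by (simp add: zeros_def flip: sum_divide_distrib of_nat_sum)

lemma zero_mean_const: "1 \<le> N \<Longrightarrow> zero_mean N (\<lambda>_. b) = b"
  unfolding zero_mean_def scaleR_sum_left[symmetric] by (simp add: sum_weights)

lemma norm_zero_mean_le:
  assumes N: "1 \<le> N" and B: "\<And>x. x \<in> zeros N \<Longrightarrow> norm (u x) \<le> B"
  shows "norm (zero_mean N u) \<le> B"
proof -
  have "norm (zero_mean N u) \<le> (\<Sum>x\<in>zeros N. real (order x (q N)) / real N * B)"
    unfolding zero_mean_def by (rule sum_norm_le) (auto intro!: mult_left_mono divide_right_mono B)
  then show ?thesis unfolding sum_distrib_right[symmetric] sum_weights[OF N] by simp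
qed

lemma zero_mean_cong: "(\<And>x. x \<in> zeros N \<Longrightarrow> u x = u' x) \<Longrightarrow> zero_mean N u = zero_mean N u'"
  unfolding zero_mean_def by (intro sum.cong) auto

lemma zero_mean_diff: "zero_mean N (\<lambda>x. u x - u' x) = zero_mean N u - zero_mean N u'"
  unfolding zero_mean_def by (simp add: scaleR_diff_right sum_subtractf)

lemma zero_mean_mult: "zero_mean N (\<lambda>x. b * u x) = b * zero_mean N u" for b :: "'b::real_normed_algebra"
  unfolding zero_mean_def by (simp add: sum_distrib_left)

lemma zero_mean_sum: "zero_mean N (\<lambda>x. \<Sum>i\<in>J. u i x) = (\<Sum>i\<in>J. zero_mean N (u i))"
  unfolding zero_mean_def scaleR_sum_right by (rule sum.swap)

lemma zero_mean_of_real: "zero_mean N (\<lambda>x. of_real (u x) :: complex) = of_real (zero_mean N u)"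
  unfolding zero_mean_def by (simp add: scaleR_conv_of_real)

lemma zero_mean_rotate:
  assumes N: "1 \<le> N" and \<omega>: "\<omega> ^ (r + 1) = 1"
  shows "zero_mean N (\<lambda>x. u (\<omega> * x)) = zero_mean N u"
proof -
  have \<omega>0: "\<omega> \<noteq> 0" using \<omega> by auto
  have ord: "order (\<omega> * x) (q N) = order x (q N)" for x
    using order_rotate[OF Q_nonzero[OF N] poly_Q_rotate[OF N \<omega>] \<omega>] by simp
  have "x \<in> zeros N \<Longrightarrow> \<omega> * x \<in> zeros N" for x
    unfolding zeros_def using poly_Q_rotate[OF N \<omega>] by simp
  moreover have "x / \<omega> \<in> zeros N" if "x \<in> zeros N" for x
    using that poly_Q_rotate[OF N \<omega>, of \<gamma> c N "x / \<omega>"] \<omega>0 by (simp add: zeros_def)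
  ultimately show ?thesis
    unfolding zero_mean_def
    by (intro sum.reindex_bij_witness[of _ "\<lambda>x. x / \<omega>" "\<lambda>x. \<omega> * x"]) (use \<omega>0 ord in auto)
qed

lemma zero_mean_stieltjes:
  assumes N: "1 \<le> N" and z: "z \<notin> star r"
  shows "zero_mean N (\<lambda>x. 1 / (z - x)) = 1 / of_nat N * (poly (pderiv (q N)) z / poly (q N) z)"
proof -
  have "poly (q N) z \<noteq> 0" using logderiv_Q(1)[OF z N] .
  then show ?thesis
    unfolding zero_mean_def zeros_def
    by (simp add: poly_logderiv_eq_sum sum_distrib_left scaleR_conv_of_real)
qed

lemma zero_mean_stieltjes_tendsto:
  assumes z: "z \<notin> star r"
  shows "(\<lambda>N. zero_mean N (\<lambda>x. 1 / (z - x))) \<longlonglongrightarrow>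
     - (1 / of_nat r) * ((of_nat (r + 1) * integral {0..1} (\<phi> (1 / z ^ (r + 1))) - of_nat r) / z)"
proof (rule Lim_transform_eventually[OF logderiv_Q_tendsto[OF z]])
  show "\<forall>\<^sub>F N in sequentially. 1 / of_nat N * (poly (pderiv (q N)) z / poly (q N) z) = zero_mean N (\<lambda>x. 1 / (z - x))"
    by (rule eventually_sequentiallyI[of 1]) (rule zero_mean_stieltjes[OF _ z, symmetric])
qed

text \<open>Induction on \<open>k\<close>, using
  $x^{k+1}/(1-\zeta x) = (x^k/(1-\zeta x) - x^k)/\zeta$ and then $\zeta \to 0$ along a ray
  on which $1/\zeta$ avoids the star.\<close>

lemma convergent_moments: "convergent (\<lambda>N. zero_mean N (\<lambda>x. x ^ k))"
proof -
  obtain R where R: "1 \<le> R" "\<And>N x. 1 \<le> N \<Longrightarrow> x \<in> zeros N \<Longrightarrow> norm x \<le> R" by (rule zeros_bounded) blast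
  \<comment> \<open>u^(r+1) = -1, so 1/\<zeta> = u/\<tau> has a negative (r+1)-st power and lies off
    the star for every \<tau> > 0.\<close>
  define u where "u = exp (\<i> * of_real pi / of_nat (r + 1))"
  have "u ^ (r + 1) = exp (of_nat (r + 1) * (\<i> * of_real pi / of_nat (r + 1)))"
    unfolding u_def by (rule exp_of_nat_mult[symmetric])
  also have "of_nat (r + 1) * (\<i> * of_real pi / of_nat (r + 1)) = \<i> * of_real pi"
    by (simp del: of_nat_Suc)
  finally have u: "u ^ (r + 1) = - 1" by (simp add: exp_pi_i')
  have nu: "norm u = 1" unfolding u_def by (simp add: norm_exp_eq_Re)
  define \<zeta> where "\<zeta> \<tau> = of_real \<tau> / u" for \<tau>
  have u0: "u \<noteq> 0" using nu by auto
  have off: "1 / \<zeta> \<tau> \<notin> star r" if "0 < \<tau>" for \<tau>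
  proof -
    have eq: "(1 / \<zeta> \<tau>) ^ (r + 1) = of_real (- 1 / \<tau> ^ (r + 1))"
      unfolding \<zeta>_def by (simp only: divide_divide_eq_right mult_1 power_divide u) simp
    have "- 1 / \<tau> ^ (r + 1) < 0" using that by (simp add: divide_neg_pos)
    then show ?thesis unfolding star_iff eq nonneg_Reals_of_real_iff by linarith
  qed
  have nz: "1 - \<zeta> \<tau> * x \<noteq> 0" if "0 < \<tau>" "x \<in> zeros N" "1 \<le> N" for \<tau> x N
  proof
    assume "1 - \<zeta> \<tau> * x = 0"
    then have "x = 1 / \<zeta> \<tau>" using that u0 by (simp add: \<zeta>_def field_simps)
    then show False using off[OF that(1)] zeros_subset_star[OF that(3,2)] by simp
  qed
  have "(\<forall>\<tau>>0. convergent (\<lambda>N. zero_mean N (\<lambda>x. x ^ k / (1 - \<zeta> \<tau> * x)))) \<and> convergent (\<lambda>N. zero_mean N (\<lambda>x. x ^ k))"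
  proof (induction k)
    case 0
    have "convergent (\<lambda>N. zero_mean N (\<lambda>x. x ^ 0 / (1 - \<zeta> \<tau> * x)))" if \<tau>: "0 < \<tau>" for \<tau>
    proof -
      have \<zeta>0: "\<zeta> \<tau> \<noteq> 0" using \<tau> u0 by (simp add: \<zeta>_def)
      \<comment> \<open>The induction starts from the known limits of Stieltjes transforms, because
        1 / (1 - \<zeta> x) is 1/\<zeta> times the kernel at the point 1/\<zeta>.\<close>
      have "convergent (\<lambda>N. (1 / \<zeta> \<tau>) * zero_mean N (\<lambda>x. 1 / (1 / \<zeta> \<tau> - x)))"
        by (rule convergentI[OF tendsto_mult[OF tendsto_const zero_mean_stieltjes_tendsto[OF off[OF \<tau>]]]])
      moreover have "(1 / \<zeta> \<tau>) * zero_mean N (\<lambda>x. 1 / (1 / \<zeta> \<tau> - x)) = zero_mean N (\<lambda>x. x ^ 0 / (1 - \<zeta> \<tau> * x))" for N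
        unfolding zero_mean_mult[symmetric] by (intro zero_mean_cong) (use \<zeta>0 in \<open>simp add: field_simps\<close>)
      ultimately show ?thesis by simp
    qed
    moreover have "convergent (\<lambda>N. zero_mean N (\<lambda>x::complex. x ^ 0 :: complex))"
      by (rule convergentI[of _ 1], rule tendsto_eventually)
        (auto intro!: eventually_sequentiallyI[of 1] simp: zero_mean_const)
    ultimately show ?case by blast
  next
    case (Suc k)
    have A: "convergent (\<lambda>N. zero_mean N (\<lambda>x. x ^ Suc k / (1 - \<zeta> \<tau> * x)))" if \<tau>: "0 < \<tau>" for \<tau>
    proof -
      have \<zeta>0: "\<zeta> \<tau> \<noteq> 0" using \<tau> u0 by (simp add: \<zeta>_def)
      have "convergent (\<lambda>N. (1 / \<zeta> \<tau>) * (zero_mean N (\<lambda>x. x ^ k / (1 - \<zeta> \<tau> * x)) - zero_mean N (\<lambda>x. x ^ k)))"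
        using Suc \<tau> by (intro convergent_mult convergent_diff convergent_const) auto
      moreover have "(1 / \<zeta> \<tau>) * (zero_mean N (\<lambda>x. x ^ k / (1 - \<zeta> \<tau> * x)) - zero_mean N (\<lambda>x. x ^ k)) =
          zero_mean N (\<lambda>x. x ^ Suc k / (1 - \<zeta> \<tau> * x))" if "1 \<le> N" for N
        unfolding zero_mean_diff[symmetric] zero_mean_mult[symmetric]
        by (intro zero_mean_cong) (use \<zeta>0 nz[OF \<tau> _ that] in \<open>simp add: field_simps\<close>)
      ultimately show ?thesis
        using convergent_cong[OF eventually_sequentiallyI[of 1]] by (metis (no_types, lifting))
    qed
    have "convergent (\<lambda>N. zero_mean N (\<lambda>x. x ^ Suc k))"
    proof (rule convergent_if_approximable)
      fix e :: real assume e: "0 < e"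
      \<comment> \<open>The first bound gives |\<zeta> x| <= 1/2, hence |1 - \<zeta> x| >= 1/2; the
        second then makes the error |\<zeta> x^(k+2) / (1 - \<zeta> x)| at most e.\<close>
      define \<tau> where "\<tau> = min (1 / (2 * R)) (e / (2 * R ^ (k + 2)))"
      have \<tau>: "0 < \<tau>" using e R by (simp add: \<tau>_def)
      have \<tau>R: "\<tau> * R \<le> 1 / 2"
      proof -
        have "\<tau> * R \<le> 1 / (2 * R) * R" using R by (intro mult_right_mono) (auto simp: \<tau>_def)
        then show ?thesis using R by simp
      qed
      have \<tau>e: "\<tau> * R ^ (k + 2) * 2 \<le> e"
      proof -
        have "\<tau> * R ^ (k + 2) * 2 \<le> e / (2 * R ^ (k + 2)) * R ^ (k + 2) * 2"
          using R by (intro mult_right_mono) (auto simp: \<tau>_def)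
        then show ?thesis using R by simp
      qed
      have "norm (zero_mean N (\<lambda>x. x ^ Suc k) - zero_mean N (\<lambda>x. x ^ Suc k / (1 - \<zeta> \<tau> * x))) \<le> e" if N: "1 \<le> N" for N
        unfolding zero_mean_diff[symmetric]
      proof (rule norm_zero_mean_le[OF N])
        fix x assume x: "x \<in> zeros N"
        have n\<zeta>: "norm (\<zeta> \<tau>) = \<tau>" using \<tau> nu by (simp add: \<zeta>_def norm_divide)
        have "norm (\<zeta> \<tau> * x) \<le> \<tau> * R"
          unfolding norm_mult n\<zeta> using R(2)[OF N x] \<tau> by (intro mult_left_mono) auto
        then have low: "1 / 2 \<le> norm (1 - \<zeta> \<tau> * x)"
          using norm_triangle_ineq2[of 1 "\<zeta> \<tau> * x"] \<tau>R by simp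
        have "x ^ Suc k - x ^ Suc k / (1 - \<zeta> \<tau> * x) = - (\<zeta> \<tau> * x ^ (k + 2)) / (1 - \<zeta> \<tau> * x)"
          using nz[OF \<tau> x N] by (simp add: field_simps)
        then have "norm (x ^ Suc k - x ^ Suc k / (1 - \<zeta> \<tau> * x)) = \<tau> * norm x ^ (k + 2) / norm (1 - \<zeta> \<tau> * x)"
          by (simp only: norm_divide norm_minus_cancel norm_mult norm_power n\<zeta>)
        also have "\<dots> \<le> \<tau> * R ^ (k + 2) / (1 / 2)"
          using low R(2)[OF N x] R(1) \<tau> by (intro frac_le mult_left_mono power_mono) auto
        finally show "norm (x ^ Suc k - x ^ Suc k / (1 - \<zeta> \<tau> * x)) \<le> e" using \<tau>e by simp
      qed
      then show "\<exists>b. convergent b \<and> (\<forall>\<^sub>F N in sequentially. norm (zero_mean N (\<lambda>x. x ^ Suc k) - b N) \<le> e)"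
        using A[OF \<tau>] by (intro exI[of _ "\<lambda>N. zero_mean N (\<lambda>x. x ^ Suc k / (1 - \<zeta> \<tau> * x))"] conjI eventually_sequentiallyI[of 1]) auto
    qed
    with A show ?case by blast
  qed
  then show ?thesis by blast
qed

text \<open>On the star x^(r+1) = |x|^(r+1), so the mean of a polynomial in |x|^(r+1) is a
  combination of moments. Weierstrass approximation in this variable, applied to h composed with the
  (r+1)-st root on a bounded interval, reaches every continuous h.\<close>

lemma convergent_radial_mean:
  fixes h :: "real \<Rightarrow> real"
  assumes h: "continuous_on UNIV h"
  shows "convergent (\<lambda>N. zero_mean N (\<lambda>x. h (norm x)))"
proof (rule convergent_if_approximable)
  fix e :: real assume e: "0 < e"
  obtain R where R: "1 \<le> R" "\<And>N x. 1 \<le> N \<Longrightarrow> x \<in> zeros N \<Longrightarrow> norm x \<le> R" by (rule zeros_bounded) blast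
  have "continuous_on {0..R ^ (r + 1)} (\<lambda>u. h (root (r + 1) u))"
    by (rule continuous_on_compose2[OF h]) (auto intro!: continuous_intros)
  then obtain pl where pl: "real_polynomial_function pl" "\<And>u. u \<in> {0..R ^ (r + 1)} \<Longrightarrow> \<bar>h (root (r + 1) u) - pl u\<bar> < e"
    using Stone_Weierstrass_real_polynomial_function[OF compact_Icc _ e] by blast
  from pl(1) obtain a n where pln: "pl = (\<lambda>u. \<Sum>i\<le>n. a i * u ^ i)" unfolding real_polynomial_function_iff_sum by blast
  have "norm (zero_mean N (\<lambda>x. h (norm x)) - zero_mean N (\<lambda>x. pl (norm x ^ (r + 1)))) \<le> e" if N: "1 \<le> N" for N
    unfolding zero_mean_diff[symmetric]
  proof (rule norm_zero_mean_le[OF N])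
    fix x assume x: "x \<in> zeros N"
    have "norm x ^ (r + 1) \<in> {0..R ^ (r + 1)}" using R(2)[OF N x] by (auto intro!: power_mono simp del: power_Suc)
    moreover have "root (r + 1) (norm x ^ (r + 1)) = norm x" by (rule real_root_power_cancel) auto
    ultimately show "norm (h (norm x) - pl (norm x ^ (r + 1))) \<le> e" using pl(2)[of "norm x ^ (r + 1)"] by simp
  qed
  moreover have "convergent (\<lambda>N. zero_mean N (\<lambda>x. pl (norm x ^ (r + 1))))"
  proof -
    have "convergent (\<lambda>N. \<Sum>i\<le>n. of_real (a i) * zero_mean N (\<lambda>x. x ^ ((r + 1) * i)))"
      by (intro convergent_sum convergent_mult convergent_const convergent_moments)
    then have "convergent (\<lambda>N. Re (\<Sum>i\<le>n. of_real (a i) * zero_mean N (\<lambda>x. x ^ ((r + 1) * i))))"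
      unfolding convergent_def using tendsto_Re by blast
    moreover have "Re (\<Sum>i\<le>n. of_real (a i) * zero_mean N (\<lambda>x. x ^ ((r + 1) * i))) = zero_mean N (\<lambda>x. pl (norm x ^ (r + 1)))"
      if N: "1 \<le> N" for N
    proof -
      have "(\<Sum>i\<le>n. of_real (a i) * zero_mean N (\<lambda>x. x ^ ((r + 1) * i))) = zero_mean N (\<lambda>x. \<Sum>i\<le>n. of_real (a i) * x ^ ((r + 1) * i))"
        by (simp only: zero_mean_sum zero_mean_mult)
      also have "\<dots> = zero_mean N (\<lambda>x. of_real (pl (norm x ^ (r + 1))))"
      proof (rule zero_mean_cong)
        fix x assume "x \<in> zeros N"
        then have "x ^ (r + 1) \<in> \<real>\<^sub>\<ge>\<^sub>0" using zeros_subset_star[OF N] star_iff by blast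
        then obtain y where y: "x ^ (r + 1) = of_real y" "0 \<le> y" by (auto elim: nonneg_Reals_cases)
        then have "norm x ^ (r + 1) = y" by (metis norm_power norm_of_real abs_of_nonneg)
        then show "(\<Sum>i\<le>n. of_real (a i) * x ^ ((r + 1) * i)) = of_real (pl (norm x ^ (r + 1)))"
          unfolding pln power_mult y(1) by simp
      qed
      finally show ?thesis by (simp only: zero_mean_of_real Re_complex_of_real)
    qed
    ultimately show ?thesis
      using convergent_cong[OF eventually_sequentiallyI[of 1]] by (metis (no_types, lifting))
  qed
  ultimately show "\<exists>b. convergent b \<and> (\<forall>\<^sub>F N in sequentially. norm (zero_mean N (\<lambda>x. h (norm x)) - b N) \<le> e)"
    by (intro exI[of _ "\<lambda>N. zero_mean N (\<lambda>x. pl (norm x ^ (r + 1)))"] conjI eventually_sequentiallyI[of 1]) auto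
qed

text \<open>The distributions of the moduli are tight, so a subsequence converges weakly; its limit
  is spread evenly over the rays. A test function may be replaced by its average over rotations,
  which is radial on the star. Radial means converge along the full sequence, so the subsequential
  limit is the limit.\<close>

lemma ex_weak_star_limit: "\<exists>\<mu>. weak_star_limit (\<lambda>N. zero_measure (q N) N) \<mu>"
proof -
  define \<omega> where "\<omega> = exp (2 * of_real pi * \<i> / of_nat (r + 1))"
  have "\<omega> ^ (r + 1) = exp (of_nat (r + 1) * (2 * of_real pi * \<i> / of_nat (r + 1)))"
    unfolding \<omega>_def by (rule exp_of_nat_mult[symmetric])
  also have "of_nat (r + 1) * (2 * of_real pi * \<i> / of_nat (r + 1)) = 2 * of_real pi * \<i>"
    by (simp del: of_nat_Suc)
  finally have \<omega>: "\<omega> ^ (r + 1) = 1" by simp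
  obtain R where R: "1 \<le> R" "\<And>N x. 1 \<le> N \<Longrightarrow> x \<in> zeros N \<Longrightarrow> norm x \<le> R" by (rule zeros_bounded) blast
  \<comment> \<open>The shift to \<open>Suc n\<close> avoids N = 0: the scaling factor of
    \<open>q 0\<close> is \<open>0 powr 0\<close>, which is 0, so \<open>q 0\<close> is the zero
    polynomial.\<close>
  define \<nu> where "\<nu> n = distr (zero_measure (q (Suc n)) (Suc n)) borel norm" for n
  have norm_meas: "norm \<in> borel_measurable (zero_measure p N)" for p :: "complex poly" and N
    by (subst measurable_cong_sets[OF sets_zero_measure refl]) measurable
  have \<nu>: "real_distribution (\<nu> n)" for n
    unfolding \<nu>_def
    by (rule prob_space.real_distribution_distr[OF prob_space_zero_measure norm_meas]) (auto simp: Q_nonzero degree_Q)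
  have \<nu>_int: "integral\<^sup>L (\<nu> n) h = zero_mean (Suc n) (\<lambda>x. h (norm x))"
    if [measurable]: "h \<in> borel_measurable borel" for h :: "real \<Rightarrow> real" and n
  proof -
    have "integral\<^sup>L (\<nu> n) h = (\<integral>x. h (norm x) \<partial>zero_measure (q (Suc n)) (Suc n))"
      unfolding \<nu>_def by (rule integral_distr) (auto intro: norm_meas)
    also have "\<dots> = zero_mean (Suc n) (\<lambda>x. h (norm x))" by (rule integral_eq_zero_mean) auto
    finally show ?thesis .
  qed
  have "tight \<nu>"
    unfolding tight_def
  proof (intro conjI allI impI)
    fix \<epsilon> :: real assume \<epsilon>: "0 < \<epsilon>"
    \<comment> \<open>The intervals in \<open>tight\<close> are open on the left; the endpoint -1
      leaves room for a zero at the origin.\<close>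
    have "measure (\<nu> n) {- 1<..R} = 1" for n
    proof -
      interpret real_distribution "\<nu> n" by (rule \<nu>)
      have "measure (\<nu> n) {- 1<..R} = integral\<^sup>L (\<nu> n) (indicator {- 1<..R})" by simp
      also have "\<dots> = zero_mean (Suc n) (\<lambda>x. indicator {- 1<..R} (norm x))" by (rule \<nu>_int) simp
      also have "\<dots> = zero_mean (Suc n) (\<lambda>x. 1)"
        by (rule zero_mean_cong) (use R(2)[of "Suc n"] in \<open>auto simp: indicator_def intro: less_le_trans[OF _ norm_ge_zero]\<close>)
      finally show ?thesis by (simp add: zero_mean_const)
    qed
    then show "\<exists>a b. a < b \<and> (\<forall>n. 1 - \<epsilon> < measure (\<nu> n) {a<..b})"
      using R(1) \<epsilon> by (intro exI[of _ "- 1"] exI[of _ R]) auto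
  qed (rule \<nu>)
  then obtain s \<nu>0 where s: "strict_mono (s :: nat \<Rightarrow> nat)" and \<nu>0: "real_distribution \<nu>0"
    and conv: "weak_conv_m (\<nu> \<circ> (\<lambda>n. n) \<circ> s) \<nu>0"
    using tight_imp_convergent_subsubsequence[of \<nu> "\<lambda>n. n"] by (auto simp: strict_mono_def)
  obtain \<mu> where \<mu>: "sets \<mu> = sets borel" "finite_measure \<mu>"
    "\<And>u :: complex \<Rightarrow> real. continuous_on UNIV u \<Longrightarrow> bounded (range u) \<Longrightarrow>
       integral\<^sup>L \<mu> u = (\<integral>x. (\<Sum>k\<le>r. u (of_real \<bar>x\<bar> * \<omega> ^ k)) / real (r + 1) \<partial>\<nu>0)"
    using ex_rotated_measure[OF \<nu>0, where r = r and \<omega> = \<omega>] by blast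
  have "(\<lambda>N. integral\<^sup>L (zero_measure (q N) N) u) \<longlonglongrightarrow> integral\<^sup>L \<mu> u"
    if u: "continuous_on UNIV u" "bounded (range u)" for u :: "complex \<Rightarrow> real"
  proof -
    define h where "h x = (\<Sum>k\<le>r. u (of_real \<bar>x\<bar> * \<omega> ^ k)) / real (r + 1)" for x :: real
    have h_cont: "continuous_on UNIV h"
      unfolding h_def by (intro continuous_intros continuous_on_compose2[OF u(1)]) auto
    obtain B where B: "\<And>x. norm (u x) \<le> B" using u(2) by (auto simp: bounded_iff)
    have h_bound: "norm (h x) \<le> B" for x
    proof -
      have "norm (\<Sum>k\<le>r. u (of_real \<bar>x\<bar> * \<omega> ^ k)) \<le> real (card {..r}) * B"
        by (rule sum_norm_bound) (rule B)
      then show ?thesis by (simp add: h_def divide_le_eq mult.commute)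
    qed
    \<comment> \<open>Rotating a point x of the star permutes the points |x| \<omega>^k, so the
      average of u over the rotations of x is h(|x|); by the invariance of the zeros, averaging does
      not change the mean.\<close>
    have mean: "zero_mean N u = zero_mean N (\<lambda>x. h (norm x))" if N: "1 \<le> N" for N
    proof -
      have "zero_mean N (\<lambda>x. h (norm x)) = zero_mean N (\<lambda>x. (1 / real (r + 1)) * (\<Sum>k\<le>r. u (\<omega> ^ k * x)))"
      proof (rule zero_mean_cong)
        fix x assume "x \<in> zeros N"
        then obtain j where j: "x = of_real (norm x) * \<omega> ^ j"
          using star_ray[OF zeros_subset_star[OF N]] unfolding \<omega>_def by metis
        have wmod: "\<omega> ^ (m mod (r + 1)) = \<omega> ^ m" for m
        proof -
          have "\<omega> ^ m = \<omega> ^ (m mod (r + 1) + (r + 1) * (m div (r + 1)))" by (simp only: mod_mult_div_eq)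
          also have "\<dots> = \<omega> ^ (m mod (r + 1))" by (simp only: power_add[of _ "m mod (r + 1)"] power_mult \<omega> power_one mult_1_right)
          finally show ?thesis by simp
        qed
        have "(\<Sum>k\<le>r. u (\<omega> ^ k * x)) = (\<Sum>k<r + 1. u (of_real (norm x) * \<omega> ^ ((j + k) mod (r + 1))))"
          unfolding wmod using j by (intro sum.cong) (auto simp: power_add mult_ac)
        also have "\<dots> = (\<Sum>k<r + 1. u (of_real (norm x) * \<omega> ^ k))"
          using sum.reindex_bij_betw[OF bij_betw_add_mod[of "r + 1" j], of "\<lambda>k. u (of_real (norm x) * \<omega> ^ k)"] by simp
        finally show "h (norm x) = (1 / real (r + 1)) * (\<Sum>k\<le>r. u (\<omega> ^ k * x))"
          by (simp add: h_def lessThan_Suc_atMost)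
      qed
      also have "\<dots> = (1 / real (r + 1)) * (\<Sum>k\<le>r. zero_mean N (\<lambda>x. u (\<omega> ^ k * x)))"
        by (simp only: zero_mean_mult zero_mean_sum)
      also have "(\<Sum>k\<le>r. zero_mean N (\<lambda>x. u (\<omega> ^ k * x))) = (\<Sum>k\<le>r. zero_mean N u)"
      proof (intro sum.cong refl zero_mean_rotate[OF N])
        fix k show "(\<omega> ^ k) ^ (r + 1) = 1" by (metis \<omega> power_commutes power_mult mult.commute power_one)
      qed
      finally show ?thesis by simp
    qed
    obtain l where l: "(\<lambda>N. zero_mean N (\<lambda>x. h (norm x))) \<longlonglongrightarrow> l"
      using convergent_radial_mean[OF h_cont] by (auto simp: convergent_def)
    have "(\<lambda>n. zero_mean (Suc (s n)) (\<lambda>x. h (norm x))) \<longlonglongrightarrow> l"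
      using LIMSEQ_subseq_LIMSEQ[OF LIMSEQ_Suc[OF l] s] by (simp add: o_def)
    moreover have "(\<lambda>n. integral\<^sup>L ((\<nu> \<circ> (\<lambda>n. n) \<circ> s) n) h) \<longlonglongrightarrow> integral\<^sup>L \<nu>0 h"
      using h_cont h_bound
      by (intro weak_conv_imp_integral_bdd_continuous_conv[OF _ \<nu>0 conv])
        (auto simp: \<nu> continuous_on_eq_continuous_at)
    then have "(\<lambda>n. zero_mean (Suc (s n)) (\<lambda>x. h (norm x))) \<longlonglongrightarrow> integral\<^sup>L \<nu>0 h"
      using borel_measurable_continuous_onI[OF h_cont] by (simp add: \<nu>_int)
    ultimately have "l = integral\<^sup>L \<nu>0 h" by (rule LIMSEQ_unique)
    then have "(\<lambda>N. zero_mean N (\<lambda>x. h (norm x))) \<longlonglongrightarrow> integral\<^sup>L \<mu> u"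
      using l \<mu>(3)[OF u] by (simp add: h_def[abs_def])
    moreover have "\<forall>\<^sub>F N in sequentially. zero_mean N (\<lambda>x. h (norm x)) = integral\<^sup>L (zero_measure (q N) N) u"
      using borel_measurable_continuous_onI[OF u(1)]
      by (intro eventually_sequentiallyI[of 1]) (simp add: integral_eq_zero_mean mean)
    ultimately show ?thesis by (rule Lim_transform_eventually)
  qed
  with \<mu>(1,2) show ?thesis unfolding weak_star_limit_def by blast
qed

text \<open>The kernel $1/(z-x)$ is not bounded; it is replaced by a bounded continuous function \<open>k\<close> that agrees
  with it on the star, which carries the limit measure.\<close>

lemma weak_star_limit_stieltjes:
  assumes \<mu>: "weak_star_limit (\<lambda>N. zero_measure (q N) N) \<mu>" and z: "z \<notin> star r"
  shows "(\<lambda>N. zero_mean N (\<lambda>x. 1 / (z - x))) \<longlonglongrightarrow> stieltjes \<mu> z"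
proof -
  have sets [measurable_cong, simp]: "sets \<mu> = sets borel" and fin: "finite_measure \<mu>"
    and lim: "\<And>u :: complex \<Rightarrow> real. continuous_on UNIV u \<Longrightarrow> bounded (range u) \<Longrightarrow>
       (\<lambda>N. integral\<^sup>L (zero_measure (q N) N) u) \<longlonglongrightarrow> integral\<^sup>L \<mu> u"
    using \<mu> unfolding weak_star_limit_def by auto
  interpret finite_measure \<mu> by (rule fin)
  have mean_lim: "(\<lambda>N. zero_mean N u) \<longlonglongrightarrow> integral\<^sup>L \<mu> u"
    if u: "continuous_on UNIV u" "\<And>x. \<bar>u x\<bar> \<le> B" for u :: "complex \<Rightarrow> real" and B
  proof (rule Lim_transform_eventually[OF lim[OF u(1)]])
    show "bounded (range u)" using u(2) by (auto simp: bounded_iff)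
    show "\<forall>\<^sub>F N in sequentially. integral\<^sup>L (zero_measure (q N) N) u = zero_mean N u"
      using borel_measurable_continuous_onI[OF u(1)]
      by (intro eventually_sequentiallyI[of 1]) (simp add: integral_eq_zero_mean)
  qed
  have star_ne: "star r \<noteq> {}" using star_iff[of 0 r] by auto
  \<comment> \<open>A bounded continuous function that vanishes exactly on the star. Its means over
    the zeros are 0, hence so is its integral, and the limit measure is carried by the star.\<close>
  define \<delta> where "\<delta> x = min 1 (infdist x (star r))" for x
  have \<delta>_cont: "continuous_on UNIV \<delta>" unfolding \<delta>_def by (intro continuous_intros)
  have \<delta>_bd: "\<bar>\<delta> x\<bar> \<le> 1" "0 \<le> \<delta> x" for x by (auto simp: \<delta>_def infdist_nonneg)
  have "(\<lambda>N. zero_mean N \<delta>) \<longlonglongrightarrow> integral\<^sup>L \<mu> \<delta>" by (rule mean_lim[OF \<delta>_cont \<delta>_bd(1)])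
  moreover have "(\<lambda>N. zero_mean N \<delta>) \<longlonglongrightarrow> 0"
  proof (rule tendsto_eventually, rule eventually_sequentiallyI[of 1])
    fix N :: nat assume N: "1 \<le> N"
    have "zero_mean N \<delta> = zero_mean N (\<lambda>_. 0)"
      by (rule zero_mean_cong) (use zeros_subset_star[OF N] in \<open>simp add: \<delta>_def\<close>)
    then show "zero_mean N \<delta> = 0" using zero_mean_const[OF N] by metis
  qed
  ultimately have "integral\<^sup>L \<mu> \<delta> = 0" by (rule LIMSEQ_unique)
  moreover have "integrable \<mu> \<delta>"
    by (rule integrable_const_bound[where B = 1]) (use \<delta>_bd borel_measurable_continuous_onI[OF \<delta>_cont] in auto)
  ultimately have "AE x in \<mu>. \<delta> x = 0"
    using integral_nonneg_eq_0_iff_AE[of \<mu> \<delta>] \<delta>_bd(2) by auto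
  then have supp: "AE x in \<mu>. x \<in> star r"
  proof (rule AE_mp, intro AE_I2 impI)
    fix x assume "\<delta> x = 0"
    then have "infdist x (star r) = 0" by (auto simp: \<delta>_def min_def split: if_splits)
    then show "x \<in> star r" using in_closed_iff_infdist_zero[OF closed_star star_ne] by blast
  qed
  define d where "d = infdist z (star r)"
  have d: "0 < d" unfolding d_def by (rule infdist_pos_not_in_closed[OF closed_star star_ne z])
  \<comment> \<open>The reciprocal of z - x is its conjugate divided by its squared modulus. Keeping
    the modulus above d, the distance of z from the star, preserves the values on the star and
    bounds the function by 1/d.\<close>
  define k where "k x = cnj (z - x) / of_real ((max (norm (z - x)) d)\<^sup>2)" for x
  have m0: "max (norm (z - x)) d \<noteq> 0" for x using d by (auto simp: max_def)
  have k_cont: "continuous_on UNIV k"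
    unfolding k_def by (intro continuous_intros) (use m0 in auto)
  have k_bd: "norm (k x) \<le> 1 / d" for x
  proof -
    define m where "m = max (norm (z - x)) d"
    have m: "0 < m" "norm (z - x) \<le> m" "d \<le> m" using d by (auto simp: m_def)
    have "norm (k x) = norm (z - x) / m\<^sup>2"
      unfolding k_def m_def[symmetric] norm_divide complex_mod_cnj using m(1) by (simp add: norm_power)
    also have "\<dots> \<le> m / m\<^sup>2" using m by (intro divide_right_mono) auto
    also have "\<dots> = 1 / m" using m by (simp add: power2_eq_square)
    also have "\<dots> \<le> 1 / d" using m d by (intro divide_left_mono) auto
    finally show ?thesis .
  qed
  have k_star: "k x = 1 / (z - x)" if "x \<in> star r" for x
  proof -
    have "d \<le> norm (z - x)" unfolding d_def using infdist_le[OF that, of z] by (simp add: dist_norm)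
    then have "max (norm (z - x)) d = norm (z - x)" by simp
    moreover have "z - x \<noteq> 0" using that z by auto
    ultimately show ?thesis
      unfolding k_def using complex_norm_square[of "z - x"] by (simp add: field_simps)
  qed
  have k_meas: "k \<in> borel_measurable borel" by (rule borel_measurable_continuous_onI[OF k_cont])
  have k_int: "integrable \<mu> k"
    by (rule integrable_const_bound[where B = "1 / d"]) (use k_bd k_meas in auto)
  have "stieltjes \<mu> z = integral\<^sup>L \<mu> k"
    unfolding stieltjes_def
  proof (rule integral_cong_AE)
    show "AE x in \<mu>. 1 / (z - x) = k x" using supp by eventually_elim (simp add: k_star)
    show "(\<lambda>x. 1 / (z - x)) \<in> borel_measurable \<mu>" by measurable
  qed (use k_meas in simp)
  \<comment> \<open>\<open>weak_star_limit\<close> tests against real functions, so the real and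
    imaginary parts of k are treated separately.\<close>
  moreover have "(\<lambda>N. Complex (zero_mean N (\<lambda>x. Re (k x))) (zero_mean N (\<lambda>x. Im (k x)))) \<longlonglongrightarrow>
      Complex (integral\<^sup>L \<mu> (\<lambda>x. Re (k x))) (integral\<^sup>L \<mu> (\<lambda>x. Im (k x)))"
  proof (rule tendsto_Complex)
    show "(\<lambda>N. zero_mean N (\<lambda>x. Re (k x))) \<longlonglongrightarrow> integral\<^sup>L \<mu> (\<lambda>x. Re (k x))"
      by (rule mean_lim) (intro continuous_intros k_cont, rule order_trans[OF abs_Re_le_cmod k_bd])
    show "(\<lambda>N. zero_mean N (\<lambda>x. Im (k x))) \<longlonglongrightarrow> integral\<^sup>L \<mu> (\<lambda>x. Im (k x))"
      by (rule mean_lim) (intro continuous_intros k_cont, rule order_trans[OF abs_Im_le_cmod k_bd])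
  qed
  moreover have "Complex (integral\<^sup>L \<mu> (\<lambda>x. Re (k x))) (integral\<^sup>L \<mu> (\<lambda>x. Im (k x))) = integral\<^sup>L \<mu> k"
    using k_int by (simp add: complex_eq_iff)
  moreover have "\<forall>\<^sub>F N in sequentially. Complex (zero_mean N (\<lambda>x. Re (k x))) (zero_mean N (\<lambda>x. Im (k x))) = zero_mean N (\<lambda>x. 1 / (z - x))"
  proof (rule eventually_sequentiallyI[of 1])
    fix N :: nat assume N: "1 \<le> N"
    have "Complex (zero_mean N (\<lambda>x. Re (k x))) (zero_mean N (\<lambda>x. Im (k x))) = zero_mean N k"
      by (simp add: complex_eq_iff zero_mean_def)
    also have "\<dots> = zero_mean N (\<lambda>x. 1 / (z - x))"
      by (rule zero_mean_cong) (use zeros_subset_star[OF N] k_star in auto)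
    finally show "Complex (zero_mean N (\<lambda>x. Re (k x))) (zero_mean N (\<lambda>x. Im (k x))) = zero_mean N (\<lambda>x. 1 / (z - x))" .
  qed
  ultimately show ?thesis using Lim_transform_eventually by force
qed

lemma zero_mean_tendsto_G:
  assumes z: "z \<notin> star r"
  shows "(\<lambda>N. zero_mean N (\<lambda>x. 1 / (z - x))) \<longlonglongrightarrow> G r \<gamma> c z"
proof -
  have "weak_star_limit (\<lambda>N. zero_measure (q N) N) (limiting_zero_distribution r \<gamma> c)"
    unfolding limiting_zero_distribution_def by (rule someI_ex[OF ex_weak_star_limit])
  then show ?thesis unfolding G_def using z by (rule weak_star_limit_stieltjes)
qed

lemma G_eq:
  assumes z: "z \<notin> star r"
  shows "G r \<gamma> c z = - (1 / of_nat r) * ((of_nat (r + 1) * integral {0..1} (\<phi> (1 / z ^ (r + 1))) - of_nat r) / z)"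
  using zero_mean_tendsto_G[OF z] zero_mean_stieltjes_tendsto[OF z] by (rule LIMSEQ_unique)

text \<open>All zeros lie on the star, at distance at least d from K. The transforms are therefore
  Lipschitz on K with constant 1/d^2 for every N >= 1, which turns pointwise into uniform
  convergence.\<close>

lemma uniform_limit_G:
  assumes K: "compact K" "K \<subseteq> - star r"
  shows "uniform_limit K (\<lambda>N z. 1 / of_nat N * (poly (pderiv (q N)) z / poly (q N) z)) (G r \<gamma> c) sequentially"
proof -
  obtain d where d: "0 < d" "(\<Union>z\<in>K. cball z d) \<subseteq> - star r"
    using compact_subset_open_imp_cball_epsilon_subset[OF K(1) _ K(2)] closed_star by (metis open_Compl)
  have far: "d \<le> norm (z - x)" if "z \<in> K" "x \<in> star r" for z x
  proof (rule ccontr)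
    assume "\<not> d \<le> norm (z - x)"
    then have "x \<in> cball z d" by (simp add: dist_norm)
    then show False using d(2) that by blast
  qed
  have "uniform_limit K (\<lambda>N z. zero_mean N (\<lambda>x. 1 / (z - x))) (G r \<gamma> c) sequentially"
  proof (rule uniform_limit_equi_Lipschitz[where L = "1 / d\<^sup>2", OF K(1)])
    show "\<forall>\<^sub>F N in sequentially. \<forall>z\<in>K. \<forall>z'\<in>K.
        dist (zero_mean N (\<lambda>x. 1 / (z - x))) (zero_mean N (\<lambda>x. 1 / (z' - x))) \<le> 1 / d\<^sup>2 * dist z z'"
    proof (intro eventually_sequentiallyI[of 1] ballI)
      fix N :: nat and z z' assume N: "1 \<le> N" and z: "z \<in> K" "z' \<in> K"
      show "dist (zero_mean N (\<lambda>x. 1 / (z - x))) (zero_mean N (\<lambda>x. 1 / (z' - x))) \<le> 1 / d\<^sup>2 * dist z z'"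
        unfolding dist_norm zero_mean_diff[symmetric]
      proof (rule norm_zero_mean_le[OF N])
        fix x assume "x \<in> zeros N"
        then have x: "x \<in> star r" by (rule zeros_subset_star[OF N])
        have l: "d \<le> norm (z - x)" "d \<le> norm (z' - x)" using far x z by auto
        then have nz: "z - x \<noteq> 0" "z' - x \<noteq> 0" using d(1) by auto
        then have "1 / (z - x) - 1 / (z' - x) = (z' - z) / ((z - x) * (z' - x))"
          by (simp add: divide_simps)
        then have "norm (1 / (z - x) - 1 / (z' - x)) = norm (z - z') / (norm (z - x) * norm (z' - x))"
          by (simp only: norm_divide norm_mult norm_minus_commute)
        also have "\<dots> \<le> norm (z - z') / (d * d)"
          using l d(1) by (intro divide_left_mono mult_mono mult_pos_pos) auto
        finally show "norm (1 / (z - x) - 1 / (z' - x)) \<le> 1 / d\<^sup>2 * norm (z - z')"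
          by (simp add: power2_eq_square)
      qed
    qed
    show "(\<lambda>N. zero_mean N (\<lambda>x. 1 / (z - x))) \<longlonglongrightarrow> G r \<gamma> c z" if "z \<in> K" for z
      using K(2) that by (intro zero_mean_tendsto_G) auto
  qed
  then show ?thesis
    by (rule uniform_limit_cong[THEN iffD1, rotated 2])
      (use K(2) in \<open>auto intro!: eventually_sequentiallyI[of 1] simp: zero_mean_stieltjes subset_iff\<close>)
qed

text \<open>With I the integral of \<phi> over [0, 1], the contour integral is \<gamma> (1 - I), and
  1 - (r+1)(1 - I) = (r+1) I - r is the numerator in \<open>G_eq\<close>.\<close>

lemma G_eq_F_integral:
  assumes z: "z \<notin> star r" and y: "y = z ^ (r + 1)"
  shows "F_integrand r \<gamma> \<alpha> y contour_integrable_on F_path r \<gamma> \<alpha> y"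
    and "G r \<gamma> c z = - (1 / (of_nat r * z)) * (1 - of_real (real (r + 1) / \<gamma>) * F_integral r \<gamma> \<alpha> y)"
proof -
  have "y \<in> D" using z star_iff[of z r] by (simp add: y)
  note F = F_contour_integral[OF this]
  show "F_integrand r \<gamma> \<alpha> y contour_integrable_on F_path r \<gamma> \<alpha> y"
    using F by (rule has_contour_integral_integrable)
  have "F_integral r \<gamma> \<alpha> y = of_real \<gamma> * (1 - integral {0..1} (\<phi> (1 / y)))"
    unfolding F_integral_def using F by (rule contour_integral_unique)
  then have "of_real (real (r + 1) / \<gamma>) * F_integral r \<gamma> \<alpha> y = of_nat (r + 1) * (1 - integral {0..1} (\<phi> (1 / y)))"
    using gamma_pos by simp
  then show "G r \<gamma> c z = - (1 / (of_nat r * z)) * (1 - of_real (real (r + 1) / \<gamma>) * F_integral r \<gamma> \<alpha> y)"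
    unfolding G_eq[OF z] y using off_star(1)[OF z] r_pos by (simp add: field_simps)
qed

end

theorem theorem1p2:
  fixes r :: nat and \<gamma> :: real and \<alpha> :: "nat \<Rightarrow> real" and c :: "nat \<Rightarrow> real"
  assumes "1 \<le> r"
    and "0 < \<gamma>"
    and "\<forall>k\<in>{1..r}. 0 < \<alpha> k"
    and "\<forall>n. 0 < c n"
    and "\<forall>k\<in>{1..r}. ((\<lambda>n. c n / real n powr \<gamma>) \<longlongrightarrow> \<alpha> k)
           (inf sequentially (principal {n. [n = k - 1] (mod r)}))"
  shows "(\<forall>K. compact K \<and> K \<subseteq> - star r \<longrightarrow>
            uniform_limit K
              (\<lambda>N z. 1 / of_nat N * (poly (pderiv (Q r \<gamma> c N N)) z / poly (Q r \<gamma> c N N) z))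
              (G r \<gamma> c) sequentially)
       \<and> (\<forall>z\<in>- star r.
            (\<lambda>t. deriv (\<lambda>w. Phi r \<gamma> c w t) z / Phi r \<gamma> c z t) integrable_on {0..1} \<and>
            G r \<gamma> c z = - (1 / of_nat r) *
              integral {0..1} (\<lambda>t. deriv (\<lambda>w. Phi r \<gamma> c w t) z / Phi r \<gamma> c z t))
       \<and> (\<forall>z\<in>- star r. \<forall>y. y = z ^ (r + 1) \<longrightarrow>
            F_integrand r \<gamma> \<alpha> y contour_integrable_on F_path r \<gamma> \<alpha> y \<and>
            G r \<gamma> c z = - (1 / (of_nat r * z)) *
              (1 - of_real (real (r + 1) / \<gamma>) * F_integral r \<gamma> \<alpha> y))"
proof -
  interpret regular_recurrence r c \<gamma> \<alpha>
    using assms by unfold_locales auto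
  show ?thesis
  proof (intro conjI allI ballI impI)
    fix K assume "compact K \<and> K \<subseteq> - star r"
    then show "uniform_limit K (\<lambda>N z. 1 / of_nat N * (poly (pderiv (Q r \<gamma> c N N)) z / poly (Q r \<gamma> c N N) z))
        (G r \<gamma> c) sequentially"
      by (intro uniform_limit_G) auto
  next
    fix z assume "z \<in> - star r"
    then have z: "z \<notin> star r" by simp
    note I = Phi_integral[OF z]
    show "(\<lambda>t. deriv (\<lambda>w. Phi r \<gamma> c w t) z / Phi r \<gamma> c z t) integrable_on {0..1}"
      using I by (rule has_integral_integrable)
    show "G r \<gamma> c z = - (1 / of_nat r) *
        integral {0..1} (\<lambda>t. deriv (\<lambda>w. Phi r \<gamma> c w t) z / Phi r \<gamma> c z t)"
      unfolding integral_unique[OF I] by (rule G_eq[OF z])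
  next
    fix z y assume "z \<in> - star r" "y = z ^ (r + 1)"
    then show "F_integrand r \<gamma> \<alpha> y contour_integrable_on F_path r \<gamma> \<alpha> y"
      "G r \<gamma> c z = - (1 / (of_nat r * z)) * (1 - of_real (real (r + 1) / \<gamma>) * F_integral r \<gamma> \<alpha> y)"
      using G_eq_F_integral by auto
  qed
qed

end
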